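(* Let $G$ be a (non-trivial) finite simple graph, i.e. a finite simple graph with at least one edge. The monomial cut ideal $I(G)$ is a Freiman ideal if and only if $G$ is (isomorphic to) one of the following graphs: \[ K_2,\quad K_3,\quad P_3,\quad K_2\sqcup K_2,\quad K_2\sqcup K_3,\quad K_2\#_{K_1}K_3. \]
   Context: For a finite simple graph $G$ with vertex set $V(G)$ and edge set $E(G)=\{e_1,\dots,e_m\}$, $m\geq 1$, let $S=K[s_1,\dots,s_m,t_1,\dots,t_m]$ be the standard graded polynomial ring over a field $K$ with one pair of variables $s_i,t_i$ for each edge $e_i$, and let $\mathfrak{m}$ be its graded maximal ideal. For $A\subseteq V(G)$ the cut monomial of $A$ is $u_A=\alpha_1\cdots\alpha_m$, where $\alpha_i=s_i$ if exactly one of the two vertices of $e_i$ belongs to $A$, and $\alpha_i=t_i$ otherwise. The monomial cut ideal of $G$ is $I(G)=\langle u_A: A\subseteq V(G)\rangle\subseteq S$; it is generated in the single degree $m$. For a monomial ideal $J\subseteq S$ let $\mu(J)$ be its minimal number of generators and let the analytic spread $\ell(J)$ be the Krull dimension of the fiber ring $F(J)=\bigoplus_{k\geq 0}J^k/\mathfrak{m}J^k$. A monomial ideal $I$ generated in a single degree always satisfies $\mu(I^2)\geq\ell(I)\mu(I)-\binom{\ell(I)}{2}$; it is called a Freiman ideal if equality $\mu(I^2)=\ell(I)\mu(I)-\binom{\ell(I)}{2}$ holds. $K_k$ is the complete graph on $k$ vertices, $P_3$ is the path on $3$ vertices, $\sqcup$ denotes disjoint union of graphs, and $K_2\#_{K_1}K_3$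 is the graph obtained by gluing an edge $K_2$ and a triangle $K_3$ along exactly one common vertex.
   Formalization: Isolated vertices are disregarded: I(G) is Freiman iff G with its isolated vertices deleted is one of the six graphs; as literally stated the claim fails for K_2 plus an isolated vertex, which has the same cut ideal as K_2. *)

theory Defs
  imports
    "HOL-Algebra.QuotRing"
    "HOL-Algebra.Ideal_Product"
    "HOL-Library.Poly_Mapping"
    "HOL-Library.Extended_Nat"
begin

section \<open>Finite simple graphs\<close>

type_synonym 'a ugraph = "'a set \<times> 'a set set"

abbreviation verts :: "'a ugraph \<Rightarrow> 'a set" where "verts \<equiv> fst"
abbreviation edges :: "'a ugraph \<Rightarrow> 'a set set" where "edges \<equiv> snd"

definition simple_graph :: "'a ugraph \<Rightarrow> bool" where
  "simple_graph G \<longleftrightarrow> finite (verts G) \<and> (\<forall>e\<in>edges G. e \<subseteq> verts G \<and> card e = 2)"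

definition graph_iso :: "'a ugraph \<Rightarrow> 'b ugraph \<Rightarrow> bool" where
  "graph_iso G H \<longleftrightarrow> (\<exists>f. bij_betw f (verts G) (verts H) \<and>
     (\<forall>u\<in>verts G. \<forall>v\<in>verts G. {u, v} \<in> edges G \<longleftrightarrow> {f u, f v} \<in> edges H))"

definition complete_graph :: "'a set \<Rightarrow> 'a ugraph" where
  "complete_graph A = (A, {e. e \<subseteq> A \<and> card e = 2})"

abbreviation K_graph :: "nat \<Rightarrow> nat ugraph" where
  "K_graph k \<equiv> complete_graph {..<k}"

definition path_graph :: "nat \<Rightarrow> nat ugraph" where
  "path_graph n = ({..<n}, {{i, Suc i} | i. Suc i < n})"

definition graph_disjoint_union :: "'a ugraph \<Rightarrow> 'b ugraph \<Rightarrow> ('a + 'b) ugraph" where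
  "graph_disjoint_union G H =
     (Inl ` verts G \<union> Inr ` verts H, image Inl ` edges G \<union> image Inr ` edges H)"

text \<open>An edge and a triangle glued at a vertex: the two complete graphs below share exactly
  the vertex 1.\<close>

definition K2_glue_K3 :: "nat ugraph" where
  "K2_glue_K3 =
     (verts (complete_graph {0, 1}) \<union> verts (complete_graph {1, 2, 3}),
      edges (complete_graph {0, 1}) \<union> edges (complete_graph {1, 2, 3}))"

text \<open>Isolated vertices do not affect the cut ideal (for instance \<open>K\<^sub>2\<close> and \<open>K\<^sub>2\<close> plus an
  isolated vertex have the same one), so a classification of graphs through their cut ideals
  is a classification up to isolated vertices.\<close>

definition delete_isolated :: "'a ugraph \<Rightarrow> 'a ugraph" where
  "delete_isolated G = ({v \<in> verts G. \<exists>e\<in>edges G. v \<in> e}, edges G)"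

lemma delete_isolated_id:
  assumes "\<forall>v\<in>verts G. \<exists>e\<in>edges G. v \<in> e"
  shows "delete_isolated G = G"
  using assms by (cases G) (auto simp: delete_isolated_def)


section \<open>Polynomial rings and monomial ideals\<close>

type_synonym ('v, 'k) mpoly = "('v \<Rightarrow>\<^sub>0 nat) \<Rightarrow>\<^sub>0 'k"

definition mpoly_ring :: "'v set \<Rightarrow> ('v, 'k::field) mpoly ring" where
  "mpoly_ring V =
     \<lparr>carrier = {p. \<forall>m\<in>Poly_Mapping.keys p. Poly_Mapping.keys m \<subseteq> V},
      mult = (*), one = 1, zero = 0, add = (+)\<rparr>"

lemma mpoly_ring_cring: "cring (mpoly_ring V :: ('v, 'k::field) mpoly ring)"
proof (rule cringI)
  let ?R = "mpoly_ring V :: ('v, 'k) mpoly ring"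
  have carr: "p \<in> carrier ?R \<longleftrightarrow> (\<forall>m\<in>Poly_Mapping.keys p. Poly_Mapping.keys m \<subseteq> V)" for p
    by (simp add: mpoly_ring_def)
  have ops: "p \<oplus>\<^bsub>?R\<^esub> q = p + q" "p \<otimes>\<^bsub>?R\<^esub> q = p * q" "\<zero>\<^bsub>?R\<^esub> = 0" "\<one>\<^bsub>?R\<^esub> = 1" for p q
    by (simp_all add: mpoly_ring_def)
  have zero: "0 \<in> carrier ?R" and one: "1 \<in> carrier ?R"
    by (simp_all add: carr)
  have plus: "p + q \<in> carrier ?R" if "p \<in> carrier ?R" "q \<in> carrier ?R" for p q
    using that keys_add[of p q] unfolding carr by blast
  have neg: "- p \<in> carrier ?R" if "p \<in> carrier ?R" for p
    using that by (simp add: carr)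
  have times: "p * q \<in> carrier ?R" if "p \<in> carrier ?R" "q \<in> carrier ?R" for p q
    unfolding carr
  proof
    fix m assume "m \<in> Poly_Mapping.keys (p * q)"
    then obtain a b where m: "m = a + b" "a \<in> Poly_Mapping.keys p" "b \<in> Poly_Mapping.keys q"
      using keys_mult[of p q] by blast
    then have "Poly_Mapping.keys a \<subseteq> V" "Poly_Mapping.keys b \<subseteq> V"
      using that unfolding carr by blast+
    then show "Poly_Mapping.keys m \<subseteq> V"
      using keys_add[of a b] m(1) by blast
  qed
  show "abelian_group ?R"
  proof (rule abelian_groupI, goal_cases)
    case (6 x)
    then show ?case by (intro bexI[OF _ neg[OF 6]]) (simp add: ops)
  qed (unfold ops, (rule plus zero add.assoc add.commute add_0_left | assumption)+)
  show "Group.comm_monoid ?R"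
    by (rule comm_monoidI; unfold ops)
       (rule times one mult.assoc mult.commute mult_1_left | assumption)+
qed (simp add: mpoly_ring_def distrib_right)

definition mpoly_var :: "'v \<Rightarrow> ('v, 'k::field) mpoly" where
  "mpoly_var v = Poly_Mapping.single (Poly_Mapping.single v 1) 1"

definition graded_maximal_ideal :: "'v set \<Rightarrow> ('v, 'k::field) mpoly set" where
  "graded_maximal_ideal V = Idl\<^bsub>mpoly_ring V\<^esub> (mpoly_var ` V)"

definition monomials_of_degree :: "'v set \<Rightarrow> nat \<Rightarrow> ('v, 'k::field) mpoly set" where
  "monomials_of_degree V d =
     {Poly_Mapping.single m 1 | m. Poly_Mapping.keys m \<subseteq> V \<and>
        (\<Sum>v\<in>Poly_Mapping.keys m. Poly_Mapping.lookup m v) = d}"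

definition equigenerated_monomial_ideal :: "'v set \<Rightarrow> ('v, 'k::field) mpoly set \<Rightarrow> bool" where
  "equigenerated_monomial_ideal V J \<longleftrightarrow>
     (\<exists>d A. A \<subseteq> monomials_of_degree V d \<and> J = Idl\<^bsub>mpoly_ring V\<^esub> A)"

abbreviation ideal_pow :: "('a, 'b) ring_scheme \<Rightarrow> 'a set \<Rightarrow> nat \<Rightarrow> 'a set" where
  "ideal_pow R J k \<equiv> J [^]\<^bsub>ideals_set R\<^esub> k"

definition min_num_gens :: "('a, 'b) ring_scheme \<Rightarrow> 'a set \<Rightarrow> nat" where
  "min_num_gens R J =
     (LEAST n. \<exists>A. finite A \<and> card A = n \<and> A \<subseteq> carrier R \<and> Idl\<^bsub>R\<^esub> A = J)"


section \<open>Krull dimension, fiber ring, Freiman ideals\<close>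

definition krull_dim :: "('a, 'b) ring_scheme \<Rightarrow> enat" where
  "krull_dim R = Sup {enat n | n. \<exists>P. (\<forall>i\<le>n. primeideal (P i) R) \<and> (\<forall>i<n. P i \<subset> P (Suc i))}"

text \<open>The ring \<open>\<Oplus>\<^sub>k J\<^sup>k / M J\<^sup>k\<close>. An element is the sequence of its homogeneous components, the
  \<open>k\<close>-th one being a coset of \<open>M J\<^sup>k\<close> contained in \<open>J\<^sup>k\<close>. The product of components of degrees
  \<open>i\<close> and \<open>k - i\<close> is \<open>(a + M J\<^sup>i) (b + M J\<^bsup>k-i\<^esup>) = a b + M J\<^sup>k\<close>, which is what
  \<^const>\<open>rcoset_mult\<close> modulo \<open>M J\<^sup>k\<close> computes on these sets.\<close>

definition fiber_ring ::
  "('a, 'b) ring_scheme \<Rightarrow> 'a set \<Rightarrow> 'a set \<Rightarrow> (nat \<Rightarrow> 'a set) ring" where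
  "fiber_ring R M J =
     (let N = (\<lambda>k. M \<cdot>\<^bsub>R\<^esub> ideal_pow R J k) in
      \<lparr>carrier = {f. (\<forall>k. \<exists>a\<in>ideal_pow R J k. f k = N k +>\<^bsub>R\<^esub> a) \<and> finite {k. f k \<noteq> N k}},
       mult = (\<lambda>f g k. \<Oplus>\<^bsub>R Quot N k\<^esub>i\<in>{..k}. rcoset_mult R (N k) (f i) (g (k - i))),
       one = (\<lambda>k. if k = 0 then N 0 +>\<^bsub>R\<^esub> \<one>\<^bsub>R\<^esub> else N k),
       zero = N,
       add = (\<lambda>f g k. f k <+>\<^bsub>R\<^esub> g k)\<rparr>)"

definition analytic_spread :: "'v set \<Rightarrow> ('v, 'k::field) mpoly set \<Rightarrow> enat" where
  "analytic_spread V J = krull_dim (fiber_ring (mpoly_ring V) (graded_maximal_ideal V) J)"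

definition freiman_ideal :: "'v set \<Rightarrow> ('v, 'k::field) mpoly set \<Rightarrow> bool" where
  "freiman_ideal V J \<longleftrightarrow>
     equigenerated_monomial_ideal V J \<and>
     (\<exists>l::nat. analytic_spread V J = enat l \<and>
        int (min_num_gens (mpoly_ring V) (ideal_pow (mpoly_ring V) J 2)) =
        int l * int (min_num_gens (mpoly_ring V) J) - int (l choose 2))"


section \<open>Monomial cut ideals\<close>

datatype 'e cut_var = Var_s 'e | Var_t 'e

definition cut_vars :: "'a ugraph \<Rightarrow> 'a set cut_var set" where
  "cut_vars G = Var_s ` edges G \<union> Var_t ` edges G"

definition cut_monomial :: "'a ugraph \<Rightarrow> 'a set \<Rightarrow> ('a set cut_var, 'k::field) mpoly" where
  "cut_monomial G A =
     (\<Prod>e\<in>edges G. mpoly_var (if card (e \<inter> A) = 1 then Var_s e else Var_t e))"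

definition cut_ideal :: "'a ugraph \<Rightarrow> ('a set cut_var, 'k::field) mpoly set" where
  "cut_ideal G = Idl\<^bsub>mpoly_ring (cut_vars G)\<^esub> {cut_monomial G A | A. A \<subseteq> verts G}"

end

theory Submission
  imports Defs
begin

text \<open>Let \<open>X\<close> be the set of exponent vectors of the cut monomials of a graph with \<open>m\<close> edges,
  and \<open>X + X\<close> the set of sums of two of them. The generators have one degree, so
  \<open>\<mu>(I) = |X|\<close> and \<open>\<mu>(I\<^sup>2) = |X + X|\<close> (\<open>min_num_gens_monomial_ideal\<close>), and
  the fiber ring is the semigroup ring of the monoid generated by \<open>X\<close>
  (\<open>equigenerated.analytic_spread_eq\<close>). The theorem thus becomes a statement about sums of
  cut vectors.

  The Krull dimension is at most \<open>m + 1\<close>: choosing one element in each step of a chain of primes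
  gives algebraically independent elements, and the number of monomials in them is bounded by the
  number of \<open>k\<close>-fold sums of \<open>X\<close>, which is at most \<open>(k + 1)\<^sup>m\<close>
  (\<open>krull_dim_semigroup_ring_le\<close>). Because \<open>D N - (D choose 2)\<close> increases in \<open>D\<close> up to \<open>N\<close>,
  \<open>I(G)\<close> is not Freiman as soon as the excess \<open>|X + X| - D |X| + (D choose 2)\<close> is positive for
  \<open>D = dim span X\<close>; and \<open>D\<close> is at least \<open>m + 1\<close>, since for an edge \<open>uv\<close> the cuts of \<open>u\<close>, of \<open>v\<close>,
  of \<open>uv\<close> and the empty cut combine to twice the unit vector of the edge.

  The decisive point is \<open>excess_mono\<close>: the excess of a set in convex position does not
  increase when points are removed. Vectors with entries 0 and 1 are in convex position, so a
  single subset of \<open>X\<close> with positive excess suffices. Splitting the vertices into four classes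
  yields the eight cuts that are unions of classes; their excess depends only on the quotient graph
  on the four classes, and it is positive for every connected graph on four vertices except the
  triangle with a pendant edge (\<open>not_freiman_if_bad_quotient\<close>). Identifying one vertex of each
  component of \<open>G\<close> changes no cut and makes the graph connected. If at least five vertices remain,
  they can be merged into five, and every connected graph on five vertices has two vertices whose
  identification gives one of the bad quotients (\<open>bad_identification\<close>). If at most four remain, the
  quotient has one or two edges, or is a triangle, or a triangle with a pendant edge, and undoing
  the identification gives the six graphs of the theorem.

  Conversely, for these graphs the eight or fewer cut vectors are listed and their sums counted,
  and \<open>m + 1\<close> is attained as Krull dimension by the primes belonging to a flag of faces
  (\<open>krull_dim_semigroup_ring_ge\<close>).\<close>

abbreviation keys :: "('b \<Rightarrow>\<^sub>0 'c::zero) \<Rightarrow> 'b set" where "keys \<equiv> Poly_Mapping.keys"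
abbreviation lookup :: "('b \<Rightarrow>\<^sub>0 'c::zero) \<Rightarrow> 'b \<Rightarrow> 'c" where "lookup \<equiv> Poly_Mapping.lookup"
abbreviation single :: "'b \<Rightarrow> 'c \<Rightarrow> 'b \<Rightarrow>\<^sub>0 'c::zero" where "single \<equiv> Poly_Mapping.single"

section \<open>Monomials and polynomials\<close>

lemma keys_add_nat: "keys (a + b :: 'v \<Rightarrow>\<^sub>0 nat) = keys a \<union> keys b"
  by (auto simp: in_keys_iff lookup_add)

text \<open>Multiplying leading terms without an order on the variables: the variables are treated one at a time,
  and only the monomials with the largest exponent of the current variable are kept. Every other
  representation of \<open>a + b\<close> would have to reach both maxima as well.\<close>

lemma unique_sum_aux:
  fixes K L :: "('v \<Rightarrow>\<^sub>0 nat) set"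
  assumes "finite W" "finite K" "finite L" "K \<noteq> {}" "L \<noteq> {}"
    and "\<And>a a' v. a \<in> K \<Longrightarrow> a' \<in> K \<Longrightarrow> v \<notin> W \<Longrightarrow> lookup a v = lookup a' v"
    and "\<And>a a' v. a \<in> L \<Longrightarrow> a' \<in> L \<Longrightarrow> v \<notin> W \<Longrightarrow> lookup a v = lookup a' v"
  shows "\<exists>a\<in>K. \<exists>b\<in>L. \<forall>a'\<in>K. \<forall>b'\<in>L. a' + b' = a + b \<longrightarrow> a' = a \<and> b' = b"
  using assms
proof (induction W arbitrary: K L rule: finite_induct)
  case empty
  obtain a b where "a \<in> K" "b \<in> L" using empty by blast
  moreover have "a' = a" if "a' \<in> K" for a'
    by (rule poly_mapping_eqI) (rule empty.prems(5)[OF that \<open>a \<in> K\<close>], simp)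
  moreover have "b' = b" if "b' \<in> L" for b'
    by (rule poly_mapping_eqI) (rule empty.prems(6)[OF that \<open>b \<in> L\<close>], simp)
  ultimately show ?case by blast
next
  case (insert v W)
  \<comment> \<open>The elements with the largest exponent of \<open>v\<close>.\<close>
  let ?top = "\<lambda>K. {a \<in> K. \<forall>a'\<in>K. lookup a' v \<le> lookup a v}"
  have top: "?top K \<noteq> {}" if "finite K" "K \<noteq> {}" for K :: "('v \<Rightarrow>\<^sub>0 nat) set"
  proof -
    have "Max ((\<lambda>a. lookup a v) ` K) \<in> (\<lambda>a. lookup a v) ` K"
      using that by (intro Max_in) auto
    then obtain a where "a \<in> K" "lookup a v = Max ((\<lambda>a. lookup a v) ` K)" by auto
    then have "a \<in> ?top K" using that by simp
    then show ?thesis by blast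
  qed
  have agree: "lookup a u = lookup a' u"
    if "a \<in> ?top K" "a' \<in> ?top K" "u \<notin> W"
      "\<And>a a' v'. a \<in> K \<Longrightarrow> a' \<in> K \<Longrightarrow> v' \<notin> insert v W \<Longrightarrow> lookup a v' = lookup a' v'"
    for K :: "('v \<Rightarrow>\<^sub>0 nat) set" and a a' u
    using that by (cases "u = v") (auto intro: order.antisym)
  have "\<exists>a\<in>?top K. \<exists>b\<in>?top L. \<forall>a'\<in>?top K. \<forall>b'\<in>?top L. a' + b' = a + b \<longrightarrow> a' = a \<and> b' = b"
  proof (rule insert.IH)
    show "?top K \<noteq> {}" "?top L \<noteq> {}" using top insert.prems by blast+
    show "lookup a u = lookup a' u" if "a \<in> ?top K" "a' \<in> ?top K" "u \<notin> W" for a a' u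
      by (rule agree[OF that insert.prems(5)])
    show "lookup a u = lookup a' u" if "a \<in> ?top L" "a' \<in> ?top L" "u \<notin> W" for a a' u
      by (rule agree[OF that insert.prems(6)])
  qed (use insert.prems in auto)
  then obtain a b where ab: "a \<in> ?top K" "b \<in> ?top L"
    "\<And>a' b'. a' \<in> ?top K \<Longrightarrow> b' \<in> ?top L \<Longrightarrow> a' + b' = a + b \<Longrightarrow> a' = a \<and> b' = b"
    by blast
  have "a' = a \<and> b' = b" if "a' \<in> K" "b' \<in> L" "a' + b' = a + b" for a' b'
  proof (rule ab(3)[OF _ _ that(3)])
    have "lookup a' v + lookup b' v = lookup a v + lookup b v"
      using that(3) by (metis lookup_add)
    moreover have "lookup a' v \<le> lookup a v" "lookup b' v \<le> lookup b v"
      using ab(1,2) that by auto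
    ultimately have "lookup a' v = lookup a v" "lookup b' v = lookup b v" by linarith+
    then show "a' \<in> ?top K" "b' \<in> ?top L" using ab(1,2) that by auto
  qed
  then show ?case using ab(1,2) by blast
qed

lemma unique_sum:
  fixes K L :: "('v \<Rightarrow>\<^sub>0 nat) set"
  assumes "finite K" "finite L" "K \<noteq> {}" "L \<noteq> {}"
  obtains a b where "a \<in> K" "b \<in> L"
    "\<And>a' b'. a' \<in> K \<Longrightarrow> b' \<in> L \<Longrightarrow> a' + b' = a + b \<Longrightarrow> a' = a \<and> b' = b"
proof -
  let ?W = "\<Union>(keys ` (K \<union> L))"
  have fin: "finite ?W" using assms by simp
  have zero: "lookup a v = 0" if "a \<in> K \<union> L" "v \<notin> ?W" for a v
    using that by (auto simp: in_keys_iff)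
  have "\<exists>a\<in>K. \<exists>b\<in>L. \<forall>a'\<in>K. \<forall>b'\<in>L. a' + b' = a + b \<longrightarrow> a' = a \<and> b' = b"
  proof (rule unique_sum_aux[OF fin assms])
    show "lookup a v = lookup a' v" if "a \<in> K" "a' \<in> K" "v \<notin> ?W" for a a' v
      using zero[of a v] zero[of a' v] that by auto
    show "lookup a v = lookup a' v" if "a \<in> L" "a' \<in> L" "v \<notin> ?W" for a a' v
      using zero[of a v] zero[of a' v] that by auto
  qed
  then obtain a b where ab: "a \<in> K" "b \<in> L"
    "\<forall>a'\<in>K. \<forall>b'\<in>L. a' + b' = a + b \<longrightarrow> a' = a \<and> b' = b"
    by blast
  show ?thesis
    by (rule that[OF ab(1,2)]) (rule ab(3)[rule_format])
qed

lemma sum_single_keys: "(\<Sum>m\<in>keys p. single m (lookup p m)) = (p :: 'b \<Rightarrow>\<^sub>0 'c::comm_monoid_add)"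
proof (rule poly_mapping_eqI)
  fix k
  show "lookup (\<Sum>m\<in>keys p. single m (lookup p m)) k = lookup p k"
    by (auto simp: lookup_sum lookup_single when_def in_keys_iff)
qed

text \<open>Additive statements about polynomials reduce to single terms.\<close>

lemma poly_induct_keys [consumes 1, case_names zero single add]:
  fixes p :: "'b \<Rightarrow>\<^sub>0 'c::comm_monoid_add"
  assumes "keys p \<subseteq> S" and "P 0" and "\<And>m c. m \<in> S \<Longrightarrow> P (single m c)"
    and "\<And>p q. P p \<Longrightarrow> P q \<Longrightarrow> P (p + q)"
  shows "P p"
proof -
  have "P (\<Sum>m\<in>F. single m (lookup p m))" if "finite F" "F \<subseteq> S" for F
    using that by (induction F rule: finite_induct) (auto intro: assms)
  from this[OF finite_keys assms(1)] show ?thesis by (simp only: sum_single_keys)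
qed

lemma times_eq_sum_single:
  fixes p q :: "'b::monoid_add \<Rightarrow>\<^sub>0 'c::semiring_0"
  shows "p * q = (\<Sum>a\<in>keys p. \<Sum>b\<in>keys q. single (a + b) (lookup p a * lookup q b))"
  by (subst sum_single_keys[of p, symmetric], subst sum_single_keys[of q, symmetric])
     (simp add: sum_product mult_single)

lemma lookup_times:
  fixes p q :: "'b::monoid_add \<Rightarrow>\<^sub>0 'c::semiring_0"
  shows "lookup (p * q) k =
    (\<Sum>a\<in>keys p. \<Sum>b\<in>keys q. if a + b = k then lookup p a * lookup q b else 0)"
  by (simp add: times_eq_sum_single lookup_sum lookup_single when_def)

text \<open>If \<open>a + b\<close> arises in only one way from the two supports, no cancellation can occur there.\<close>

lemma lookup_times_unique:
  fixes p q :: "'b::monoid_add \<Rightarrow>\<^sub>0 'c::semiring_0"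
  assumes "a \<in> keys p" "b \<in> keys q"
    and "\<And>a' b'. a' \<in> keys p \<Longrightarrow> b' \<in> keys q \<Longrightarrow> a' + b' = a + b \<Longrightarrow> a' = a \<and> b' = b"
  shows "lookup (p * q) (a + b) = lookup p a * lookup q b"
proof -
  have "lookup (p * q) (a + b) =
    (\<Sum>a'\<in>keys p. \<Sum>b'\<in>keys q. if a' = a then if b' = b then lookup p a * lookup q b else 0 else 0)"
    unfolding lookup_times
  proof (intro sum.cong refl)
    fix a' b' assume "a' \<in> keys p" "b' \<in> keys q"
    then show "(if a' + b' = a + b then lookup p a' * lookup q b' else 0) =
      (if a' = a then if b' = b then lookup p a * lookup q b else 0 else 0)"
      using assms(3)[of a' b'] by (simp split: if_splits) metis
  qed
  also have "\<dots> = (\<Sum>a'\<in>keys p. if a' = a then lookup p a * lookup q b else 0)"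
    using assms(2) by (intro sum.cong refl) simp
  also have "\<dots> = lookup p a * lookup q b"
    using assms(1) by simp
  finally show ?thesis .
qed

lift_definition restrict_keys :: "'b set \<Rightarrow> ('b \<Rightarrow>\<^sub>0 'c::zero) \<Rightarrow> 'b \<Rightarrow>\<^sub>0 'c"
  is "\<lambda>S f k. if k \<in> S then f k else 0"
  by (erule rev_finite_subset) auto

lemma lookup_restrict_keys: "lookup (restrict_keys S p) k = (if k \<in> S then lookup p k else 0)"
  by transfer simp

lemma keys_restrict_keys: "keys (restrict_keys S p) = keys p \<inter> S"
  by (auto simp: in_keys_iff lookup_restrict_keys split: if_splits)

lemma restrict_keys_add:
  "restrict_keys S (p + q) = restrict_keys S p + restrict_keys S (q :: 'b \<Rightarrow>\<^sub>0 'c::monoid_add)"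
  by (rule poly_mapping_eqI) (simp add: lookup_restrict_keys lookup_add)

lemma restrict_keys_zero [simp]: "restrict_keys S 0 = 0"
  by (rule poly_mapping_eqI) (simp add: lookup_restrict_keys)

lemma restrict_keys_single:
  "restrict_keys S (single m c) = (if m \<in> S then single m c else 0)"
  by (rule poly_mapping_eqI) (auto simp: lookup_restrict_keys lookup_single when_def)

lemma restrict_keys_id: "keys p \<subseteq> S \<Longrightarrow> restrict_keys S p = p"
  by (rule poly_mapping_eqI) (auto simp: lookup_restrict_keys in_keys_iff)

lemma restrict_keys_sum:
  "restrict_keys S (\<Sum>i\<in>I. f i) = (\<Sum>i\<in>I. restrict_keys S (f i :: 'b \<Rightarrow>\<^sub>0 'c::comm_monoid_add))"
  by (rule poly_mapping_eqI) (simp add: lookup_restrict_keys lookup_sum)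

section \<open>Subrings of a commutative ring type as ring records\<close>

definition ring_on :: "'r::comm_ring_1 set \<Rightarrow> 'r ring" where
  "ring_on S = \<lparr>carrier = S, mult = (*), one = 1, zero = 0, add = (+)\<rparr>"

lemma ring_on_simps [simp]:
  "carrier (ring_on S) = S" "x \<otimes>\<^bsub>ring_on S\<^esub> y = x * y" "x \<oplus>\<^bsub>ring_on S\<^esub> y = x + y"
  "\<one>\<^bsub>ring_on S\<^esub> = 1" "\<zero>\<^bsub>ring_on S\<^esub> = 0"
  by (simp_all add: ring_on_def)

lemma cring_ring_on:
  assumes "1 \<in> S" "\<And>x y. x \<in> S \<Longrightarrow> y \<in> S \<Longrightarrow> x + y \<in> S" "\<And>x. x \<in> S \<Longrightarrow> - x \<in> S"
    "\<And>x y. x \<in> S \<Longrightarrow> y \<in> S \<Longrightarrow> x * y \<in> S"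
  shows "cring (ring_on S)"
proof (rule cringI)
  have zero: "0 \<in> S" using assms(2)[OF assms(1) assms(3)[OF assms(1)]] by simp
  show "abelian_group (ring_on S)"
  proof (rule abelian_groupI)
    fix x assume "x \<in> carrier (ring_on S)"
    then show "\<exists>y\<in>carrier (ring_on S). y \<oplus>\<^bsub>ring_on S\<^esub> x = \<zero>\<^bsub>ring_on S\<^esub>"
      using assms(3)[of x] by (intro bexI[of _ "- x"]) simp_all
  qed (auto simp: zero assms add.assoc add.commute)
  show "Group.comm_monoid (ring_on S)"
    by (rule comm_monoidI) (auto simp: assms mult.assoc mult.commute)
qed (auto simp: distrib_right)

lemma ideal_ring_onI:
  assumes "cring (ring_on S)" "I \<subseteq> S" "0 \<in> I" "\<And>x y. x \<in> I \<Longrightarrow> y \<in> I \<Longrightarrow> x + y \<in> I"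
    "\<And>x r. x \<in> I \<Longrightarrow> r \<in> S \<Longrightarrow> r * x \<in> I"
  shows "ideal I (ring_on S)"
proof (rule idealI)
  interpret cring "ring_on S" by fact
  show "ring (ring_on S)" by (rule ring_axioms)
  have minus: "\<ominus>\<^bsub>ring_on S\<^esub> x \<in> I" if "x \<in> I" for x
  proof -
    have "\<ominus>\<^bsub>ring_on S\<^esub> x = (\<ominus>\<^bsub>ring_on S\<^esub> \<one>\<^bsub>ring_on S\<^esub>) \<otimes>\<^bsub>ring_on S\<^esub> x"
      using l_minus[of "\<one>\<^bsub>ring_on S\<^esub>" x] assms(2) that one_closed by auto
    also have "\<dots> \<in> I"
      using assms(5)[OF that] a_inv_closed[OF one_closed] by simp
    finally show ?thesis .
  qed
  show "subgroup I (add_monoid (ring_on S))"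
    by (rule group.subgroupI[OF add.group_axioms])
       (use assms minus in \<open>auto simp: a_inv_def\<close>)
qed (use assms in \<open>auto simp: mult.commute\<close>)

lemma primeideal_ring_onI:
  assumes "cring (ring_on S)" "ideal P (ring_on S)" "1 \<notin> P" "1 \<in> S"
    "\<And>x y. x \<in> S \<Longrightarrow> y \<in> S \<Longrightarrow> x * y \<in> P \<Longrightarrow> x \<in> P \<or> y \<in> P"
  shows "primeideal P (ring_on S)"
  by (rule primeidealI) (use assms in auto)

lemma mpoly_ring_eq: "mpoly_ring V = ring_on {p. \<forall>m\<in>keys p. keys m \<subseteq> V}"
  by (simp add: mpoly_ring_def ring_on_def)

lemma mpoly_ring_simps [simp]:
  "x \<otimes>\<^bsub>mpoly_ring V\<^esub> y = x * y" "x \<oplus>\<^bsub>mpoly_ring V\<^esub> y = x + y"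
  "\<one>\<^bsub>mpoly_ring V\<^esub> = 1" "\<zero>\<^bsub>mpoly_ring V\<^esub> = 0"
  by (simp_all add: mpoly_ring_def)

lemma carrier_mpoly_ring: "carrier (mpoly_ring V) = {p. \<forall>m\<in>keys p. keys m \<subseteq> V}"
  by (simp add: mpoly_ring_def)

section \<open>Monomial ideals\<close>

text \<open>The ideal is described through its members, so that membership is a condition on each monomial
  separately; \<open>genideal_monomials\<close> identifies it with the ideal generated by the monomials in \<open>T\<close>.\<close>

definition monomial_ideal :: "'v set \<Rightarrow> ('v \<Rightarrow>\<^sub>0 nat) set \<Rightarrow> ('v, 'k::field) mpoly set" where
  "monomial_ideal V T = {p. \<forall>m\<in>keys p. keys m \<subseteq> V \<and> (\<exists>a\<in>T. \<exists>b. m = a + b)}"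

definition sumset :: "'b::plus set \<Rightarrow> 'b set \<Rightarrow> 'b set" where
  "sumset S T = {a + b | a b. a \<in> S \<and> b \<in> T}"

primrec nsums :: "nat \<Rightarrow> 'b::comm_monoid_add set \<Rightarrow> 'b set" where
  "nsums 0 T = {0}"
| "nsums (Suc k) T = sumset (nsums k T) T"

lemma ideal_monomial_ideal: "ideal (monomial_ideal V T :: ('v, 'k::field) mpoly set) (mpoly_ring V)"
  unfolding mpoly_ring_eq
proof (rule ideal_ring_onI)
  show "cring (ring_on {p :: ('v, 'k) mpoly. \<forall>m\<in>keys p. keys m \<subseteq> V})"
    using mpoly_ring_cring by (simp add: mpoly_ring_eq)
  fix x y :: "('v, 'k) mpoly"
  assume x: "x \<in> monomial_ideal V T"
  show "x + y \<in> monomial_ideal V T" if "y \<in> monomial_ideal V T"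
    using x that keys_add[of x y] by (force simp: monomial_ideal_def)
  show "y * x \<in> monomial_ideal V T" if "y \<in> {p. \<forall>m\<in>keys p. keys m \<subseteq> V}"
    unfolding monomial_ideal_def
  proof (intro CollectI ballI)
    fix m assume "m \<in> keys (y * x)"
    then obtain c d where cd: "m = c + d" "c \<in> keys y" "d \<in> keys x"
      using keys_mult[of y x] by blast
    then obtain a b where "a \<in> T" "d = a + b" "keys d \<subseteq> V"
      using x by (auto simp: monomial_ideal_def)
    moreover have "m = a + (c + b)" using cd calculation by (simp add: ac_simps)
    ultimately show "keys m \<subseteq> V \<and> (\<exists>a\<in>T. \<exists>b. m = a + b)"
      using that cd by (auto simp: keys_add_nat)
  qed
qed (auto simp: monomial_ideal_def)

lemma genideal_monomials:
  assumes "\<And>a. a \<in> T \<Longrightarrow> keys a \<subseteq> V"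
  shows "Idl\<^bsub>mpoly_ring V\<^esub> ((\<lambda>a. single a 1) ` T) = (monomial_ideal V T :: ('v, 'k::field) mpoly set)"
proof (rule antisym)
  interpret cring "mpoly_ring V :: ('v, 'k) mpoly ring" by (rule mpoly_ring_cring)
  let ?A = "(\<lambda>a. single a 1) ` T :: ('v, 'k) mpoly set"
  have A: "?A \<subseteq> carrier (mpoly_ring V)" using assms by (fastforce simp: carrier_mpoly_ring)
  show "Idl\<^bsub>mpoly_ring V\<^esub> ?A \<subseteq> monomial_ideal V T"
  proof (rule genideal_minimal[OF ideal_monomial_ideal])
    show "?A \<subseteq> monomial_ideal V T"
    proof
      fix p :: "('v, 'k) mpoly" assume "p \<in> ?A"
      then obtain a where "a \<in> T" "p = single a 1" by blast
      moreover have "\<exists>a'\<in>T. \<exists>b. a = a' + b"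
        using calculation(1) by (intro bexI[of _ a] exI[of _ 0]) auto
      ultimately show "p \<in> monomial_ideal V T"
        using assms[of a] by (simp add: monomial_ideal_def)
    qed
  qed
  interpret I: ideal "Idl\<^bsub>mpoly_ring V\<^esub> ?A" "mpoly_ring V :: ('v, 'k) mpoly ring"
    by (rule genideal_ideal[OF A])
  show "monomial_ideal V T \<subseteq> Idl\<^bsub>mpoly_ring V\<^esub> ?A"
  proof
    fix p :: "('v, 'k) mpoly" assume p: "p \<in> monomial_ideal V T"
    then have "keys p \<subseteq> {m. keys m \<subseteq> V \<and> (\<exists>a\<in>T. \<exists>b. m = a + b)}"
      by (auto simp: monomial_ideal_def)
    then show "p \<in> Idl\<^bsub>mpoly_ring V\<^esub> ?A"
    proof (induction p rule: poly_induct_keys)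
      case zero then show ?case using I.zero_closed by simp
    next
      case (add p q) then show ?case using I.a_closed[of p q] by simp
    next
      case (single m c)
      then obtain a b where ab: "a \<in> T" "m = a + b" "keys b \<subseteq> V" by (auto simp: keys_add_nat)
      have "single b c \<otimes>\<^bsub>mpoly_ring V\<^esub> single a 1 \<in> Idl\<^bsub>mpoly_ring V\<^esub> ?A"
        by (rule I.I_l_closed) (use ab genideal_self[OF A] in \<open>auto simp: carrier_mpoly_ring\<close>)
      then show ?case by (simp add: mult_single ab add.commute)
    qed
  qed
qed

lemma ideal_prod_monomial_ideal:
  "monomial_ideal V S \<cdot>\<^bsub>mpoly_ring V\<^esub> monomial_ideal V T =
    (monomial_ideal V (sumset S T) :: ('v, 'k::field) mpoly set)"
proof (rule antisym)
  interpret cring "mpoly_ring V :: ('v, 'k) mpoly ring" by (rule mpoly_ring_cring)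
  let ?I = "monomial_ideal V S :: ('v, 'k) mpoly set" and ?J = "monomial_ideal V T :: ('v, 'k) mpoly set"
  let ?IJ = "monomial_ideal V (sumset S T) :: ('v, 'k) mpoly set"
  interpret IJ: ideal ?IJ "mpoly_ring V" by (rule ideal_monomial_ideal)
  show "?I \<cdot>\<^bsub>mpoly_ring V\<^esub> ?J \<subseteq> ?IJ"
  proof
    fix s assume "s \<in> ?I \<cdot>\<^bsub>mpoly_ring V\<^esub> ?J"
    then show "s \<in> ?IJ"
    proof (induction rule: ideal_prod.induct)
      case (sum s1 s2)
      show ?case by (rule IJ.a_closed[OF sum.IH])
    next
      case (prod i j)
      show ?case unfolding monomial_ideal_def
      proof (intro CollectI ballI)
        fix m assume "m \<in> keys (i \<otimes>\<^bsub>mpoly_ring V\<^esub> j)"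
        then obtain c d where cd: "m = c + d" "c \<in> keys i" "d \<in> keys j"
          using keys_mult[of i j] by auto
        moreover obtain a b where "a \<in> S" "c = a + b" "keys c \<subseteq> V"
          using prod(1) cd(2) unfolding monomial_ideal_def by blast
        moreover obtain a' b' where "a' \<in> T" "d = a' + b'" "keys d \<subseteq> V"
          using prod(2) cd(3) unfolding monomial_ideal_def by blast
        moreover have "m = (a + a') + (b + b')" using cd calculation by (simp add: ac_simps)
        moreover have "a + a' \<in> sumset S T" using calculation by (auto simp: sumset_def)
        moreover have "keys m \<subseteq> V" using calculation cd(1) by (simp add: keys_add_nat)
        ultimately show "keys m \<subseteq> V \<and> (\<exists>a\<in>sumset S T. \<exists>b. m = a + b)"
          by blast
      qed
    qed
  qed
  show "?IJ \<subseteq> ?I \<cdot>\<^bsub>mpoly_ring V\<^esub> ?J"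
  proof
    interpret P: ideal "?I \<cdot>\<^bsub>mpoly_ring V\<^esub> ?J" "mpoly_ring V"
      by (intro ideal_prod_is_ideal ideal_monomial_ideal)
    fix p assume "p \<in> ?IJ"
    then have "keys p \<subseteq> {m. keys m \<subseteq> V \<and> (\<exists>a\<in>sumset S T. \<exists>b. m = a + b)}"
      by (auto simp: monomial_ideal_def)
    then show "p \<in> ?I \<cdot>\<^bsub>mpoly_ring V\<^esub> ?J"
    proof (induction p rule: poly_induct_keys)
      case zero then show ?case using P.zero_closed by simp
    next
      case (add p q) then show ?case using P.a_closed[of p q] by simp
    next
      case (single m c)
      then obtain a b d where ab: "a \<in> S" "d \<in> T" "m = (a + d) + b" "keys m \<subseteq> V"
        by (auto simp: sumset_def)
      have "single a 1 \<in> ?I"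
      proof -
        have "\<exists>a'\<in>S. \<exists>b'. a = a' + b'" using ab(1) by (intro bexI[of _ a] exI[of _ 0]) auto
        then show ?thesis using ab(3,4) by (simp add: monomial_ideal_def keys_add_nat)
      qed
      moreover have "single (d + b) c \<in> ?J"
      proof -
        have "\<exists>a'\<in>T. \<exists>b'. d + b = a' + b'" using ab(2) by blast
        then show ?thesis using ab(3,4) by (simp add: monomial_ideal_def keys_add_nat)
      qed
      ultimately have "single a 1 \<otimes>\<^bsub>mpoly_ring V\<^esub> single (d + b) c \<in> ?I \<cdot>\<^bsub>mpoly_ring V\<^esub> ?J"
        by (rule ideal_prod.prod)
      then show ?case by (simp add: mult_single ab add.assoc)
    qed
  qed
qed

lemma monomial_ideal_0: "monomial_ideal V {0} = carrier (mpoly_ring V)"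
  by (auto simp: monomial_ideal_def carrier_mpoly_ring)

text \<open>Powers of the ideal correspond to iterated sumsets of exponents. The zeroth power is the whole ring,
  matching the sumset \<open>{0}\<close>.\<close>

lemma ideal_pow_monomial_ideal:
  "ideal_pow (mpoly_ring V) (monomial_ideal V T :: ('v, 'k::field) mpoly set) k =
    monomial_ideal V (nsums k T)"
proof (induction k)
  case 0
  then show ?case by (simp add: monomial_ideal_0 ideals_set_def nat_pow_def)
next
  case (Suc k)
  have "ideal_pow (mpoly_ring V) (monomial_ideal V T :: ('v, 'k) mpoly set) (Suc k) =
    ideal_pow (mpoly_ring V) (monomial_ideal V T) k \<cdot>\<^bsub>mpoly_ring V\<^esub> monomial_ideal V T"
    by (simp add: nat_pow_def ideals_set_def)
  then show ?case by (simp add: Suc ideal_prod_monomial_ideal)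
qed

lemma graded_maximal_ideal_eq:
  "graded_maximal_ideal V = (monomial_ideal V ((\<lambda>v. single v 1) ` V) :: ('v, 'k::field) mpoly set)"
proof -
  have "(mpoly_var ` V :: ('v, 'k) mpoly set) = (\<lambda>a. single a 1) ` (\<lambda>v. single v 1) ` V"
    by (auto simp: mpoly_var_def)
  then show ?thesis
    unfolding graded_maximal_ideal_def by (simp only:) (rule genideal_monomials, auto)
qed

section \<open>Counting generators of a monomial ideal\<close>

text \<open>Scaling makes sense for every exponent type; it is used for polynomials over the coefficient field
  and also for exponent vectors with rational entries.\<close>

definition pm_scale :: "'k::field \<Rightarrow> ('b \<Rightarrow>\<^sub>0 'k) \<Rightarrow> 'b \<Rightarrow>\<^sub>0 'k" where
  "pm_scale c p = Poly_Mapping.map ((*) c) p"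

lemma lookup_pm_scale [simp]: "lookup (pm_scale c p) k = c * lookup p k"
  by (simp add: pm_scale_def Poly_Mapping.map.rep_eq when_def)

interpretation pm: vector_space "pm_scale :: 'k::field \<Rightarrow> ('b \<Rightarrow>\<^sub>0 'k) \<Rightarrow> _"
  by unfold_locales (auto intro!: poly_mapping_eqI simp: lookup_add algebra_simps)

lemma single_0_mult: "single 0 c * p = pm_scale c (p :: 'b::monoid_add \<Rightarrow>\<^sub>0 'k::field)"
  by (simp add: pm_scale_def mult_map_scale_conv_mult)

lemma subspace_keys: "pm.subspace {p :: 'b \<Rightarrow>\<^sub>0 'k::field. keys p \<subseteq> S}"
proof (rule pm.subspaceI)
  show "x + y \<in> {p. keys p \<subseteq> S}" if "x \<in> {p. keys p \<subseteq> S}" "y \<in> {p. keys p \<subseteq> S}"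
    for x y :: "'b \<Rightarrow>\<^sub>0 'k"
    using that keys_add[of x y] by blast
qed (auto simp: in_keys_iff)

lemma span_singles: "pm.span ((\<lambda>a. single a (1::'k::field)) ` S) = {p :: 'b \<Rightarrow>\<^sub>0 'k. keys p \<subseteq> S}"
proof (rule antisym)
  show "pm.span ((\<lambda>a. single a (1::'k)) ` S) \<subseteq> {p. keys p \<subseteq> S}"
    by (rule pm.span_minimal[OF _ subspace_keys]) auto
  show "{p :: 'b \<Rightarrow>\<^sub>0 'k. keys p \<subseteq> S} \<subseteq> pm.span ((\<lambda>a. single a (1::'k)) ` S)"
  proof
    fix p :: "'b \<Rightarrow>\<^sub>0 'k" assume "p \<in> {p. keys p \<subseteq> S}"
    then have "keys p \<subseteq> S" by simp
    then show "p \<in> pm.span ((\<lambda>a. single a (1::'k)) ` S)"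
    proof (induction p rule: poly_induct_keys)
      case (single m c)
      have "single m c = pm_scale c (single m 1)"
        by (rule poly_mapping_eqI) (simp add: lookup_single when_def)
      then show ?case using single by (auto intro: pm.span_scale pm.span_base)
    qed (auto intro: pm.span_zero pm.span_add)
  qed
qed

lemma inj_single: "inj (\<lambda>a. single a (1::'k::field))"
  by (rule injI) (metis keys_single singleton_inject zero_neq_one)

lemma independent_singles: "pm.independent ((\<lambda>a. single a (1::'k::field)) ` S)"
proof
  assume "pm.dependent ((\<lambda>a. single a (1::'k)) ` S)"
  then obtain a where a: "a \<in> S"
    "single a (1::'k) \<in> pm.span ((\<lambda>a. single a 1) ` S - {single a 1})"
    unfolding pm.dependent_def by blast
  have "(\<lambda>a. single a (1::'k)) ` S - {single a 1} = (\<lambda>a. single a 1) ` (S - {a})"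
    using inj_single by (auto dest: injD)
  then have "keys (single a (1::'k)) \<subseteq> S - {a}"
    using a(2) by (simp add: span_singles)
  then show False by simp
qed

lemma card_le_spanning:
  assumes "finite B" "(\<lambda>a. single a (1::'k::field)) ` S \<subseteq> pm.span B"
  shows "card S \<le> card B"
  using pm.independent_span_bound[OF assms(1) independent_singles assms(2)]
  by (simp add: card_image inj_on_subset[OF inj_single])

text \<open>Minimality of the generating monomials: none divides another one.\<close>

definition antichain :: "'b::monoid_add set \<Rightarrow> bool" where
  "antichain T \<longleftrightarrow> (\<forall>a\<in>T. \<forall>b. a + b \<in> T \<longrightarrow> b = 0)"

lemma restrict_keys_disjoint: "keys p \<inter> S = {} \<Longrightarrow> restrict_keys S p = 0"
  by (rule poly_mapping_eqI) (auto simp: lookup_restrict_keys in_keys_iff)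

lemma restrict_keys_pm_scale: "restrict_keys S (pm_scale c p) = pm_scale c (restrict_keys S p)"
  by (rule poly_mapping_eqI) (simp add: lookup_restrict_keys)

lemma nat_pm_add_eq_0_iff: "a + b = (0 :: 'v \<Rightarrow>\<^sub>0 nat) \<longleftrightarrow> a = 0 \<and> b = 0"
  by (auto simp: poly_mapping_eq_iff fun_eq_iff lookup_add)

text \<open>Modulo the maximal ideal only the constant coefficient of a multiplier survives.\<close>

lemma restrict_keys_mult_antichain:
  fixes q :: "('v, 'k::field) mpoly"
  assumes T: "antichain T" and q: "q \<in> monomial_ideal V T"
  shows "restrict_keys T (r * q) = pm_scale (lookup r 0) (restrict_keys T q)"
proof -
  have "keys r \<subseteq> UNIV" by simp
  then show ?thesis
  proof (induction r rule: poly_induct_keys)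
    case zero
    then show ?case by simp
  next
    case (add r s)
    then show ?case
      by (simp add: restrict_keys_add distrib_right lookup_add pm.scale_left_distrib)
  next
    case (single m c)
    show ?case
    proof (cases "m = 0")
      case True
      then show ?thesis by (simp add: single_0_mult restrict_keys_pm_scale)
    next
      case False
      have "keys (single m c * q) \<inter> T = {}"
      proof (rule ccontr)
        assume "\<not> ?thesis"
        then obtain n where n: "n \<in> keys (single m c * q)" "n \<in> T" by blast
        then obtain d where d: "d \<in> keys q" "n = m + d"
          using keys_mult[of "single m c" q] by (auto split: if_splits)
        then obtain a b where ab: "a \<in> T" "d = a + b"
          using q by (auto simp: monomial_ideal_def)
        then have "a + (m + b) \<in> T" using n d by (simp add: ac_simps)
        then have "m + b = 0" using T ab(1) by (auto simp: antichain_def)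
        then show False using False by (simp add: nat_pm_add_eq_0_iff)
      qed
      then show ?thesis
        using False by (simp add: restrict_keys_disjoint lookup_single)
    qed
  qed
qed

text \<open>The quotient of the ideal by its product with the maximal ideal has the monomials in \<open>T\<close> as a basis.
  Concretely, restricting the members of any generating set to the monomials in \<open>T\<close> yields a spanning set of
  a space of dimension \<open>card T\<close>, because multipliers act there through their constant coefficients.\<close>

lemma min_num_gens_monomial_ideal:
  fixes T :: "('v \<Rightarrow>\<^sub>0 nat) set"
  assumes "finite T" "antichain T" "\<And>a. a \<in> T \<Longrightarrow> keys a \<subseteq> V"
  shows "min_num_gens (mpoly_ring V) (monomial_ideal V T :: ('v, 'k::field) mpoly set) = card T"
  unfolding min_num_gens_def
proof (rule Least_equality)
  let ?R = "mpoly_ring V :: ('v, 'k) mpoly ring"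
  let ?J = "monomial_ideal V T :: ('v, 'k) mpoly set"
  let ?X = "(\<lambda>a. single a 1) ` T :: ('v, 'k) mpoly set"
  have "?X \<subseteq> carrier ?R"
    using assms(3) by (fastforce simp: carrier_mpoly_ring)
  then show "\<exists>A. finite A \<and> card A = card T \<and> A \<subseteq> carrier ?R \<and> Idl\<^bsub>?R\<^esub> A = ?J"
    using assms genideal_monomials[OF assms(3), where 'k = 'k]
    by (intro exI[of _ ?X]) (auto simp: card_image inj_on_subset[OF inj_single])
  fix n assume "\<exists>A. finite A \<and> card A = n \<and> A \<subseteq> carrier ?R \<and> Idl\<^bsub>?R\<^esub> A = ?J"
  then obtain A where A: "finite A" "card A = n" "A \<subseteq> carrier ?R" "Idl\<^bsub>?R\<^esub> A = ?J"
    by blast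
  interpret cring ?R by (rule mpoly_ring_cring)
  interpret J: ideal ?J ?R by (rule ideal_monomial_ideal)
  let ?S = "{q \<in> ?J. restrict_keys T q \<in> pm.span (restrict_keys T ` A)}"
  have "ideal ?S ?R"
    unfolding mpoly_ring_eq
  proof (rule ideal_ring_onI)
    show "cring (ring_on {p :: ('v, 'k) mpoly. \<forall>m\<in>keys p. keys m \<subseteq> V})"
      using mpoly_ring_cring by (simp add: mpoly_ring_eq)
    show "?S \<subseteq> {p. \<forall>m\<in>keys p. keys m \<subseteq> V}"
      by (auto simp: monomial_ideal_def)
    show "0 \<in> ?S" using J.zero_closed by (simp add: pm.span_zero)
    fix x y assume x: "x \<in> ?S"
    show "x + y \<in> ?S" if "y \<in> ?S"
      using J.a_closed[of x y] x that by (simp add: restrict_keys_add pm.span_add)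
    show "y * x \<in> ?S" if "y \<in> {p. \<forall>m\<in>keys p. keys m \<subseteq> V}"
      using J.I_l_closed[of x y] x that restrict_keys_mult_antichain[OF assms(2), of x V y]
      by (simp add: pm.span_scale carrier_mpoly_ring)
  qed
  moreover have "A \<subseteq> ?S"
    using genideal_self[OF A(3)] A(4) by (auto intro: pm.span_base)
  ultimately have "?J \<subseteq> ?S"
    using genideal_minimal[of ?S A] A(4) by simp
  moreover have "single a 1 \<in> ?J" if "a \<in> T" for a
    using that genideal_self[OF \<open>?X \<subseteq> carrier ?R\<close>] genideal_monomials[OF assms(3), where 'k = 'k]
    by auto
  ultimately have "restrict_keys T (single a (1::'k)) \<in> pm.span (restrict_keys T ` A)"
    if "a \<in> T" for a
    using that by blast
  then have "(\<lambda>a. single a (1::'k)) ` T \<subseteq> pm.span (restrict_keys T ` A)"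
    by (auto simp: restrict_keys_single)
  then have "card T \<le> card (restrict_keys T ` A)"
    using A(1) by (intro card_le_spanning) auto
  also have "\<dots> \<le> n" using card_image_le[OF A(1)] A(2) by simp
  finally show "card T \<le> n" .
qed

section \<open>The fiber ring as a semigroup ring\<close>

definition mdeg :: "('v \<Rightarrow>\<^sub>0 nat) \<Rightarrow> nat" where
  "mdeg m = (\<Sum>v\<in>keys m. lookup m v)"

lemma mdeg_add: "mdeg (a + b) = mdeg a + mdeg b"
  unfolding mdeg_def by (rule setsum_keys_plus_distrib) auto

lemma mdeg_0 [simp]: "mdeg 0 = 0"
  by (simp add: mdeg_def)

lemma mdeg_eq_0_iff: "mdeg m = 0 \<longleftrightarrow> m = 0"
proof
  assume "mdeg m = 0"
  then have "\<forall>v\<in>keys m. lookup m v = 0" by (simp add: mdeg_def)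
  then show "m = 0" by (intro poly_mapping_eqI) (auto simp: in_keys_iff)
qed simp

lemma antichain_mdeg:
  assumes "\<And>a. a \<in> T \<Longrightarrow> mdeg a = d"
  shows "antichain T"
  unfolding antichain_def
proof (intro ballI allI impI)
  fix a b assume "a \<in> T" "a + b \<in> T"
  then have "mdeg a + mdeg b = mdeg a" using assms by (metis mdeg_add)
  then show "b = 0" by (simp add: mdeg_eq_0_iff)
qed

lemma nsums_mdeg:
  assumes "\<And>a. a \<in> T \<Longrightarrow> mdeg a = d" and "m \<in> nsums k T"
  shows "mdeg m = k * d"
  using assms(2) by (induction k arbitrary: m) (auto simp: sumset_def mdeg_add assms(1))

lemma nsums_keys:
  assumes "\<And>a. a \<in> T \<Longrightarrow> keys (a :: 'v \<Rightarrow>\<^sub>0 nat) \<subseteq> V" and "m \<in> nsums k T"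
  shows "keys m \<subseteq> V"
  using assms(2)
proof (induction k arbitrary: m)
  case (Suc k)
  then obtain a b where "m = a + b" "a \<in> nsums k T" "b \<in> T" by (auto simp: sumset_def)
  then show ?case using Suc.IH[of a] assms(1)[of b] by (simp add: keys_add_nat)
qed simp

lemma nsums_add:
  assumes "a \<in> nsums i T" "b \<in> nsums j T"
  shows "a + b \<in> nsums (i + j) T"
  using assms(2)
proof (induction j arbitrary: b)
  case 0
  then show ?case using assms(1) by simp
next
  case (Suc j)
  then obtain c d where "b = c + d" "c \<in> nsums j T" "d \<in> T" by (auto simp: sumset_def)
  then show ?case using Suc.IH[of c] by (auto simp: sumset_def add.assoc[symmetric])
qed

definition monoid_of :: "'b::comm_monoid_add set \<Rightarrow> 'b set" where
  "monoid_of T = (\<Union>k. nsums k T)"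

lemma monoid_of_0: "0 \<in> monoid_of T"
proof -
  have "0 \<in> nsums 0 T" by simp
  then show ?thesis unfolding monoid_of_def by blast
qed

lemma monoid_of_add: "a \<in> monoid_of T \<Longrightarrow> b \<in> monoid_of T \<Longrightarrow> a + b \<in> monoid_of T"
  unfolding monoid_of_def using nsums_add by blast

lemma monoid_of_base: "a \<in> T \<Longrightarrow> a \<in> monoid_of T"
proof -
  assume "a \<in> T"
  then have "a \<in> nsums (Suc 0) T" by (auto simp: sumset_def)
  then show ?thesis unfolding monoid_of_def by blast
qed

definition semigroup_ring :: "('v \<Rightarrow>\<^sub>0 nat) set \<Rightarrow> ('v, 'k::field) mpoly ring" where
  "semigroup_ring T = ring_on {p. keys p \<subseteq> monoid_of T}"

lemma cring_semigroup_ring: "cring (semigroup_ring T :: ('v, 'k::field) mpoly ring)"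
  unfolding semigroup_ring_def
proof (rule cring_ring_on)
  fix x y :: "('v, 'k) mpoly"
  assume xy: "x \<in> {p. keys p \<subseteq> monoid_of T}" "y \<in> {p. keys p \<subseteq> monoid_of T}"
  show "x + y \<in> {p. keys p \<subseteq> monoid_of T}"
    using xy keys_add[of x y] by auto
  show "x * y \<in> {p. keys p \<subseteq> monoid_of T}"
    using xy keys_mult[of x y] monoid_of_add by blast
qed (auto simp: monoid_of_0)

lemma a_inv_mpoly_ring:
  assumes "x \<in> carrier (mpoly_ring V)"
  shows "\<ominus>\<^bsub>mpoly_ring V\<^esub> x = - (x :: ('v, 'k::field) mpoly)"
proof -
  interpret cring "mpoly_ring V :: ('v, 'k) mpoly ring" by (rule mpoly_ring_cring)
  have "- x \<in> carrier (mpoly_ring V)" using assms by (simp add: carrier_mpoly_ring)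
  then show ?thesis using minus_equality[of "- x" x] assms by simp
qed

lemma a_minus_mpoly_ring:
  assumes "x \<in> carrier (mpoly_ring V)" "y \<in> carrier (mpoly_ring V)"
  shows "x \<ominus>\<^bsub>mpoly_ring V\<^esub> y = x - (y :: ('v, 'k::field) mpoly)"
  by (simp add: a_minus_def a_inv_mpoly_ring[OF assms(2)])

lemma finsum_mpoly_ring:
  assumes "finite A" "\<And>i. i \<in> A \<Longrightarrow> f i \<in> carrier (mpoly_ring V)"
  shows "finsum (mpoly_ring V) f A = (\<Sum>i\<in>A. f i :: ('v, 'k::field) mpoly)"
proof -
  interpret cring "mpoly_ring V :: ('v, 'k) mpoly ring" by (rule mpoly_ring_cring)
  show ?thesis
    using assms by (induction A rule: finite_induct) (auto simp: Pi_def)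
qed

text \<open>The parameter \<open>k_type\<close> only carries the coefficient field, which the exponents do not mention.\<close>

locale equigenerated =
  fixes V :: "'v set" and T :: "('v \<Rightarrow>\<^sub>0 nat) set" and d :: nat and k_type :: "'k::field itself"
  assumes T_keys: "\<And>a. a \<in> T \<Longrightarrow> keys a \<subseteq> V" and T_deg: "\<And>a. a \<in> T \<Longrightarrow> mdeg a = d"
    and d_pos: "d > 0"
begin

abbreviation R :: "('v, 'k) mpoly ring" where "R \<equiv> mpoly_ring V"

text \<open>The powers \<open>J k\<close> of the ideal, and \<open>N k\<close> which is \<open>J k\<close> times the graded maximal ideal.\<close>

definition J :: "nat \<Rightarrow> ('v, 'k) mpoly set" where
  "J k = monomial_ideal V (nsums k T)"

definition N :: "nat \<Rightarrow> ('v, 'k) mpoly set" where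
  "N k = monomial_ideal V (sumset ((\<lambda>v. single v 1) ` V) (nsums k T))"

definition F :: "(nat \<Rightarrow> ('v, 'k) mpoly set) ring" where
  "F = fiber_ring R (graded_maximal_ideal V) (monomial_ideal V T)"

abbreviation head :: "nat \<Rightarrow> ('v, 'k) mpoly \<Rightarrow> ('v, 'k) mpoly" where
  "head k \<equiv> restrict_keys (nsums k T)"

lemma cring_R: "cring R" by (rule mpoly_ring_cring)

lemma ideal_N: "ideal (N k) R" unfolding N_def by (rule ideal_monomial_ideal)
lemma ideal_J: "ideal (J k) R" unfolding J_def by (rule ideal_monomial_ideal)

lemma J_carrier: "p \<in> J k \<Longrightarrow> p \<in> carrier R"
  by (auto simp: J_def monomial_ideal_def carrier_mpoly_ring)
lemma N_carrier: "p \<in> N k \<Longrightarrow> p \<in> carrier R"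
  by (auto simp: N_def monomial_ideal_def carrier_mpoly_ring)

lemma F_eq: "F =
  \<lparr>carrier = {f. (\<forall>k. \<exists>a\<in>J k. f k = N k +>\<^bsub>R\<^esub> a) \<and> finite {k. f k \<noteq> N k}},
   mult = (\<lambda>f g k. \<Oplus>\<^bsub>R Quot N k\<^esub>i\<in>{..k}. rcoset_mult R (N k) (f i) (g (k - i))),
   one = (\<lambda>k. if k = 0 then N 0 +>\<^bsub>R\<^esub> \<one>\<^bsub>R\<^esub> else N k),
   zero = N,
   add = (\<lambda>f g k. f k <+>\<^bsub>R\<^esub> g k)\<rparr>"
proof -
  have J: "ideal_pow R (monomial_ideal V T) k = J k" for k
    by (simp add: ideal_pow_monomial_ideal J_def)
  have N: "graded_maximal_ideal V \<cdot>\<^bsub>R\<^esub> J k = N k" for k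
    by (simp add: graded_maximal_ideal_eq ideal_prod_monomial_ideal N_def J_def)
  show ?thesis unfolding F_def fiber_ring_def Let_def J N ..
qed

text \<open>All monomials of \<open>N k\<close> have degree larger than \<open>k d\<close>. Together with \<open>minus_head_N\<close> below, this makes
  the part of a polynomial supported on \<open>k\<close>-fold sums a canonical representative of its coset.\<close>

lemma head_N: "p \<in> N k \<Longrightarrow> head k p = 0"
proof (rule restrict_keys_disjoint, rule ccontr)
  assume p: "p \<in> N k" and "keys p \<inter> nsums k T \<noteq> {}"
  then obtain m where m: "m \<in> keys p" "m \<in> nsums k T" by blast
  then obtain v a b where "m = (single v 1 + a) + b" "a \<in> nsums k T"
    using p by (auto simp: N_def monomial_ideal_def sumset_def)
  then have "mdeg m = 1 + k * d + mdeg b"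
    using nsums_mdeg[OF T_deg, where k = k] by (simp add: mdeg_add) (simp add: mdeg_def)
  then show False using nsums_mdeg[OF T_deg m(2)] by simp
qed

lemma head_J: "keys p \<subseteq> nsums k T \<Longrightarrow> p \<in> J k"
proof -
  assume p: "keys p \<subseteq> nsums k T"
  have "keys m \<subseteq> V \<and> (\<exists>a\<in>nsums k T. \<exists>b. m = a + b)" if "m \<in> keys p" for m
  proof
    have m: "m \<in> nsums k T" using p that by blast
    show "keys m \<subseteq> V" using nsums_keys[OF T_keys m] by simp
    show "\<exists>a\<in>nsums k T. \<exists>b. m = a + b" using m by (intro bexI[of _ m] exI[of _ 0]) auto
  qed
  then show ?thesis by (simp add: J_def monomial_ideal_def)
qed

text \<open>A monomial of \<open>J k\<close> that is not a sum of \<open>k\<close> generators is a proper multiple of such a sum,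
  hence divisible by one more variable.\<close>

lemma minus_head_N:
  assumes "p \<in> J k"
  shows "p - head k p \<in> N k"
  unfolding N_def monomial_ideal_def
proof (intro CollectI ballI)
  fix m assume "m \<in> keys (p - head k p)"
  then have m: "m \<in> keys p" "m \<notin> nsums k T"
    by (auto simp: in_keys_iff lookup_minus lookup_restrict_keys split: if_splits)
  then obtain a b where ab: "a \<in> nsums k T" "m = a + b" and mV: "keys m \<subseteq> V"
    using assms by (auto simp: J_def monomial_ideal_def)
  have "b \<noteq> 0" using m ab by auto
  then obtain v where v: "v \<in> keys b" by (metis all_not_in_conv keys_eq_empty)
  have "b = single v 1 + (b - single v 1)"
    using v by (intro poly_mapping_eqI) (auto simp: lookup_add lookup_minus lookup_single when_def in_keys_iff)
  then have "m = (single v 1 + a) + (b - single v 1)"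
    using ab by (metis add.assoc add.commute)
  moreover have "v \<in> V" using mV ab v by (auto simp: keys_add_nat)
  ultimately show "keys m \<subseteq> V \<and> (\<exists>a\<in>sumset ((\<lambda>v. single v 1) ` V) (nsums k T). \<exists>b. m = a + b)"
    using mV ab(1) by (auto simp: sumset_def)
qed

lemma coset_eq_iff:
  assumes "a \<in> carrier R" "b \<in> carrier R"
  shows "N k +>\<^bsub>R\<^esub> a = N k +>\<^bsub>R\<^esub> b \<longleftrightarrow> a - b \<in> N k"
proof -
  interpret cring R by (rule cring_R)
  show ?thesis
    using quotient_eq_iff_same_a_r_cos[OF ideal_N assms] by (simp add: a_minus_mpoly_ring assms)
qed

lemma coset_zero: "N k +>\<^bsub>R\<^esub> 0 = N k"
proof -
  interpret cring R by (rule cring_R)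
  interpret ideal "N k" R by (rule ideal_N)
  show ?thesis using a_rcos_const[OF zero_closed] by simp
qed

lemma mult_N_J: "a \<in> N i \<Longrightarrow> b \<in> J j \<Longrightarrow> a * b \<in> N (i + j)"
proof -
  assume "a \<in> N i" "b \<in> J j"
  then have "a \<otimes>\<^bsub>R\<^esub> b \<in> N i \<cdot>\<^bsub>R\<^esub> J j" by (rule ideal_prod.prod)
  then have "a * b \<in> monomial_ideal V (sumset (sumset ((\<lambda>v. single v 1) ` V) (nsums i T)) (nsums j T))"
    by (simp add: N_def J_def ideal_prod_monomial_ideal)
  moreover have "monomial_ideal V (sumset (sumset ((\<lambda>v. single v 1) ` V) (nsums i T)) (nsums j T)) \<subseteq>
    (N (i + j) :: ('v, 'k) mpoly set)"
  proof -
    have "sumset (sumset ((\<lambda>v. single v 1) ` V) (nsums i T)) (nsums j T) \<subseteq>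
      sumset ((\<lambda>v. single v 1) ` V) (nsums (i + j) T)"
    proof
      fix x assume "x \<in> sumset (sumset ((\<lambda>v. single v 1) ` V) (nsums i T)) (nsums j T)"
      then obtain v a b where "x = (v + a) + b" "v \<in> (\<lambda>v. single v 1) ` V" "a \<in> nsums i T" "b \<in> nsums j T"
        unfolding sumset_def by blast
      then have "x = v + (a + b)" "v \<in> (\<lambda>v. single v 1) ` V" "a + b \<in> nsums (i + j) T"
        by (auto simp: add.assoc nsums_add)
      then show "x \<in> sumset ((\<lambda>v. single v 1) ` V) (nsums (i + j) T)"
        unfolding sumset_def by blast
    qed
    then show ?thesis unfolding N_def monomial_ideal_def by blast
  qed
  ultimately show ?thesis by blast
qed

lemma N_subset_J: "N k \<subseteq> J k"
  unfolding N_def J_def monomial_ideal_def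
proof (intro subsetI CollectI ballI)
  fix p :: "('v, 'k) mpoly" and m
  assume "p \<in> {p. \<forall>m\<in>keys p. keys m \<subseteq> V \<and>
    (\<exists>a\<in>sumset ((\<lambda>v. single v 1) ` V) (nsums k T). \<exists>b. m = a + b)}" "m \<in> keys p"
  then obtain v a b where "keys m \<subseteq> V" "m = (v + a) + b" "a \<in> nsums k T"
    unfolding sumset_def by blast
  then have "m = a + (v + b)" by (simp add: ac_simps)
  then show "keys m \<subseteq> V \<and> (\<exists>a\<in>nsums k T. \<exists>b. m = a + b)"
    using \<open>keys m \<subseteq> V\<close> \<open>a \<in> nsums k T\<close> by blast
qed

text \<open>The product of a coset modulo \<open>N i\<close> and a coset modulo \<open>N j\<close> is a single coset modulo
  \<open>N (i + j)\<close>, because an element of \<open>N i\<close> times an element of \<open>J j\<close> lies in \<open>N (i + j)\<close>.\<close>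

lemma rcoset_mult_cosets:
  assumes "a \<in> J i" "b \<in> J j"
  shows "rcoset_mult R (N (i + j)) (N i +>\<^bsub>R\<^esub> a) (N j +>\<^bsub>R\<^esub> b) = N (i + j) +>\<^bsub>R\<^esub> (a * b)"
proof -
  interpret cring R by (rule cring_R)
  have eq: "N (i + j) +>\<^bsub>R\<^esub> (a' \<otimes>\<^bsub>R\<^esub> b') = N (i + j) +>\<^bsub>R\<^esub> (a * b)"
    if a': "a' \<in> N i +>\<^bsub>R\<^esub> a" and b': "b' \<in> N j +>\<^bsub>R\<^esub> b" for a' b'
  proof -
    obtain x where x: "x \<in> N i" "a' = x + a" using a' by (auto simp: a_r_coset_def')
    obtain y where y: "y \<in> N j" "b' = y + b" using b' by (auto simp: a_r_coset_def')
    have xy: "x \<in> carrier R" "y \<in> carrier R" "a \<in> carrier R" "b \<in> carrier R"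
      using x y assms N_carrier J_carrier by auto
    have carr: "a' \<in> carrier R" "b' \<in> carrier R"
      using x(2) y(2) a_closed[of x a] a_closed[of y b] xy by simp_all
    interpret Nij: ideal "N (i + j)" R by (rule ideal_N)
    have bJ: "b' \<in> J j"
      using additive_subgroup.a_closed[OF ideal.axioms(1)[OF ideal_J], of y j b] y assms(2) N_subset_J
      by auto
    have "a' * b' - a * b = x * b' + y * a" by (simp add: x y algebra_simps)
    moreover have "x * b' + y * a \<in> N (i + j)"
    proof -
      have "y * a \<in> N (i + j)"
        using mult_N_J[OF y(1) assms(1)] by (simp only: add.commute[of j i])
      then show ?thesis
        using Nij.a_closed[OF mult_N_J[OF x(1) bJ], of "y * a"] by (simp only: mpoly_ring_simps)
    qed
    ultimately have "a' * b' - a * b \<in> N (i + j)" by simp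
    moreover have "a' * b' \<in> carrier R" "a * b \<in> carrier R"
      using m_closed[OF carr] m_closed[OF xy(3,4)] by simp_all
    ultimately show ?thesis by (simp add: coset_eq_iff)
  qed
  have "a \<in> N i +>\<^bsub>R\<^esub> a" "b \<in> N j +>\<^bsub>R\<^esub> b"
    using ideal.axioms(1)[OF ideal_N] assms J_carrier
    by (auto intro!: abelian_subgroup.a_rcos_self abelian_subgroupI3 is_abelian_group)
  then show ?thesis unfolding rcoset_mult_def using eq by blast
qed

text \<open>The isomorphism from the semigroup ring to the fiber ring: the component of degree \<open>k\<close> is the coset of the
  part supported on \<open>k\<close>-fold sums.\<close>

definition \<phi> :: "('v, 'k) mpoly \<Rightarrow> nat \<Rightarrow> ('v, 'k) mpoly set" where
  "\<phi> p k = N k +>\<^bsub>R\<^esub> head k p"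

lemma head_in_J: "head k p \<in> J k"
  by (rule head_J) (auto simp: keys_restrict_keys)

text \<open>By degree, a monomial of the semigroup ring is a \<open>k\<close>-fold sum for exactly one \<open>k\<close>, so the semigroup ring
  is graded by \<open>k\<close>.\<close>

lemma head_mult:
  assumes "keys p \<subseteq> monoid_of T" "keys q \<subseteq> monoid_of T"
  shows "head k (p * q) = (\<Sum>i\<le>k. head i p * head (k - i) q)"
  using assms(1)
proof (induction p rule: poly_induct_keys)
  case (single m c)
  show ?case using assms(2)
  proof (induction q rule: poly_induct_keys)
    case single': (single n e)
    obtain i j where ij: "m \<in> nsums i T" "n \<in> nsums j T"
      using single single' by (auto simp: monoid_of_def)
    have unique: "k = l" if "x \<in> nsums k T" "x \<in> nsums l T" for x k l
      using nsums_mdeg[OF T_deg that(1)] nsums_mdeg[OF T_deg that(2)] d_pos by simp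
    have m: "m \<in> nsums l T \<longleftrightarrow> l = i" and n: "n \<in> nsums l T \<longleftrightarrow> l = j" 
      and mn: "m + n \<in> nsums l T \<longleftrightarrow> l = i + j" for l
      using unique ij nsums_add[OF ij] by blast+
    have "(\<Sum>l\<le>k. head l (single m c) * head (k - l) (single n e)) =
      (\<Sum>l\<le>k. if l = i then if k - i = j then single (m + n) (c * e) else 0 else 0)"
      by (intro sum.cong refl) (simp add: restrict_keys_single m n mult_single)
    also have "\<dots> = head k (single m c * single n e)"
      by (auto simp: mult_single restrict_keys_single mn)
    finally show ?case by simp
  qed (simp_all add: distrib_left restrict_keys_add sum.distrib)
qed (simp_all add: distrib_right restrict_keys_add sum.distrib)

lemma finite_head: 
  assumes "keys p \<subseteq> monoid_of T"
  shows "finite {k. head k p \<noteq> 0}"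
proof (rule finite_subset)
  show "{k. head k p \<noteq> 0} \<subseteq> (\<lambda>m. mdeg m div d) ` keys p"
  proof
    fix k assume "k \<in> {k. head k p \<noteq> 0}"
    then obtain m where "m \<in> keys p" "m \<in> nsums k T"
      using restrict_keys_disjoint[of p "nsums k T"] by auto
    then show "k \<in> (\<lambda>m. mdeg m div d) ` keys p"
      using nsums_mdeg[OF T_deg, where m = m and k = k] d_pos by force
  qed
qed simp

lemma \<phi>_hom: "\<phi> \<in> ring_hom (semigroup_ring T) F"
proof (rule ring_hom_memI)
  interpret cring R by (rule cring_R)
  fix x y :: "('v, 'k) mpoly"
  assume "x \<in> carrier (semigroup_ring T)"
  then have x: "keys x \<subseteq> monoid_of T" by (simp add: semigroup_ring_def)
  show "\<phi> x \<in> carrier F"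
  proof -
    have "{k. \<phi> x k \<noteq> N k} \<subseteq> {k. head k x \<noteq> 0}" by (auto simp: \<phi>_def coset_zero)
    then show ?thesis using finite_head[OF x] head_in_J finite_subset
      by (auto simp: F_eq \<phi>_def)
  qed
  assume "y \<in> carrier (semigroup_ring T)"
  then have y: "keys y \<subseteq> monoid_of T" by (simp add: semigroup_ring_def)
  show "\<phi> (x \<oplus>\<^bsub>semigroup_ring T\<^esub> y) = \<phi> x \<oplus>\<^bsub>F\<^esub> \<phi> y"
  proof
    fix k
    have "(N k +>\<^bsub>R\<^esub> head k x) <+>\<^bsub>R\<^esub> (N k +>\<^bsub>R\<^esub> head k y) = N k +>\<^bsub>R\<^esub> (head k x + head k y)"
      using ideal.a_rcos_sum[OF ideal_N J_carrier[OF head_in_J] J_carrier[OF head_in_J]] by simp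
    then show "\<phi> (x \<oplus>\<^bsub>semigroup_ring T\<^esub> y) k = (\<phi> x \<oplus>\<^bsub>F\<^esub> \<phi> y) k"
      by (simp add: F_eq \<phi>_def semigroup_ring_def restrict_keys_add)
  qed
  show "\<phi> (x \<otimes>\<^bsub>semigroup_ring T\<^esub> y) = \<phi> x \<otimes>\<^bsub>F\<^esub> \<phi> y"
  proof
    fix k
    interpret h: ring_hom_cring R "R Quot N k" "(+>\<^bsub>R\<^esub>) (N k)"
      by (rule ideal.rcos_ring_hom_cring[OF ideal_N cring_R])
    have carr: "head i x * head j y \<in> carrier R" for i j
      using m_closed[OF J_carrier[OF head_in_J[of i x]] J_carrier[OF head_in_J[of j y]]] by simp
    have "(\<phi> x \<otimes>\<^bsub>F\<^esub> \<phi> y) k =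
      (\<Oplus>\<^bsub>R Quot N k\<^esub>i\<in>{..k}. rcoset_mult R (N k) (\<phi> x i) (\<phi> y (k - i)))"
      by (simp add: F_eq)
    also have "\<dots> = (\<Oplus>\<^bsub>R Quot N k\<^esub>i\<in>{..k}. N k +>\<^bsub>R\<^esub> (head i x * head (k - i) y))"
    proof (rule h.S.finsum_cong')
      show "rcoset_mult R (N k) (\<phi> x i) (\<phi> y (k - i)) = N k +>\<^bsub>R\<^esub> (head i x * head (k - i) y)"
        if "i \<in> {..k}" for i
        using rcoset_mult_cosets[OF head_in_J[of i x] head_in_J[of "k - i" y]] that by (simp add: \<phi>_def)
    qed (use h.hom_closed carr in auto)
    also have "\<dots> = N k +>\<^bsub>R\<^esub> finsum R (\<lambda>i. head i x * head (k - i) y) {..k}"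
      by (subst h.hom_finsum) (use carr in \<open>auto simp: comp_def\<close>)
    also have "\<dots> = \<phi> (x \<otimes>\<^bsub>semigroup_ring T\<^esub> y) k"
      by (simp add: finsum_mpoly_ring carr \<phi>_def semigroup_ring_def head_mult[OF x y])
    finally show "\<phi> (x \<otimes>\<^bsub>semigroup_ring T\<^esub> y) k = (\<phi> x \<otimes>\<^bsub>F\<^esub> \<phi> y) k" by simp
  qed
next
  show "\<phi> \<one>\<^bsub>semigroup_ring T\<^esub> = \<one>\<^bsub>F\<^esub>"
  proof
    fix k
    have "0 \<notin> nsums k T" if "k \<noteq> 0" for k
    proof
      assume "0 \<in> nsums k T"
      from nsums_mdeg[OF T_deg this] show False using that d_pos by simp
    qed
    then have "head k 1 = (if k = 0 then 1 else 0)"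
      using restrict_keys_single[of "nsums k T" 0 "1::'k"] by auto
    then show "\<phi> \<one>\<^bsub>semigroup_ring T\<^esub> k = \<one>\<^bsub>F\<^esub> k"
      by (simp add: \<phi>_def semigroup_ring_def F_eq coset_zero)
  qed
qed

lemma \<phi>_iso: "\<phi> \<in> ring_iso (semigroup_ring T) F"
  unfolding ring_iso_def
proof (intro CollectI conjI \<phi>_hom bij_betw_imageI)
  show "inj_on \<phi> (carrier (semigroup_ring T))"
  proof (rule inj_onI)
    fix p q :: "('v, 'k) mpoly"
    assume "p \<in> carrier (semigroup_ring T)" "q \<in> carrier (semigroup_ring T)" "\<phi> p = \<phi> q"
    then have pq: "keys p \<subseteq> monoid_of T" "keys q \<subseteq> monoid_of T" 
      and eq: "N k +>\<^bsub>R\<^esub> head k p = N k +>\<^bsub>R\<^esub> head k q" for k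
      by (auto simp: semigroup_ring_def \<phi>_def fun_eq_iff)
    have heads: "head k p = head k q" for k
    proof -
      have "head k p - head k q \<in> N k"
        using eq[of k] by (simp add: coset_eq_iff J_carrier[OF head_in_J])
      then have "head k (head k p - head k q) = 0" by (rule head_N)
      then have "lookup (head k p) m = lookup (head k q) m" for m
        by (auto simp: poly_mapping_eq_iff fun_eq_iff lookup_restrict_keys lookup_minus split: if_splits)
      then show ?thesis by (rule poly_mapping_eqI)
    qed
    show "p = q"
    proof (rule poly_mapping_eqI)
      fix m
      show "lookup p m = lookup q m"
      proof (cases "m \<in> monoid_of T")
        case True
        then obtain k where "m \<in> nsums k T" by (auto simp: monoid_of_def)
        then show ?thesis using arg_cong[OF heads[of k], of "\<lambda>x. lookup x m"]
          by (simp add: lookup_restrict_keys)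
      next
        case False
        then show ?thesis using pq by (metis in_keys_iff subsetD)
      qed
    qed
  qed
  show "\<phi> ` carrier (semigroup_ring T) = carrier F"
  proof
    show "\<phi> ` carrier (semigroup_ring T) \<subseteq> carrier F"
      using \<phi>_hom by (auto simp: ring_hom_def)
    show "carrier F \<subseteq> \<phi> ` carrier (semigroup_ring T)"
    proof
      fix f assume "f \<in> carrier F"
      then have "\<forall>k. \<exists>a\<in>J k. f k = N k +>\<^bsub>R\<^esub> a" and fin: "finite {k. f k \<noteq> N k}"
        by (auto simp: F_eq)
      then obtain a where a: "\<And>k. a k \<in> J k" "\<And>k. f k = N k +>\<^bsub>R\<^esub> a k" by metis
      define p where "p = (\<Sum>k | f k \<noteq> N k. head k (a k))"
      have unique: "head k (head l x) = (if k = l then head l x else 0)" for k l x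
      proof (cases "k = l")
        case False
        then have "nsums k T \<inter> nsums l T = {}"
          using nsums_mdeg[OF T_deg, where k = k] nsums_mdeg[OF T_deg, where k = l] d_pos
          by (metis disjoint_iff mult_cancel2 neq0_conv)
        then show ?thesis using False
          by (auto simp: keys_restrict_keys intro!: restrict_keys_disjoint)
      qed (simp add: restrict_keys_id keys_restrict_keys)
      have headp: "head k p = (if f k \<noteq> N k then head k (a k) else 0)" for k
        using fin by (simp add: p_def restrict_keys_sum unique if_distrib[of "head k"])
      have "keys (head k (a k)) \<subseteq> monoid_of T" for k
        by (auto simp: keys_restrict_keys monoid_of_def)
      then have "keys p \<subseteq> monoid_of T"
        unfolding p_def using keys_sum[of "\<lambda>k. head k (a k)" "{k. f k \<noteq> N k}"] by blast
      moreover have "\<phi> p k = f k" for k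
      proof (cases "f k = N k")
        case True
        then show ?thesis by (simp add: \<phi>_def headp coset_zero)
      next
        case False
        have "a k - head k (a k) \<in> N k" by (rule minus_head_N[OF a(1)])
        then have "N k +>\<^bsub>R\<^esub> a k = N k +>\<^bsub>R\<^esub> head k (a k)"
          using coset_eq_iff[OF J_carrier[OF a(1)] J_carrier[OF head_in_J]] by blast
        then show ?thesis using False by (simp add: \<phi>_def headp a(2)[of k])
      qed
      ultimately show "f \<in> \<phi> ` carrier (semigroup_ring T)"
        by (auto simp: semigroup_ring_def fun_eq_iff intro!: image_eqI[of _ _ p])
    qed
  qed
qed

end

text \<open>Preimages of primes under a surjection are prime, and strict inclusions stay strict.\<close>

lemma krull_dim_ring_iso_le:
  assumes "cring A" "cring B" "h \<in> ring_iso A B"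
  shows "krull_dim B \<le> krull_dim A"
proof -
  interpret ring_hom_ring A B h
    using assms by (intro ring_hom_ring.intro ring_hom_ring_axioms.intro) 
      (auto simp: cring_def ring_iso_def)
  have surj: "h ` carrier A = carrier B"
    using assms(3) by (auto simp: ring_iso_def bij_betw_def)
  have sub: "{enat n |n. \<exists>P. (\<forall>i\<le>n. primeideal (P i) B) \<and> (\<forall>i<n. P i \<subset> P (Suc i))}
    \<subseteq> {enat n |n. \<exists>P. (\<forall>i\<le>n. primeideal (P i) A) \<and> (\<forall>i<n. P i \<subset> P (Suc i))}"
  proof clarify
    fix n P assume P: "\<forall>i\<le>n. primeideal (P i) B" "\<forall>i<n. P i \<subset> P (Suc i)"
    let ?Q = "\<lambda>i. {r \<in> carrier A. h r \<in> P i}"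
    have "\<forall>i\<le>n. primeideal (?Q i) A"
      using P(1) primeideal_vimage[OF assms(1)] by blast
    moreover have "?Q i \<subset> ?Q (Suc i)" if "i < n" for i
    proof -
      have "P i \<subset> P (Suc i)" using P(2) that by blast
      then obtain y where y: "y \<in> P (Suc i)" "y \<notin> P i" by blast
      have "primeideal (P (Suc i)) B" using P(1) that by (simp add: Suc_leI)
      then have "y \<in> carrier B" using ideal.Icarr[OF primeideal.axioms(1) y(1)] by blast
      then have "y \<in> h ` carrier A" by (simp only: surj)
      then obtain x where x: "x \<in> carrier A" "y = h x" by (rule imageE)
      have "?Q i \<subseteq> ?Q (Suc i)" using \<open>P i \<subset> P (Suc i)\<close> by (intro Collect_mono) auto
      moreover have "x \<in> ?Q (Suc i)" "x \<notin> ?Q i" using x y by simp_all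
      ultimately show ?thesis by (intro psubsetI) (assumption, metis)
    qed
    ultimately show "\<exists>m. enat n = enat m \<and>
      (\<exists>P. (\<forall>i\<le>m. primeideal (P i) A) \<and> (\<forall>i<m. P i \<subset> P (Suc i)))"
      by (intro exI[of _ n] conjI refl exI[of _ ?Q]) simp_all
  qed
  show ?thesis unfolding krull_dim_def by (rule Sup_subset_mono[OF sub])
qed

lemma krull_dim_ring_iso:
  assumes "cring A" "cring B" "h \<in> ring_iso A B"
  shows "krull_dim B = krull_dim A"
  using krull_dim_ring_iso_le[OF assms] krull_dim_ring_iso_le[OF assms(2,1)]
    ring_iso_set_sym[OF _ assms(3)] assms(1) by (auto simp: cring_def intro: antisym)

lemma (in equigenerated) analytic_spread_eq:
  "analytic_spread V (monomial_ideal V T :: ('v, 'k) mpoly set) =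
    krull_dim (semigroup_ring T :: ('v, 'k) mpoly ring)"
proof -
  have "\<phi> \<zero>\<^bsub>semigroup_ring T\<^esub> = \<zero>\<^bsub>F\<^esub>"
    by (rule ext) (simp add: F_eq \<phi>_def semigroup_ring_def coset_zero)
  then have "F\<lparr>zero := \<phi> \<zero>\<^bsub>semigroup_ring T\<^esub>\<rparr> = F"
    by (simp only:) (cases F, simp)
  then have "cring F"
    using cring.ring_iso_imp_img_cring[OF cring_semigroup_ring \<phi>_iso] by (simp only:)
  then have "krull_dim F = krull_dim (semigroup_ring T :: ('v, 'k) mpoly ring)"
    by (rule krull_dim_ring_iso[OF cring_semigroup_ring _ \<phi>_iso])
  then show ?thesis by (simp only: analytic_spread_def F_def)
qed

section \<open>Krull dimension of a semigroup ring\<close>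

lemma scale_in_semigroup_ring_ideal:
  assumes "ideal I (semigroup_ring T)" "p \<in> I"
  shows "pm_scale c p \<in> (I :: ('v, 'k::field) mpoly set)"
proof -
  have "single 0 c \<in> carrier (semigroup_ring T)"
    by (simp add: semigroup_ring_def monoid_of_0)
  from ideal.I_l_closed[OF assms this] show ?thesis
    by (simp add: semigroup_ring_def single_0_mult)
qed

lemma sum_in_semigroup_ring_ideal:
  assumes "ideal I (semigroup_ring T)" "\<And>i. i \<in> A \<Longrightarrow> f i \<in> (I :: ('v, 'k::field) mpoly set)"
  shows "(\<Sum>i\<in>A. f i) \<in> I"
proof -
  have zero: "0 \<in> I"
    using additive_subgroup.zero_closed[OF ideal.axioms(1)[OF assms(1)]]
    by (simp add: semigroup_ring_def)
  have add: "x + y \<in> I" if "x \<in> I" "y \<in> I" for x y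
    using additive_subgroup.a_closed[OF ideal.axioms(1)[OF assms(1)] that]
    by (simp add: semigroup_ring_def)
  show ?thesis using assms(2)
    by (induction A rule: infinite_finite_induct) (auto intro: zero add)
qed

text \<open>Elements chosen from the successive differences of a chain of primes are algebraically independent.
  The smallest power of \<open>x j\<close> that occurs in a relation can be cancelled modulo the prime \<open>P j\<close>, as
  \<open>x j\<close> is not in it; what remains modulo \<open>x j\<close>, and so modulo \<open>P (Suc j)\<close>, is a relation between the later elements.
  Injectivity of the restriction keeps the exponent vectors distinct when earlier coordinates are dropped.\<close>

lemma prime_chain_independent:
  fixes P :: "nat \<Rightarrow> ('v, 'k::field) mpoly set" and x :: "nat \<Rightarrow> ('v, 'k) mpoly"
  assumes P: "\<And>i. i \<le> n \<Longrightarrow> primeideal (P i) (semigroup_ring T)"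
    and mono: "\<And>i. i < n \<Longrightarrow> P i \<subseteq> P (Suc i)"
    and x: "\<And>i. i < n \<Longrightarrow> x i \<in> P (Suc i)" "\<And>i. i < n \<Longrightarrow> x i \<notin> P i"
    and "j \<le> n" "finite \<Gamma>" "inj_on (\<lambda>\<alpha>. restrict \<alpha> {j..<n}) \<Gamma>"
    and "(\<Sum>\<alpha>\<in>\<Gamma>. pm_scale (c \<alpha>) (\<Prod>i=j..<n. x i ^ \<alpha> i)) \<in> P j"
    and "\<alpha> \<in> \<Gamma>"
  shows "c \<alpha> = 0"
  using assms(5-9)
proof (induction j arbitrary: \<Gamma> \<alpha> rule: inc_induct)
  case base
  have "\<Gamma> = {\<alpha>}"
  proof (rule equalityI; rule subsetI)
    fix \<beta> assume "\<beta> \<in> \<Gamma>"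
    have "restrict \<beta> {n..<n} = restrict \<alpha> {n..<n}" by (simp add: restrict_def)
    then have "\<beta> = \<alpha>" by (rule inj_onD[OF base(2) _ \<open>\<beta> \<in> \<Gamma>\<close> base(4)])
    then show "\<beta> \<in> {\<alpha>}" by simp
  qed (simp add: base(4))
  then have "pm_scale (c \<alpha>) 1 \<in> P n" using base by simp
  then have c1: "pm_scale (inverse (c \<alpha>)) (pm_scale (c \<alpha>) 1) \<in> P n"
    by (rule scale_in_semigroup_ring_ideal[OF primeideal.axioms(1)[OF P[OF order.refl]]])
  show ?case
  proof (rule ccontr)
    assume "c \<alpha> \<noteq> 0"
    then have "1 \<in> P n" using c1 by simp
    then have "P n = carrier (semigroup_ring T)"
      using ideal.one_imp_carrier[OF primeideal.axioms(1)[OF P[OF order.refl]]]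
      by (simp add: semigroup_ring_def)
    then show False using primeideal.I_notcarr[OF P[OF order.refl]] by simp
  qed
next
  case (step j)
  let ?A = "semigroup_ring T :: ('v, 'k) mpoly ring"
  interpret Pj: primeideal "P j" ?A using P step.hyps by simp
  interpret Pj': primeideal "P (Suc j)" ?A using P step.hyps by simp
  have closed: "p * q \<in> carrier ?A" if "p \<in> carrier ?A" "q \<in> carrier ?A" for p q
    using Pj.m_closed[OF that] by (simp add: semigroup_ring_def)
  have xc: "x i \<in> carrier ?A" if "i < n" for i
    using ideal.Icarr[OF primeideal.axioms(1)[OF P], of "Suc i" "x i"] x(1) that by simp
  have xpow: "x i ^ e \<in> carrier ?A" if "i < n" for i e
  proof (induction e)
    case 0
    show ?case using Pj.one_closed by (simp add: semigroup_ring_def)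
  next
    case (Suc e)
    then show ?case using closed[OF xc[OF that]] by simp
  qed
  have xprod: "(\<Prod>i=l..<n. x i ^ \<alpha> i) \<in> carrier ?A" for l \<alpha>
  proof -
    have "(\<Prod>i\<in>B. x i ^ \<alpha> i) \<in> carrier ?A" if "finite B" "B \<subseteq> {..<n}" for B
      using that Pj.one_closed
      by (induction B rule: finite_induct) (auto intro!: closed xpow, simp add: semigroup_ring_def monoid_of_0)
    from this[of "{l..<n}"] show ?thesis by (simp add: subset_eq)
  qed
  show ?case
  proof (rule ccontr)
    assume "c \<alpha> \<noteq> 0"
    define \<Gamma>' where "\<Gamma>' = {\<beta> \<in> \<Gamma>. c \<beta> \<noteq> 0}"
    have fin: "finite \<Gamma>'" and "\<alpha> \<in> \<Gamma>'"
      using step.prems \<open>c \<alpha> \<noteq> 0\<close> by (auto simp: \<Gamma>'_def)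
    \<comment> \<open>The smallest exponent of \<open>x j\<close> among the terms with nonzero coefficient, to be cancelled.\<close>
    define a where "a = Min ((\<lambda>\<beta>. \<beta> j) ` \<Gamma>')"
    have a_in: "a \<in> (\<lambda>\<beta>. \<beta> j) ` \<Gamma>'"
      unfolding a_def using fin \<open>\<alpha> \<in> \<Gamma>'\<close> by (intro Min_in) auto
    have a_le: "a \<le> \<beta> j" if "\<beta> \<in> \<Gamma>'" for \<beta>
      unfolding a_def using fin that by (intro Min_le) auto
    let ?rest = "\<lambda>\<beta>. \<Prod>i=Suc j..<n. x i ^ \<beta> i"
    let ?S = "\<Sum>\<beta>\<in>\<Gamma>'. pm_scale (c \<beta>) (x j ^ (\<beta> j - a) * ?rest \<beta>)"
    have scale_mult: "pm_scale e (p * q) = p * pm_scale e q" for e and p q :: "('v, 'k) mpoly"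
      by (simp add: single_0_mult[symmetric] mult.left_commute)
    have "(\<Sum>\<beta>\<in>\<Gamma>. pm_scale (c \<beta>) (\<Prod>i=j..<n. x i ^ \<beta> i)) =
      (\<Sum>\<beta>\<in>\<Gamma>'. pm_scale (c \<beta>) (\<Prod>i=j..<n. x i ^ \<beta> i))"
      using step.prems(1) by (intro sum.mono_neutral_right) (auto simp: \<Gamma>'_def)
    also have "\<dots> = (\<Sum>\<beta>\<in>\<Gamma>'. x j ^ a * pm_scale (c \<beta>) (x j ^ (\<beta> j - a) * ?rest \<beta>))"
    proof (intro sum.cong refl)
      fix \<beta> assume "\<beta> \<in> \<Gamma>'"
      have "(\<Prod>i=j..<n. x i ^ \<beta> i) = x j ^ \<beta> j * ?rest \<beta>"
        using step.hyps by (simp add: prod.atLeast_Suc_lessThan)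
      also have "\<dots> = x j ^ a * (x j ^ (\<beta> j - a) * ?rest \<beta>)"
        using a_le[OF \<open>\<beta> \<in> \<Gamma>'\<close>] by (simp add: mult.assoc[symmetric] power_add[symmetric])
      finally show "pm_scale (c \<beta>) (\<Prod>i=j..<n. x i ^ \<beta> i) =
        x j ^ a * pm_scale (c \<beta>) (x j ^ (\<beta> j - a) * ?rest \<beta>)"
        by (simp add: scale_mult)
    qed
    also have "\<dots> = x j ^ a * ?S" by (simp add: sum_distrib_left)
    finally have xS: "x j ^ a * ?S \<in> P j" using step.prems(3) by simp
    have "ideal (carrier ?A) ?A" by (rule Pj.oneideal)
    then have S: "?S \<in> carrier ?A"
      using step.hyps by (intro sum_in_semigroup_ring_ideal scale_in_semigroup_ring_ideal closed xpow xprod)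
    have "x j ^ e \<notin> P j" for e
    proof (induction e)
      case 0
      then show ?case
        using Pj.one_imp_carrier Pj.I_notcarr by (auto simp: semigroup_ring_def)
    next
      case (Suc e)
      then show ?case
        using Pj.I_prime[OF xc xpow, of j j e] x(2) step.hyps by (auto simp: semigroup_ring_def)
    qed
    then have "?S \<in> P j"
      using Pj.I_prime[OF xpow S, of j a] xS step.hyps by (auto simp: semigroup_ring_def)
    then have S': "?S \<in> P (Suc j)" using mono step.hyps by blast
    let ?low = "{\<beta> \<in> \<Gamma>'. \<beta> j = a}"
    let ?Slow = "\<Sum>\<beta>\<in>?low. pm_scale (c \<beta>) (?rest \<beta>)"
    let ?Shigh = "\<Sum>\<beta>\<in>\<Gamma>'-?low. pm_scale (c \<beta>) (x j ^ (\<beta> j - a) * ?rest \<beta>)"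
    have "?S = ?Shigh + (\<Sum>\<beta>\<in>?low. pm_scale (c \<beta>) (x j ^ (\<beta> j - a) * ?rest \<beta>))"
      by (rule sum.subset_diff[OF _ fin]) blast
    also have "(\<Sum>\<beta>\<in>?low. pm_scale (c \<beta>) (x j ^ (\<beta> j - a) * ?rest \<beta>)) = ?Slow"
      by (intro sum.cong refl) simp
    finally have split: "?Slow = ?S + pm_scale (- 1) ?Shigh"
      by (simp only: pm.scale_minus_left pm.scale_one) (simp only: add_diff_cancel_left' diff_conv_add_uminus[symmetric])
    have "?Shigh \<in> P (Suc j)"
    proof (intro sum_in_semigroup_ring_ideal[OF Pj'.is_ideal] scale_in_semigroup_ring_ideal[OF Pj'.is_ideal])
      fix \<beta> assume "\<beta> \<in> \<Gamma>' - ?low"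
      then have "a < \<beta> j" using a_le[of \<beta>] by auto
      then obtain e where e: "\<beta> j - a = Suc e" using less_imp_Suc_add[of a "\<beta> j"] by auto
      have "x j ^ (\<beta> j - a) * ?rest \<beta> = (x j ^ e * ?rest \<beta>) * x j"
        by (simp only: e power_Suc ac_simps)
      also have "\<dots> \<in> P (Suc j)"
      proof -
        have "x j ^ e * ?rest \<beta> \<in> carrier ?A"
          by (rule closed[OF xpow xprod]) (use step.hyps in simp)
        from Pj'.I_l_closed[OF x(1)[OF step.hyps(2)] this] show ?thesis
          by (simp only: semigroup_ring_def ring_on_simps)
      qed
      finally show "x j ^ (\<beta> j - a) * ?rest \<beta> \<in> P (Suc j)" .
    qed
    then have "?S + pm_scale (- 1) ?Shigh \<in> P (Suc j)"
      using Pj'.a_closed[OF S' scale_in_semigroup_ring_ideal[OF Pj'.is_ideal], of ?Shigh "- 1"]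
      by (simp add: semigroup_ring_def)
    then have S0: "?Slow \<in> P (Suc j)" by (simp only: split)
    obtain \<beta> where \<beta>: "\<beta> \<in> ?low" using a_in by auto
    have inj: "inj_on (\<lambda>\<alpha>. restrict \<alpha> {Suc j..<n}) ?low"
    proof (rule inj_onI)
      fix \<beta> \<gamma> assume bg: "\<beta> \<in> ?low" "\<gamma> \<in> ?low" "restrict \<beta> {Suc j..<n} = restrict \<gamma> {Suc j..<n}"
      have "restrict \<beta> {j..<n} = restrict \<gamma> {j..<n}"
      proof
        fix i show "restrict \<beta> {j..<n} i = restrict \<gamma> {j..<n} i"
        proof (cases "i \<in> {Suc j..<n}")
          case True
          then show ?thesis using fun_cong[OF bg(3), of i] by simp
        next
          case False
          then have "i = j \<or> i \<notin> {j..<n}" by auto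
          then show ?thesis using bg(1,2) by (auto simp: restrict_def)
        qed
      qed
      then show "\<beta> = \<gamma>" using inj_onD[OF step.prems(2), of \<beta> \<gamma>] bg by (auto simp: \<Gamma>'_def)
    qed
    have "c \<beta> = 0" by (rule step.IH[OF _ inj S0 \<beta>]) (use fin in simp)
    then show False using \<beta> by (simp add: \<Gamma>'_def)
  qed
qed

text \<open>A chain of length \<open>n\<close> gives \<open>(s + 1)\<^sup>n\<close> independent monomials with exponents up to \<open>s\<close>. They are
  supported on sums of at most \<open>L s\<close> generators for a constant \<open>L\<close>, and there are at most
  \<open>(L s + 1)\<^bsup>m+1\<^esup>\<close> of those. For large \<open>s\<close> this forces \<open>n \<le> m + 1\<close>.\<close>

theorem krull_dim_semigroup_ring_le:
  fixes T :: "('v \<Rightarrow>\<^sub>0 nat) set"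
  assumes fin: "\<And>k. finite (nsums k T)" and card: "\<And>k. card (nsums k T) \<le> (k + 1) ^ m"
  shows "krull_dim (semigroup_ring T :: ('v, 'k::field) mpoly ring) \<le> enat (m + 1)"
  unfolding krull_dim_def
proof (rule Sup_least, clarify)
  let ?A = "semigroup_ring T :: ('v, 'k) mpoly ring"
  fix n and P :: "nat \<Rightarrow> ('v, 'k) mpoly set"
  assume P: "\<forall>i\<le>n. primeideal (P i) ?A" and strict: "\<forall>i<n. P i \<subset> P (Suc i)"
  have "\<forall>i. \<exists>x. i < n \<longrightarrow> x \<in> P (Suc i) \<and> x \<notin> P i"
    using strict by blast
  then obtain x where x: "\<And>i. i < n \<Longrightarrow> x i \<in> P (Suc i)" "\<And>i. i < n \<Longrightarrow> x i \<notin> P i"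
    by metis
  define D where "D j = (\<Union>k\<le>j. nsums k T)" for j
  define W where "W j = {p :: ('v, 'k) mpoly. keys p \<subseteq> D j}" for j
  have W_mult: "p * q \<in> W (i + j)" if "p \<in> W i" "q \<in> W j" for p q i j
  proof -
    have "m \<in> D (i + j)" if m: "m \<in> keys (p * q)" for m
    proof -
      obtain a b where ab: "m = a + b" "a \<in> keys p" "b \<in> keys q"
        using m keys_mult[of p q] by blast
      then obtain k l where "k \<le> i" "a \<in> nsums k T" "l \<le> j" "b \<in> nsums l T"
        using \<open>p \<in> W i\<close> \<open>q \<in> W j\<close> unfolding W_def D_def by blast
      then show ?thesis using nsums_add[of a k T b l] ab(1) unfolding D_def
        by (intro UN_I[of "k + l"]) auto
    qed
    then show ?thesis unfolding W_def by blast
  qed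
  have W_mono: "W i \<subseteq> W j" if "i \<le> j" for i j
    using that unfolding W_def D_def by fastforce
  have W_1: "1 \<in> W 0" by (simp add: W_def D_def)
  have "\<forall>i. \<exists>L. i < n \<longrightarrow> x i \<in> W L"
  proof
    fix i
    show "\<exists>L. i < n \<longrightarrow> x i \<in> W L"
    proof (cases "i < n")
      case True
      then have "x i \<in> carrier ?A"
        using ideal.Icarr[OF primeideal.axioms(1), of "P (Suc i)" ?A "x i"] P x(1) by simp
      then have "keys (x i) \<subseteq> monoid_of T" by (simp add: semigroup_ring_def)
      then have "\<forall>m\<in>keys (x i). \<exists>k. m \<in> nsums k T" by (auto simp: monoid_of_def)
      then obtain k where k: "\<And>m. m \<in> keys (x i) \<Longrightarrow> m \<in> nsums (k m) T" by metis
      have "x i \<in> W (Max (k ` keys (x i)))"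
        unfolding W_def D_def
      proof (intro CollectI subsetI UN_I)
        fix m assume m: "m \<in> keys (x i)"
        show "m \<in> nsums (k m) T" by (rule k[OF m])
        show "k m \<in> {..Max (k ` keys (x i))}" using m by simp
      qed
      then show ?thesis by blast
    qed simp
  qed
  then obtain l where l: "\<And>i. i < n \<Longrightarrow> x i \<in> W (l i)" by metis
  define L where "L = (\<Sum>i<n. l i)"
  have D_card: "finite (D j) \<and> card (D j) \<le> (j + 1) ^ (m + 1)" for j
  proof
    show "finite (D j)" unfolding D_def using fin by blast
    have "card (D j) \<le> (\<Sum>k\<le>j. card (nsums k T))"
      unfolding D_def by (rule card_UN_le) simp
    also have "\<dots> \<le> (\<Sum>k\<le>j. (j + 1) ^ m)"
      by (intro sum_mono order.trans[OF card] power_mono) auto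
    finally show "card (D j) \<le> (j + 1) ^ (m + 1)" by simp
  qed
  have count: "(s + 1) ^ n \<le> (L * s + 1) ^ (m + 1)" for s
  proof -
    define \<Gamma> where "\<Gamma> = PiE {..<n} (\<lambda>_. {..s})"
    define mon where "mon \<alpha> = (\<Prod>i=0..<n. x i ^ \<alpha> i)" for \<alpha>
    have fin\<Gamma>: "finite \<Gamma>" and card\<Gamma>: "card \<Gamma> = (s + 1) ^ n"
      by (auto simp: \<Gamma>_def card_PiE finite_PiE)
    have restr: "restrict \<alpha> {0..<n} = \<alpha>" if "\<alpha> \<in> \<Gamma>" for \<alpha>
      using that unfolding \<Gamma>_def by (metis PiE_restrict atLeast0LessThan)
    have indep: "c \<alpha> = 0" if "\<Gamma>' \<subseteq> \<Gamma>" "(\<Sum>\<alpha>\<in>\<Gamma>'. pm_scale (c \<alpha>) (mon \<alpha>)) = 0" "\<alpha> \<in> \<Gamma>'"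
      for c \<alpha> \<Gamma>'
    proof (rule prime_chain_independent[where P = P and x = x and j = 0 and n = n and T = T and \<Gamma> = \<Gamma>' and c = c])
      show "inj_on (\<lambda>\<alpha>. restrict \<alpha> {0..<n}) \<Gamma>'"
        using restr that(1) by (intro inj_onI) (metis subsetD)
      show "finite \<Gamma>'" using that(1) fin\<Gamma> by (rule finite_subset)
      show "primeideal (P i) ?A" if "i \<le> n" for i using P that by blast
      have "0 \<in> P 0"
        using additive_subgroup.zero_closed[OF ideal.axioms(1)[OF primeideal.axioms(1)], of "P 0" ?A] P
        by (simp add: semigroup_ring_def)
      then show "(\<Sum>\<alpha>\<in>\<Gamma>'. pm_scale (c \<alpha>) (\<Prod>i=0..<n. x i ^ \<alpha> i)) \<in> P 0"
        using that(2) by (simp add: mon_def)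
      show "P i \<subseteq> P (Suc i)" if "i < n" for i using strict that by blast
    qed (use x that(3) in simp_all)
    have inj: "inj_on mon \<Gamma>"
    proof (rule inj_onI, rule ccontr)
      fix \<alpha> \<beta> assume ab: "\<alpha> \<in> \<Gamma>" "\<beta> \<in> \<Gamma>" "mon \<alpha> = mon \<beta>" "\<alpha> \<noteq> \<beta>"
      let ?c = "\<lambda>\<gamma>. if \<gamma> = \<alpha> then 1 else - 1 :: 'k"
      have "?c \<alpha> = 0"
      proof (rule indep[where \<Gamma>' = "{\<alpha>, \<beta>}" and c = ?c and \<alpha> = \<alpha>])
        show "(\<Sum>\<gamma>\<in>{\<alpha>, \<beta>}. pm_scale (?c \<gamma>) (mon \<gamma>)) = 0"
          using ab(4) ab(4)[symmetric] by (simp add: ab(3))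
      qed (use ab in simp_all)
      then show False by simp
    qed
    have "pm.independent (mon ` \<Gamma>)"
    proof (rule pm.independent_if_scalars_zero)
      fix f p assume f: "(\<Sum>p\<in>mon ` \<Gamma>. pm_scale (f p) p) = 0" and "p \<in> mon ` \<Gamma>"
      then obtain \<alpha> where "\<alpha> \<in> \<Gamma>" "p = mon \<alpha>" by blast
      then show "f p = 0"
        using indep[of \<Gamma> "f \<circ> mon" \<alpha>] f by (simp add: sum.reindex[OF inj])
    qed (use fin\<Gamma> in simp)
    moreover have "mon ` \<Gamma> \<subseteq> pm.span ((\<lambda>a. single a 1) ` D (L * s))"
    proof (clarsimp simp: span_singles)
      fix \<alpha> m assume \<alpha>: "\<alpha> \<in> \<Gamma>" and m: "m \<in> keys (mon \<alpha>)"
      have pow: "x i ^ e \<in> W (l i * e)" if "i < n" for i e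
        by (induction e) (use W_mult[OF l[OF that]] W_1 in \<open>auto\<close>)
      have "(\<Prod>i=0..<j. x i ^ \<alpha> i) \<in> W ((\<Sum>i<j. l i) * s)" if "j \<le> n" for j
        using that
      proof (induction j)
        case (Suc j)
        have "\<alpha> j \<le> s" using \<alpha> Suc.prems by (auto simp: \<Gamma>_def PiE_def Pi_def)
        then have "x j ^ \<alpha> j \<in> W (l j * s)"
          using pow[of j "\<alpha> j"] W_mono[of "l j * \<alpha> j" "l j * s"] Suc.prems by auto
        then show ?case
          using W_mult[OF Suc.IH, of "x j ^ \<alpha> j" "l j * s"] Suc.prems
          by (simp add: algebra_simps)
      qed (use W_1 in simp)
      from this[of n] show "m \<in> D (L * s)" using m by (auto simp: W_def mon_def L_def)
    qed
    ultimately have "card (mon ` \<Gamma>) \<le> card ((\<lambda>a. single a (1::'k)) ` D (L * s))"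
      using pm.independent_span_bound D_card by blast
    also have "\<dots> \<le> card (D (L * s))" by (rule card_image_le) (use D_card in simp)
    also have "\<dots> \<le> (L * s + 1) ^ (m + 1)" using D_card by simp
    finally show ?thesis by (simp add: card_image[OF inj] card\<Gamma>)
  qed
  have "n \<le> m + 1"
  proof (rule ccontr)
    assume "\<not> n \<le> m + 1"
    then have n: "Suc (m + 1) \<le> n" by simp
    \<comment> \<open>From here \<open>s\<close> is too large for the two powers to be comparable.\<close>
    define s where "s = (L + 1) ^ (m + 1)"
    have "(s + 1) * (s + 1) ^ (m + 1) = (s + 1) ^ (Suc (m + 1))" by simp
    also have "\<dots> \<le> (s + 1) ^ n" by (rule power_increasing[OF n]) simp
    also have "\<dots> \<le> (L * s + 1) ^ (m + 1)" by (rule count)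
    also have "\<dots> \<le> ((L + 1) * (s + 1)) ^ (m + 1)" by (rule power_mono) simp_all
    also have "\<dots> = s * (s + 1) ^ (m + 1)" by (simp only: power_mult_distrib s_def)
    finally have "s + 1 \<le> s" by (simp only: mult_le_cancel2) simp
    then show False by simp
  qed
  then show "enat n \<le> enat (m + 1)" by simp
qed

text \<open>The functionals \<open>ht i\<close> cut out a descending chain of faces of the monoid. The polynomials without
  monomials on a face form a prime: a sum lies on a face only if both summands do, and by \<open>unique_sum\<close> the
  product of two polynomials with monomials on the face has one there. The points \<open>w i\<close> show that the faces are distinct.\<close>

theorem krull_dim_semigroup_ring_ge:
  fixes T :: "('v \<Rightarrow>\<^sub>0 nat) set" and ht :: "nat \<Rightarrow> ('v \<Rightarrow>\<^sub>0 nat) \<Rightarrow> int"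
  assumes zero: "\<And>i. ht i 0 = 0" and add: "\<And>i a b. ht i (a + b) = ht i a + ht i b"
    and nonneg: "\<And>i a. i < n \<Longrightarrow> a \<in> T \<Longrightarrow> 0 \<le> ht i a"
    and w: "\<And>i. i < n \<Longrightarrow> w i \<in> T" "\<And>i. i < n \<Longrightarrow> 0 < ht i (w i)"
      "\<And>i j. i < n \<Longrightarrow> j < i \<Longrightarrow> ht j (w i) = 0"
  shows "enat n \<le> krull_dim (semigroup_ring T :: ('v, 'k::field) mpoly ring)"
proof -
  let ?A = "semigroup_ring T :: ('v, 'k) mpoly ring"
  have nonneg': "0 \<le> ht i a" if "i < n" and a: "a \<in> monoid_of T" for i a
  proof -
    obtain k where "a \<in> nsums k T" using a unfolding monoid_of_def by blast
    then show ?thesis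
      by (induction k arbitrary: a) (auto simp: sumset_def zero add nonneg[OF \<open>i < n\<close>])
  qed
  define P where "P i = {p \<in> carrier ?A. \<forall>m\<in>keys p. \<exists>j<i. 0 < ht j m}" for i
  have "primeideal (P i) ?A" if i: "i \<le> n" for i
    unfolding semigroup_ring_def
  proof (rule primeideal_ring_onI)
    let ?S = "{p :: ('v, 'k) mpoly. keys p \<subseteq> monoid_of T}"
    have sum_pos: "0 < ht j (a + b)" if "j < i" "0 < ht j a" "a \<in> monoid_of T" "b \<in> monoid_of T" for j a b
      using nonneg'[of j b] that i by (simp add: add)
    show cring: "cring (ring_on ?S)"
      using cring_semigroup_ring by (simp add: semigroup_ring_def)
    show "ideal (P i) (ring_on ?S)"
    proof (rule ideal_ring_onI[OF cring])
      fix x y assume x: "x \<in> P i"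
      show "x + y \<in> P i" if "y \<in> P i"
        using x that keys_add[of x y] by (fastforce simp: P_def semigroup_ring_def)
      show "y * x \<in> P i" if y: "y \<in> ?S"
      proof -
        have "m \<in> monoid_of T \<and> (\<exists>j<i. 0 < ht j m)" if m: "m \<in> keys (y * x)" for m
        proof -
          obtain b a where ab: "m = b + a" "b \<in> keys y" "a \<in> keys x"
            using m keys_mult[of y x] by blast
          then have mem: "b \<in> monoid_of T" "a \<in> monoid_of T"
            using x y by (auto simp: P_def semigroup_ring_def)
          obtain j where "j < i" "0 < ht j a" using x ab by (auto simp: P_def)
          then have "0 < ht j m" using sum_pos[of j a b] mem by (simp add: ab(1) add.commute)
          then show ?thesis using \<open>j < i\<close> mem ab(1) by (auto intro: monoid_of_add)
        qed
        then show ?thesis by (auto simp: P_def semigroup_ring_def)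
      qed
    qed (auto simp: P_def semigroup_ring_def)
    show "1 \<notin> P i" by (auto simp: P_def zero)
    show "1 \<in> ?S" by (simp add: monoid_of_0)
    fix p q assume p: "p \<in> ?S" and q: "q \<in> ?S" and pq: "p * q \<in> P i"
    show "p \<in> P i \<or> q \<in> P i"
    proof (rule ccontr)
      assume neg: "\<not> (p \<in> P i \<or> q \<in> P i)"
      \<comment> \<open>On the monoid the functionals are nonnegative, so the face is where the first \<open>i\<close> of them vanish.\<close>
      define face where "face = {m. \<forall>j<i. \<not> 0 < ht j m}"
      have "keys p \<inter> face \<noteq> {}" "keys q \<inter> face \<noteq> {}"
        using neg p q by (auto simp: P_def face_def semigroup_ring_def)
      then obtain a b where a: "a \<in> keys p \<inter> face" and b: "b \<in> keys q \<inter> face"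
        and unique: "\<And>a' b'. a' \<in> keys p \<inter> face \<Longrightarrow> b' \<in> keys q \<inter> face \<Longrightarrow> a' + b' = a + b \<Longrightarrow>
          a' = a \<and> b' = b"
        using unique_sum[of "keys p \<inter> face" "keys q \<inter> face"] by (metis finite_Int finite_keys)
      have ab_face: "a + b \<in> face"
        unfolding face_def
      proof (intro CollectI allI impI)
        fix j assume "j < i"
        then have "\<not> 0 < ht j a" "\<not> 0 < ht j b" using a b by (auto simp: face_def)
        then show "\<not> 0 < ht j (a + b)" by (simp add: add)
      qed
      have "lookup (p * q) (a + b) = lookup p a * lookup q b"
      proof (rule lookup_times_unique)
        fix a' b' assume ab': "a' \<in> keys p" "b' \<in> keys q" "a' + b' = a + b"
        then have mem: "a' \<in> monoid_of T" "b' \<in> monoid_of T" using p q by auto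
        have "a' \<in> face \<and> b' \<in> face"
        proof -
          have "\<not> 0 < ht j (a' + b')" if "j < i" for j
            using ab_face that unfolding ab'(3) by (simp add: face_def)
          then have "\<not> 0 < ht j a' \<and> \<not> 0 < ht j b'" if "j < i" for j
            using sum_pos[of j a' b'] sum_pos[of j b' a'] mem that by (metis add.commute)
          then show ?thesis by (auto simp: face_def)
        qed
        then show "a' = a \<and> b' = b" using unique[of a' b'] ab' by blast
      qed (use a b in auto)
      also have "\<dots> \<noteq> 0" using a b by (simp add: in_keys_iff)
      finally have "a + b \<in> keys (p * q)" by (simp add: in_keys_iff)
      then show False using pq ab_face by (auto simp: P_def face_def)
    qed
  qed
  moreover have "P i \<subset> P (Suc i)" if i: "i < n" for i
  proof
    show "P i \<subseteq> P (Suc i)" unfolding P_def using less_Suc_eq by blast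
    have "single (w i) 1 \<in> P (Suc i)"
      using w(1,2)[OF i] by (auto simp: P_def semigroup_ring_def monoid_of_base)
    moreover have "single (w i) 1 \<notin> P i"
      using w(3)[OF i] by (auto simp: P_def)
    ultimately show "P i \<noteq> P (Suc i)" by blast
  qed
  ultimately show ?thesis
    unfolding krull_dim_def by (intro Sup_upper) blast
qed

section \<open>Sums of points in convex position\<close>

text \<open>The point is the unique minimum of an additive functional, as a vertex of the convex hull is.\<close>

definition exposed :: "'b::plus set \<Rightarrow> 'b \<Rightarrow> bool" where
  "exposed X p \<longleftrightarrow> (\<exists>h :: 'b \<Rightarrow> rat. (\<forall>x y. h (x + y) = h x + h y) \<and> (\<forall>x\<in>X - {p}. h p < h x))"

lemma finite_sumset:
  fixes S U :: "'c::plus set"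
  assumes "finite S" "finite U"
  shows "finite (sumset S U)"
proof -
  have "sumset S U = (\<lambda>(a, b). a + b) ` (S \<times> U)" by (auto simp: sumset_def)
  then show ?thesis using assms by simp
qed

context vector_space
begin

lemma dim_insert_new:
  assumes "finite X" "p \<notin> span X"
  shows "dim (insert p X) = Suc (dim X)"
proof -
  obtain B where B: "B \<subseteq> X" "independent B" "X \<subseteq> span B" "card B = dim X"
    using basis_exists[of X] by blast
  have "span B \<subseteq> span X" by (rule span_mono[OF B(1)])
  then have p: "p \<notin> span B" using assms by blast
  have "card (insert p B) = dim (insert p X)"
  proof (rule basis_card_eq_dim)
    show "insert p B \<subseteq> insert p X" using B by blast
    show "independent (insert p B)" using independent_insertI[OF p B(2)] .
    have "X \<subseteq> span (insert p B)"
      using B(3) span_mono[of B "insert p B"] by blast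
    then show "insert p X \<subseteq> span (insert p B)"
      using span_base[of p "insert p B"] by simp
  qed
  moreover have "card (insert p B) = Suc (card B)"
    using p finite_subset[OF B(1) assms(1)] span_base[of p B] by (intro card_insert_disjoint) auto
  ultimately show ?thesis using B(4) by simp
qed

lemma dim_insert_span:
  assumes "p \<in> span X"
  shows "dim (insert p X) = dim X"
  by (rule span_eq_dim) (rule span_redundant[OF assms])

end

text \<open>The difference of the two sides of the inequality of Freiman for the size of a sumset, with the dimension of the
  linear span: for points on an affine hyperplane that misses the origin it is the affine dimension plus one.\<close>

definition excess :: "('b \<Rightarrow>\<^sub>0 rat) set \<Rightarrow> int" where
  "excess X = int (card (sumset X X)) - int (pm.dim X) * int (card X) + int (pm.dim X choose 2)"

text \<open>Let \<open>Q\<close> be the set of \<open>q\<close> for which \<open>p + q\<close> is a new sum. If \<open>p + x = a + b\<close> is not new, then \<open>x = a + b - p\<close>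
  where the functional minimal at \<open>p\<close> is smaller at \<open>a\<close> and \<open>b\<close> than at \<open>x\<close>. So \<open>Q\<close> and \<open>p\<close> span everything by induction,
  and there are at least \<open>dim\<close> new sums, counting \<open>p + p\<close>; this pays for the growth of the other terms. If \<open>p\<close> is
  outside the span of the other points, every \<open>p + x\<close> is new, which pays for the larger dimension.\<close>

lemma excess_insert:
  fixes X :: "('b \<Rightarrow>\<^sub>0 rat) set"
  assumes fin: "finite X" and new: "p \<notin> X" and exp: "exposed (insert p X) p"
  shows "excess X \<le> excess (insert p X)"
proof -
  obtain h :: "('b \<Rightarrow>\<^sub>0 rat) \<Rightarrow> rat" where add: "\<And>x y. h (x + y) = h x + h y" and less: "\<And>x. x \<in> X \<Longrightarrow> h p < h x"
    using exp new by (auto simp: exposed_def)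
  define Q where "Q = {q \<in> X. p + q \<notin> sumset X X}"
  have finQ: "finite Q" and "p \<notin> Q" using fin new by (auto simp: Q_def)
  have sub: "sumset X X \<union> (+) p ` insert p Q \<subseteq> sumset (insert p X) (insert p X)"
    by (auto simp: sumset_def Q_def)
  have disj: "sumset X X \<inter> (+) p ` insert p Q = {}"
  proof -
    have "p + p \<notin> sumset X X"
    proof
      assume "p + p \<in> sumset X X"
      then obtain a b where ab: "p + p = a + b" "a \<in> X" "b \<in> X" by (auto simp: sumset_def)
      have "h p + h p = h a + h b" using arg_cong[OF ab(1), of h] by (simp add: add)
      then show False using less[OF ab(2)] less[OF ab(3)] by simp
    qed
    then show ?thesis by (auto simp: Q_def)
  qed
  have "card ((+) p ` insert p Q) = Suc (card Q)"
    using finQ \<open>p \<notin> Q\<close> by (subst card_image) (simp_all add: inj_on_def)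
  then have "card (sumset X X) + Suc (card Q) = card (sumset X X \<union> (+) p ` insert p Q)"
    using card_Un_disjoint[OF finite_sumset[OF fin fin] _ disj] finQ by simp
  also have "\<dots> \<le> card (sumset (insert p X) (insert p X))"
    by (rule card_mono[OF _ sub]) (use fin in \<open>simp add: finite_sumset\<close>)
  finally have card: "card (sumset X X) + Suc (card Q) \<le> card (sumset (insert p X) (insert p X))" .
  show ?thesis
  proof (cases "p \<in> pm.span X")
    case True
    have "x \<in> pm.span (insert p Q)" if "x \<in> X" for x
      using that
    proof (induction "card {y \<in> X. h y < h x}" arbitrary: x rule: less_induct)
      case less
      show ?case
      proof (cases "x \<in> Q")
        case False
        then obtain a b where ab: "p + x = a + b" "a \<in> X" "b \<in> X"
          using less.prems by (auto simp: Q_def sumset_def)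
        have sum: "h p + h x = h a + h b" using arg_cong[OF ab(1), of h] by (simp add: add)
        have smaller: "y \<in> pm.span (insert p Q)" if "y \<in> X" "h y < h x" for y
        proof (rule less.hyps[OF _ that(1)])
          have "y \<in> {y \<in> X. h y < h x}" "y \<notin> {z \<in> X. h z < h y}" using that by auto
          moreover have "{z \<in> X. h z < h y} \<subseteq> {y \<in> X. h y < h x}" using that(2) by auto
          ultimately show "card {z \<in> X. h z < h y} < card {y \<in> X. h y < h x}"
            using fin by (intro psubset_card_mono) auto
        qed
        have "h a < h x" "h b < h x"
          using sum \<open>\<And>x. x \<in> X \<Longrightarrow> h p < h x\<close>[OF ab(2)] \<open>\<And>x. x \<in> X \<Longrightarrow> h p < h x\<close>[OF ab(3)] by simp_all
        then have "a + b - p \<in> pm.span (insert p Q)"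
          using smaller ab by (intro pm.span_diff pm.span_add) (auto intro: pm.span_base)
        moreover have "x = a + b - p" using ab(1) by (simp add: algebra_simps)
        ultimately show ?thesis by simp
      qed (auto intro: pm.span_base)
    qed
    then have "insert p X \<subseteq> pm.span (insert p Q)" by (auto intro: pm.span_base)
    then have "pm.dim (insert p X) \<le> card (insert p Q)"
      using finQ by (intro pm.dim_le_card) auto
    then have "int (pm.dim X) \<le> int (card Q) + 1"
      using finQ \<open>p \<notin> Q\<close> by (simp add: pm.dim_insert_span[OF True])
    then show ?thesis
      using card new fin by (simp add: excess_def pm.dim_insert_span[OF True] algebra_simps)
  next
    case False
    have "Q = X"
    proof (rule ccontr)
      assume "Q \<noteq> X"
      then obtain q a b where q: "q \<in> X" "p + q = a + b" "a \<in> X" "b \<in> X"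
        by (auto simp: Q_def sumset_def)
      then have "p = a + b - q" by (simp add: algebra_simps)
      moreover have "a + b - q \<in> pm.span X"
        using q by (intro pm.span_diff pm.span_add pm.span_base)
      ultimately show False using False by simp
    qed
    then show ?thesis
      using card new fin pm.dim_insert_new[OF fin False]
      by (simp add: excess_def algebra_simps numeral_2_eq_2)
  qed
qed

theorem excess_mono:
  fixes X :: "('b \<Rightarrow>\<^sub>0 rat) set"
  assumes "finite X" "Y \<subseteq> X" "\<And>p. p \<in> X \<Longrightarrow> exposed X p"
  shows "excess Y \<le> excess X"
proof -
  have "excess Y \<le> excess (Y \<union> Z)" if "finite Z" "Z \<subseteq> X" for Z
    using that
  proof (induction Z rule: finite_induct)
    case (insert p Z)
    show ?case
    proof (cases "p \<in> Y \<union> Z")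
      case True
      then have "Y \<union> insert p Z = Y \<union> Z" by blast
      then show ?thesis using insert by simp
    next
      case False
      have "insert p (Y \<union> Z) \<subseteq> X" using insert assms(2) by blast
      then have "exposed (insert p (Y \<union> Z)) p"
        using assms(3)[of p] insert.prems unfolding exposed_def by blast
      moreover have "finite (Y \<union> Z)" using insert.hyps finite_subset[OF assms(2,1)] by blast
      ultimately have "excess (Y \<union> Z) \<le> excess (insert p (Y \<union> Z))"
        using False by (intro excess_insert)
      then show ?thesis using insert by simp
    qed
  qed simp
  from this[OF assms(1) order.refl] show ?thesis
    using assms(2) by (simp add: Un_absorb1)
qed

text \<open>Raising the dimension from \<open>E\<close> to \<open>E + 1\<close> adds \<open>N - E\<close>.\<close>

lemma Freiman_bound_mono:
  fixes D E N :: nat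
  assumes "D \<le> E" "E \<le> N"
  shows "int D * int N - int (D choose 2) \<le> int E * int N - int (E choose 2)"
  using assms
proof (induction E rule: dec_induct)
  case (step E)
  have "Suc E choose 2 = E + (E choose 2)" by (simp add: numeral_2_eq_2)
  moreover have "int (Suc E) * int N = int E * int N + int N" by (simp add: distrib_right)
  ultimately show ?case using step.IH step.prems by simp
qed simp

section \<open>Exponents of cut monomials\<close>

definition cuts_edge :: "'a set \<Rightarrow> 'a set \<Rightarrow> bool" where
  "cuts_edge A e \<longleftrightarrow> card (e \<inter> A) = 1"

definition cut_exp :: "'a ugraph \<Rightarrow> 'a set \<Rightarrow> ('a set cut_var \<Rightarrow>\<^sub>0 nat)" where
  "cut_exp G A = (\<Sum>e\<in>edges G. single (if cuts_edge A e then Var_s e else Var_t e) 1)"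

definition cut_exps :: "'a ugraph \<Rightarrow> ('a set cut_var \<Rightarrow>\<^sub>0 nat) set" where
  "cut_exps G = cut_exp G ` Pow (verts G)"

lemma cuts_edge_pair: "a \<noteq> b \<Longrightarrow> cuts_edge A {a, b} \<longleftrightarrow> (a \<in> A) \<noteq> (b \<in> A)"
  unfolding cuts_edge_def by (cases "a \<in> A"; cases "b \<in> A") (auto simp: Int_insert_left)

lemma not_cuts_edge_empty [simp]: "\<not> cuts_edge {} e"
  by (simp add: cuts_edge_def)

lemma edge_pair:
  assumes "simple_graph G" "e \<in> edges G"
  obtains a b where "e = {a, b}" "a \<noteq> b" "a \<in> verts G" "b \<in> verts G"
  using assms by (auto simp: simple_graph_def card_2_iff)

lemma finite_edges: "simple_graph G \<Longrightarrow> finite (edges G)"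
  by (rule finite_subset[of _ "Pow (verts G)"]) (auto simp: simple_graph_def)

lemma lookup_cut_exp:
  assumes "finite (edges G)"
  shows "lookup (cut_exp G A) (Var_s e) = of_bool (e \<in> edges G \<and> cuts_edge A e)"
    and "lookup (cut_exp G A) (Var_t e) = of_bool (e \<in> edges G \<and> \<not> cuts_edge A e)"
proof -
  have "lookup (cut_exp G A) (Var_s e) =
    (\<Sum>f\<in>edges G. if f = e then of_bool (cuts_edge A e) else 0)"
    unfolding cut_exp_def lookup_sum
    by (intro sum.cong refl) (auto simp: lookup_single when_def)
  then show "lookup (cut_exp G A) (Var_s e) = of_bool (e \<in> edges G \<and> cuts_edge A e)"
    using assms by simp
  have "lookup (cut_exp G A) (Var_t e) =
    (\<Sum>f\<in>edges G. if f = e then of_bool (\<not> cuts_edge A e) else 0)"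
    unfolding cut_exp_def lookup_sum
    by (intro sum.cong refl) (auto simp: lookup_single when_def)
  then show "lookup (cut_exp G A) (Var_t e) = of_bool (e \<in> edges G \<and> \<not> cuts_edge A e)"
    using assms by simp
qed

lemma mdeg_sum_single:
  assumes "finite E"
  shows "mdeg (\<Sum>e\<in>E. single (f e) 1) = card E"
  using assms
  by (induction E rule: finite_induct) (simp_all add: mdeg_add, simp_all add: mdeg_def)

lemma mdeg_cut_exp: "finite (edges G) \<Longrightarrow> mdeg (cut_exp G A) = card (edges G)"
  unfolding cut_exp_def by (rule mdeg_sum_single)

lemma keys_cut_exp: "keys (cut_exp G A) \<subseteq> cut_vars G"
proof -
  have "keys (cut_exp G A) \<subseteq>
    (\<Union>e\<in>edges G. keys (single (if cuts_edge A e then Var_s e else Var_t e) (1::nat)))"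
    unfolding cut_exp_def by (rule keys_sum)
  also have "\<dots> \<subseteq> cut_vars G" by (auto simp: cut_vars_def)
  finally show ?thesis .
qed

lemma cut_monomial_eq:
  assumes "finite (edges G)"
  shows "cut_monomial G A = (single (cut_exp G A) 1 :: ('a set cut_var, 'k::field) mpoly)"
proof -
  have "(\<Prod>e\<in>E. mpoly_var (f e)) = (single (\<Sum>e\<in>E. single (f e) 1) 1 :: ('a set cut_var, 'k) mpoly)"
    if "finite E" for E and f :: "'a set \<Rightarrow> 'a set cut_var"
    using that by (induction E rule: finite_induct) (simp_all add: mpoly_var_def mult_single)
  then show ?thesis using assms by (simp add: cut_monomial_def cut_exp_def cuts_edge_def)
qed

text \<open>Each cut monomial has one variable for each edge.\<close>

lemma equigenerated_cut_exps:
  assumes "simple_graph G" "edges G \<noteq> {}"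
  shows "equigenerated (cut_vars G) (cut_exps G) (card (edges G))"
proof
  show "keys a \<subseteq> cut_vars G" "mdeg a = card (edges G)" if "a \<in> cut_exps G" for a
    using that keys_cut_exp[of G] mdeg_cut_exp[OF finite_edges[OF assms(1)]]
    by (auto simp: cut_exps_def dest: subsetD)
  show "0 < card (edges G)"
    using assms finite_edges by (simp add: card_gt_0_iff)
qed

lemma finite_cut_exps: "simple_graph G \<Longrightarrow> finite (cut_exps G)"
  by (simp add: cut_exps_def simple_graph_def)

lemma cut_ideal_eq:
  assumes "simple_graph G"
  shows "cut_ideal G = (monomial_ideal (cut_vars G) (cut_exps G) :: ('a set cut_var, 'k::field) mpoly set)"
proof -
  have "{cut_monomial G A | A. A \<subseteq> verts G} =
    ((\<lambda>a. single a 1) ` cut_exps G :: ('a set cut_var, 'k) mpoly set)"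
    using cut_monomial_eq[OF finite_edges[OF assms]] by (auto simp: cut_exps_def)
  then show ?thesis
    unfolding cut_ideal_def by (simp only:) (rule genideal_monomials, auto simp: cut_exps_def dest: subsetD[OF keys_cut_exp])
qed

text \<open>The square of the ideal belongs to the two-fold sums, whose degrees are again all equal.\<close>

lemma freiman_cut_ideal_iff:
  assumes G: "simple_graph G" "edges G \<noteq> {}"
  shows "freiman_ideal (cut_vars G) (cut_ideal G :: ('a set cut_var, 'k::field) mpoly set) \<longleftrightarrow>
    (\<exists>l. krull_dim (semigroup_ring (cut_exps G) :: ('a set cut_var, 'k) mpoly ring) = enat l \<and>
      int (card (sumset (cut_exps G) (cut_exps G))) =
      int l * int (card (cut_exps G)) - int (l choose 2))"
proof -
  let ?V = "cut_vars G" and ?T = "cut_exps G"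
  interpret equigenerated ?V ?T "card (edges G)" "TYPE('k)"
    by (rule equigenerated_cut_exps[OF G])
  have fin: "finite (edges G)" by (rule finite_edges[OF G(1)])
  have two: "nsums 2 ?T = sumset ?T ?T"
    by (auto simp: numeral_2_eq_2 sumset_def)
  have "monomials_of_degree ?V (card (edges G)) \<supseteq>
    {cut_monomial G A | A. A \<subseteq> verts G}"
    using keys_cut_exp[of G] mdeg_cut_exp[OF fin] cut_monomial_eq[OF fin]
    unfolding monomials_of_degree_def mdeg_def by blast
  then have eq: "equigenerated_monomial_ideal ?V (cut_ideal G :: ('a set cut_var, 'k) mpoly set)"
    unfolding equigenerated_monomial_ideal_def cut_ideal_def by blast
  have "min_num_gens (mpoly_ring ?V) (monomial_ideal ?V ?T :: ('a set cut_var, 'k) mpoly set) = card ?T"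
    by (rule min_num_gens_monomial_ideal[OF finite_cut_exps[OF G(1)] antichain_mdeg[OF T_deg] T_keys])
  moreover have "min_num_gens (mpoly_ring ?V)
    (ideal_pow (mpoly_ring ?V) (monomial_ideal ?V ?T :: ('a set cut_var, 'k) mpoly set) 2) = card (nsums 2 ?T)"
    unfolding ideal_pow_monomial_ideal
  proof (rule min_num_gens_monomial_ideal)
    show "finite (nsums 2 ?T)" using finite_cut_exps[OF G(1)] by (simp add: two finite_sumset)
    show "antichain (nsums 2 ?T)" by (rule antichain_mdeg) (rule nsums_mdeg[OF T_deg])
    show "keys a \<subseteq> ?V" if "a \<in> nsums 2 ?T" for a by (rule nsums_keys[OF T_keys that])
  qed
  ultimately show ?thesis
    unfolding freiman_ideal_def cut_ideal_eq[OF G(1)] analytic_spread_eq two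
    using eq[unfolded cut_ideal_eq[OF G(1)]] by simp
qed

text \<open>An exponent vector in a \<open>k\<close>-fold sum is determined by its exponents at the variables
  \<open>Var_s e\<close>, because the exponents at \<open>Var_s e\<close> and \<open>Var_t e\<close> add up to \<open>k\<close>.\<close>

lemma nsums_cut_exps_sum:
  assumes "simple_graph G" "x \<in> nsums k (cut_exps G)"
  shows "lookup x (Var_s e) + lookup x (Var_t e) = (if e \<in> edges G then k else 0)"
  using assms(2)
proof (induction k arbitrary: x)
  case (Suc k)
  then obtain y A where "x = y + cut_exp G A" "y \<in> nsums k (cut_exps G)"
    by (auto simp: sumset_def cut_exps_def)
  then show ?case
    using Suc.IH[of y] by (auto simp: lookup_add lookup_cut_exp[OF finite_edges[OF assms(1)]])
qed simp

lemma inj_on_restrict_nsums_cut_exps: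
  assumes "simple_graph G"
  shows "inj_on (\<lambda>x. restrict (\<lambda>e. lookup x (Var_s e)) (edges G)) (nsums k (cut_exps G))"
    (is "inj_on ?f (nsums k ?T)")
proof (rule inj_onI)
  fix x y assume xy: "x \<in> nsums k ?T" "y \<in> nsums k ?T" "?f x = ?f y"
  have s: "lookup x (Var_s e) = lookup y (Var_s e)" for e
    using fun_cong[OF xy(3), of e] nsums_cut_exps_sum[OF assms xy(1), of e] nsums_cut_exps_sum[OF assms xy(2), of e] by (cases "e \<in> edges G") auto
  show "x = y"
  proof (rule poly_mapping_eqI)
    fix v show "lookup x v = lookup y v"
      using s nsums_cut_exps_sum[OF assms xy(1)] nsums_cut_exps_sum[OF assms xy(2)] by (cases v) (auto, metis add_left_cancel)
  qed
qed

lemma card_nsums_cut_exps: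
  assumes "simple_graph G"
  shows "finite (nsums k (cut_exps G))" and "card (nsums k (cut_exps G)) \<le> (k + 1) ^ card (edges G)"
proof -
  let ?E = "edges G" and ?T = "cut_exps G"
  let ?f = "\<lambda>x. restrict (\<lambda>e. lookup x (Var_s e)) ?E"
  have fin: "finite ?E" by (rule finite_edges[OF assms])
  show finT: "finite (nsums k ?T)"
    by (induction k) (simp_all add: finite_sumset finite_cut_exps[OF assms])
  note inj = inj_on_restrict_nsums_cut_exps[OF assms, of k]
  have "?f ` nsums k ?T \<subseteq> PiE ?E (\<lambda>_. {..k})"
  proof (intro image_subsetI restrict_PiE_iff[THEN iffD2] ballI)
    fix x e assume "x \<in> nsums k ?T" "e \<in> ?E"
    then show "lookup x (Var_s e) \<in> {..k}" using nsums_cut_exps_sum[OF assms, of x k e] by simp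
  qed
  then have "card (nsums k ?T) \<le> card (PiE ?E (\<lambda>_. {..k}))"
    by (rule card_inj_on_le[OF inj]) (simp add: fin finite_PiE)
  also have "\<dots> = (k + 1) ^ card ?E" by (simp add: card_PiE fin)
  finally show "card (nsums k ?T) \<le> (k + 1) ^ card ?E" .
qed

section \<open>The convex geometry of cuts\<close>

definition rat_vec :: "('b \<Rightarrow>\<^sub>0 nat) \<Rightarrow> 'b \<Rightarrow>\<^sub>0 rat" where
  "rat_vec p = Poly_Mapping.map of_nat p"

lemma lookup_rat_vec [simp]: "lookup (rat_vec p) k = of_nat (lookup p k)"
  by (simp add: rat_vec_def Poly_Mapping.map.rep_eq when_def)

lemma rat_vec_add: "rat_vec (p + q) = rat_vec p + rat_vec q"
  by (rule poly_mapping_eqI) (simp add: lookup_add)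

lemma inj_rat_vec: "inj rat_vec"
proof (rule injI)
  fix p q :: "'b \<Rightarrow>\<^sub>0 nat" assume "rat_vec p = rat_vec q"
  then have "lookup (rat_vec p) k = lookup (rat_vec q) k" for k by simp
  then show "p = q" by (intro poly_mapping_eqI) simp
qed

text \<open>The linear algebra needs rational entries, which do not change the number of sums.\<close>

lemma card_sumset_rat_vec: "card (sumset (rat_vec ` S) (rat_vec ` S)) = card (sumset S S)"
proof -
  have "sumset (rat_vec ` S) (rat_vec ` S) = rat_vec ` sumset S S"
  proof
    show "sumset (rat_vec ` S) (rat_vec ` S) \<subseteq> rat_vec ` sumset S S"
      unfolding sumset_def by (auto simp: rat_vec_add[symmetric] intro!: imageI) blast
    show "rat_vec ` sumset S S \<subseteq> sumset (rat_vec ` S) (rat_vec ` S)"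
      unfolding sumset_def by (auto simp: rat_vec_add) blast
  qed
  then show ?thesis by (simp add: card_image inj_on_subset[OF inj_rat_vec])
qed

definition edge_vec :: "'a set \<Rightarrow> 'a set cut_var \<Rightarrow>\<^sub>0 rat" where
  "edge_vec e = single (Var_s e) 1 - single (Var_t e) 1"

lemma lookup_edge_vec [simp]:
  "lookup (edge_vec e) (Var_s f) = of_bool (e = f)"
  "lookup (edge_vec e) (Var_t f) = - of_bool (e = f)"
  by (simp_all add: edge_vec_def lookup_minus lookup_single when_def)

text \<open>The functional counts the edges on which a vector differs from \<open>p\<close>.\<close>

lemma exposed_cut_exp:
  assumes "simple_graph G" "p \<in> rat_vec ` cut_exps G"
  shows "exposed (rat_vec ` cut_exps G) p"
proof -
  obtain A where p: "p = rat_vec (cut_exp G A)" using assms(2) by (auto simp: cut_exps_def)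
  have fin: "finite (edges G)" by (rule finite_edges[OF assms(1)])
  define h :: "('a set cut_var \<Rightarrow>\<^sub>0 rat) \<Rightarrow> rat" where
    "h x = (\<Sum>e\<in>edges G. lookup x (if cuts_edge A e then Var_t e else Var_s e))" for x
  have "h (x + y) = h x + h y" for x y
    by (simp add: h_def lookup_add sum.distrib)
  moreover have "h p < h x" if x: "x \<in> rat_vec ` cut_exps G - {p}" for x
  proof -
    obtain B where B: "x = rat_vec (cut_exp G B)" using x by (auto simp: cut_exps_def)
    have "\<exists>e\<in>edges G. cuts_edge A e \<noteq> cuts_edge B e"
    proof (rule ccontr)
      assume "\<not> ?thesis"
      then have "cut_exp G A = cut_exp G B" unfolding cut_exp_def by (intro sum.cong) auto
      then show False using x p B by simp
    qed
    then obtain e where e: "e \<in> edges G" "cuts_edge A e \<noteq> cuts_edge B e" by blast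
    have "0 < h x" unfolding h_def
    proof (rule sum_pos2[OF fin e(1)])
      show "0 < lookup x (if cuts_edge A e then Var_t e else Var_s e)"
        using e by (simp add: B lookup_cut_exp[OF fin])
    qed (auto simp: B)
    moreover have "h p = 0"
      unfolding h_def p by (intro sum.neutral) (auto simp: lookup_cut_exp[OF fin])
    ultimately show ?thesis by simp
  qed
  ultimately show ?thesis unfolding exposed_def by blast
qed

lemma card_le_dim:
  assumes "finite X" "pm.independent B" "B \<subseteq> pm.span X"
  shows "card B \<le> pm.dim X"
proof -
  obtain C where C: "C \<subseteq> X" "pm.independent C" "X \<subseteq> pm.span C" "card C = pm.dim X"
    using pm.basis_exists[of X] by blast
  have "B \<subseteq> pm.span C"
    using assms(3) pm.span_minimal[OF C(3) pm.subspace_span] by blast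
  then show ?thesis
    using pm.independent_span_bound[OF finite_subset[OF C(1) assms(1)] assms(2)] C(4) by simp
qed

text \<open>The span contains the vector of the empty cut and, by
  \<open>cut u + cut v - cut {u, v} - cut {} = 2 edge_vec {u, v}\<close>, all edge vectors. These are independent: the edge
  vectors have separate supports, and they have sum 0 at the two variables of each edge, unlike the empty cut.\<close>

lemma dim_cut_exps:
  assumes G: "simple_graph G" "edges G \<noteq> {}"
  shows "card (edges G) + 1 \<le> pm.dim (rat_vec ` cut_exps G)"
proof -
  let ?X = "rat_vec ` cut_exps G"
  have fin: "finite (edges G)" by (rule finite_edges[OF G(1)])
  let ?x = "\<lambda>A. rat_vec (cut_exp G A)"
  have x: "?x A \<in> pm.span ?X" if "A \<subseteq> verts G" for A
    using that by (intro pm.span_base) (auto simp: cut_exps_def)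
  have edge: "edge_vec e \<in> pm.span ?X" if e: "e \<in> edges G" for e
  proof -
    obtain a b where ab: "e = {a, b}" "a \<noteq> b" "a \<in> verts G" "b \<in> verts G"
      using edge_pair[OF G(1) e] by blast
    have "lookup (pm_scale (1/2) (?x {a} + ?x {b} - ?x {a, b} - ?x {})) k = lookup (edge_vec e) k" for k
    proof -
      have cut: "of_bool (cuts_edge {a} f) + of_bool (cuts_edge {b} f) - of_bool (cuts_edge {a, b} f) =
        (of_bool (e = f) * 2 :: rat)" if f: "f \<in> edges G" for f
      proof -
        obtain c d where cd: "f = {c, d}" "c \<noteq> d" using edge_pair[OF G(1) f] by blast
        show ?thesis using ab(1,2) cd by (auto simp: cuts_edge_pair doubleton_eq_iff)
      qed
      show ?thesis
      proof (cases k)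
        case (Var_s f)
        then show ?thesis using cut[of f] e
          by (cases "f \<in> edges G") (auto simp: lookup_add lookup_minus lookup_cut_exp[OF fin])
      next
        case (Var_t f)
        then show ?thesis using cut[of f] e
          by (cases "f \<in> edges G") (auto simp: lookup_add lookup_minus lookup_cut_exp[OF fin] of_bool_not_iff)
      qed
    qed
    then have "pm_scale (1/2) (?x {a} + ?x {b} - ?x {a, b} - ?x {}) = edge_vec e"
      by (rule poly_mapping_eqI)
    moreover have "pm_scale (1/2) (?x {a} + ?x {b} - ?x {a, b} - ?x {}) \<in> pm.span ?X"
      using ab by (intro pm.span_scale pm.span_diff pm.span_add x) auto
    ultimately show ?thesis by simp
  qed
  have indep: "pm.independent (edge_vec ` F) \<and> card (edge_vec ` F) = card F" if "finite F" for F :: "'a set set"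
    using that
  proof (induction F rule: finite_induct)
    case (insert e F)
    have "pm.span (edge_vec ` F) \<subseteq> {p. lookup p (Var_s e) = 0}"
      using insert.hyps by (intro pm.span_minimal pm.subspaceI) (auto simp: lookup_add)
    then have new: "edge_vec e \<notin> pm.span (edge_vec ` F)" by auto
    then have "edge_vec e \<notin> edge_vec ` F" using pm.span_base by blast
    then show ?case
      using insert pm.independent_insertI[OF new] by (simp add: card_insert_disjoint)
  qed (simp add: pm.independent_empty)
  obtain e where e: "e \<in> edges G" using G by blast
  have "pm.span (edge_vec ` edges G) \<subseteq> {p. lookup p (Var_s e) + lookup p (Var_t e) = 0}"
    by (intro pm.span_minimal pm.subspaceI) (auto simp: lookup_add distrib_left[symmetric])
  moreover have "lookup (?x {}) (Var_s e) + lookup (?x {}) (Var_t e) = 1"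
    using e by (simp add: lookup_cut_exp[OF fin])
  ultimately have new: "?x {} \<notin> pm.span (edge_vec ` edges G)" by auto
  let ?B = "insert (?x {}) (edge_vec ` edges G)"
  have "card ?B = card (edges G) + 1"
    using indep[OF fin] fin pm.span_base[of "?x {}" "edge_vec ` edges G"] new
    by (subst card_insert_disjoint) auto
  moreover have "card ?B \<le> pm.dim ?X"
  proof (rule card_le_dim)
    show "pm.independent ?B" using pm.independent_insertI[OF new] indep[OF fin] by blast
    show "?B \<subseteq> pm.span ?X" using edge x[of "{}"] by auto
  qed (simp add: finite_cut_exps[OF G(1)])
  ultimately show ?thesis by simp
qed

text \<open>The Krull dimension is at most the dimension of the span, and the right-hand side of the Freiman equality
  increases up to there, so it stays below the number of sums.\<close>

theorem not_freiman_if_excess: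
  assumes G: "simple_graph G" "edges G \<noteq> {}"
    and Y: "Y \<subseteq> rat_vec ` cut_exps G" "0 < excess Y"
  shows "\<not> freiman_ideal (cut_vars G) (cut_ideal G :: ('a set cut_var, 'k::field) mpoly set)"
proof
  let ?T = "cut_exps G" and ?X = "rat_vec ` cut_exps G"
  assume "freiman_ideal (cut_vars G) (cut_ideal G :: ('a set cut_var, 'k) mpoly set)"
  then obtain l where l: "krull_dim (semigroup_ring ?T :: ('a set cut_var, 'k) mpoly ring) = enat l"
    and eq: "int (card (sumset ?T ?T)) = int l * int (card ?T) - int (l choose 2)"
    using freiman_cut_ideal_iff[OF G] by blast
  have fin: "finite ?X" using finite_cut_exps[OF G(1)] by simp
  have card: "card ?X = card ?T" by (simp add: card_image inj_on_subset[OF inj_rat_vec])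
  have "enat l \<le> enat (card (edges G) + 1)"
    unfolding l[symmetric]
    by (rule krull_dim_semigroup_ring_le) (rule card_nsums_cut_exps[OF G(1)])+
  then have "l \<le> pm.dim ?X" using dim_cut_exps[OF G] by simp
  moreover have "pm.dim ?X \<le> card ?X"
    using fin by (intro pm.dim_le_card pm.span_superset)
  ultimately have "int l * int (card ?X) - int (l choose 2) \<le>
    int (pm.dim ?X) * int (card ?X) - int (pm.dim ?X choose 2)"
    by (rule Freiman_bound_mono)
  moreover have "0 < excess ?X"
    using Y excess_mono[OF fin Y(1) exposed_cut_exp[OF G(1)]] by simp
  ultimately show False
    using eq by (simp add: excess_def card card_sumset_rat_vec)
qed

section \<open>Quotients on four vertices\<close>

definition num_true :: "bool list \<Rightarrow> nat" where
  "num_true ps = length (filter (\<lambda>p. p) ps)"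

text \<open>The arguments tell which pairs of the vertices 0, 1, 2, 3 are adjacent. The graphs described are the trees, the
  4-cycle, and the graphs with five or six edges: all connected graphs on four vertices except the triangle with a
  pendant edge.\<close>

definition bad_quotient :: "bool \<Rightarrow> bool \<Rightarrow> bool \<Rightarrow> bool \<Rightarrow> bool \<Rightarrow> bool \<Rightarrow> bool" where
  "bad_quotient p01 p02 p03 p12 p13 p23 \<longleftrightarrow>
    (let n = num_true [p01, p02, p03, p12, p13, p23] in
      n = 3 \<and> \<not> (p01 \<and> p02 \<and> p12) \<and> \<not> (p01 \<and> p03 \<and> p13) \<and> \<not> (p02 \<and> p03 \<and> p23) \<and> \<not> (p12 \<and> p13 \<and> p23) \<or>
      n = 4 \<and> p01 = p23 \<and> p02 = p13 \<and> p03 = p12 \<or> n \<ge> 5)"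

text \<open>The cut of the classes chosen by \<open>(a, b, c)\<close>, where class 0 stays on the other side, on the pairs in the order
  01, 02, 03, 12, 13, 23.\<close>

definition cut_pattern :: "bool \<times> bool \<times> bool \<Rightarrow> bool list" where
  "cut_pattern = (\<lambda>(a, b, c). [a, b, c, a \<noteq> b, a \<noteq> c, b \<noteq> c])"

text \<open>The sum of two cuts of the complete graph on four vertices, with the entries at absent edges cleared.\<close>

definition pattern_sum :: "bool list \<Rightarrow> bool list \<Rightarrow> bool list \<Rightarrow> nat list" where
  "pattern_sum ps xs ys = map (\<lambda>(p, x, y). if p then of_bool x + of_bool y else 0) (zip ps (zip xs ys))"

primrec pattern_sums :: "bool list \<Rightarrow> bool list list \<Rightarrow> nat list list" where
  "pattern_sums ps [] = []"
| "pattern_sums ps (x # xs) = map (pattern_sum ps x) (x # xs) @ pattern_sums ps xs"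

definition cut_patterns :: "bool list list" where
  "cut_patterns = map cut_pattern (List.product [False, True] (List.product [False, True] [False, True]))"

text \<open>For \<open>n\<close> edges the eight cuts span dimension at most \<open>n + 1\<close>, and each bound is larger by one than
  \<open>8 (n + 1) - (n + 1 choose 2)\<close>, which is 26, 30, 33, 35 for \<open>n = 3, 4, 5, 6\<close>. The triangle with a pendant edge has
  only 30 sums. Each unordered pair of cuts is added once, which keeps the evaluation short.\<close>

lemma pattern_sums_count:
  "\<forall>p01 p02 p03 p12 p13 p23. bad_quotient p01 p02 p03 p12 p13 p23 \<longrightarrow>
    (let ps = [p01, p02, p03, p12, p13, p23]; n = num_true ps in
      (if n = 3 then 27 else if n = 4 then 31 else if n = 5 then 34 else 36)
        \<le> length (remdups (pattern_sums ps cut_patterns)))"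
  by code_simp

text \<open>Vertex 0 is fixed on one side of a bipartition of the five vertices, and \<open>a, b, c, d\<close> tell which of the others join it;
  an edge has to cross unless all do.\<close>

definition connected_on_5 ::
  "bool \<Rightarrow> bool \<Rightarrow> bool \<Rightarrow> bool \<Rightarrow> bool \<Rightarrow> bool \<Rightarrow> bool \<Rightarrow> bool \<Rightarrow> bool \<Rightarrow> bool \<Rightarrow> bool" where
  "connected_on_5 p01 p02 p03 p04 p12 p13 p14 p23 p24 p34 \<longleftrightarrow>
    (\<forall>a b c d. \<not> (a \<and> b \<and> c \<and> d) \<longrightarrow>
      p01 \<and> \<not> a \<or> p02 \<and> \<not> b \<or> p03 \<and> \<not> c \<or> p04 \<and> \<not> d \<or> p12 \<and> a \<noteq> b \<or> p13 \<and> a \<noteq> c \<or>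
      p14 \<and> a \<noteq> d \<or> p23 \<and> b \<noteq> c \<or> p24 \<and> b \<noteq> d \<or> p34 \<and> c \<noteq> d)"

text \<open>The disjuncts are the ten identifications of two vertices. The merged vertex comes first, followed by the
  other three in order.\<close>

lemma bad_identification:
  "\<forall>p01 p02 p03 p04 p12 p13 p14 p23 p24 p34.
    connected_on_5 p01 p02 p03 p04 p12 p13 p14 p23 p24 p34 \<longrightarrow>
      bad_quotient (p02 \<or> p12) (p03 \<or> p13) (p04 \<or> p14) p23 p24 p34 \<or>
      bad_quotient (p01 \<or> p12) (p03 \<or> p23) (p04 \<or> p24) p13 p14 p34 \<or>
      bad_quotient (p01 \<or> p13) (p02 \<or> p23) (p04 \<or> p34) p12 p14 p24 \<or>
      bad_quotient (p01 \<or> p14) (p02 \<or> p24) (p03 \<or> p34) p12 p13 p23 \<or>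
      bad_quotient (p01 \<or> p02) (p13 \<or> p23) (p14 \<or> p24) p03 p04 p34 \<or>
      bad_quotient (p01 \<or> p03) (p12 \<or> p23) (p14 \<or> p34) p02 p04 p24 \<or>
      bad_quotient (p01 \<or> p04) (p12 \<or> p24) (p13 \<or> p34) p02 p03 p23 \<or>
      bad_quotient (p02 \<or> p03) (p12 \<or> p13) (p24 \<or> p34) p01 p04 p14 \<or>
      bad_quotient (p02 \<or> p04) (p12 \<or> p14) (p23 \<or> p34) p01 p03 p13 \<or>
      bad_quotient (p03 \<or> p04) (p13 \<or> p14) (p23 \<or> p24) p01 p02 p12"
  by code_simp

definition adj :: "'a ugraph \<Rightarrow> ('a \<Rightarrow> nat) \<Rightarrow> nat \<Rightarrow> nat \<Rightarrow> bool" where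
  "adj G \<phi> i j \<longleftrightarrow> (\<exists>u v. {u, v} \<in> edges G \<and> \<phi> u = i \<and> \<phi> v = j)"

lemma set_pattern_sums:
  "set (pattern_sums ps xs) \<subseteq> {pattern_sum ps x y | x y. x \<in> set xs \<and> y \<in> set xs}"
proof (induction xs)
  case (Cons x xs)
  then have "set (pattern_sums ps xs) \<subseteq>
    {pattern_sum ps a b | a b. a \<in> set (x # xs) \<and> b \<in> set (x # xs)}"
    by fastforce
  moreover have "set (map (pattern_sum ps x) (x # xs)) \<subseteq>
    {pattern_sum ps a b | a b. a \<in> set (x # xs) \<and> b \<in> set (x # xs)}"
    by auto
  ultimately show ?case by simp
qed simp

definition selected :: "bool \<times> bool \<times> bool \<Rightarrow> nat \<Rightarrow> bool" where
  "selected = (\<lambda>(a, b, c) i. i = 1 \<and> a \<or> i = 2 \<and> b \<or> i = 3 \<and> c)"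

definition pairs4 :: "(nat \<times> nat) list" where
  "pairs4 = [(0, 1), (0, 2), (0, 3), (1, 2), (1, 3), (2, 3)]"

lemma pairs4_iff: "(i, j) \<in> set pairs4 \<longleftrightarrow> i < j \<and> j < 4"
  by (auto simp: pairs4_def numeral_eq_Suc less_Suc_eq)

lemma cut_pattern_eq: "cut_pattern t = map (\<lambda>(i, j). selected t i \<noteq> selected t j) pairs4"
  by (cases t) (simp add: cut_pattern_def pairs4_def selected_def)

text \<open>The cut vectors of unions of classes lie in the span of the empty cut and one vector for each adjacent pair
  of classes, while their sums are told apart by one representative edge for each such pair.\<close>

theorem not_freiman_if_bad_quotient:
  fixes \<phi> :: "'a \<Rightarrow> nat"
  assumes G: "simple_graph G" "edges G \<noteq> {}" and \<phi>: "\<And>v. v \<in> verts G \<Longrightarrow> \<phi> v < 4"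
    and bad: "bad_quotient (adj G \<phi> 0 1) (adj G \<phi> 0 2) (adj G \<phi> 0 3)
      (adj G \<phi> 1 2) (adj G \<phi> 1 3) (adj G \<phi> 2 3)"
  shows "\<not> freiman_ideal (cut_vars G) (cut_ideal G :: ('a set cut_var, 'k::field) mpoly set)"
proof -
  have fin: "finite (edges G)" by (rule finite_edges[OF G(1)])
  define S where "S t = {v \<in> verts G. selected t (\<phi> v)}" for t
  define ps where "ps = map (\<lambda>(i, j). adj G \<phi> i j) pairs4"
  define n where "n = num_true ps"
  have bound: "(if n = 3 then 27 else if n = 4 then 31 else if n = 5 then 34 else 36)
      \<le> length (remdups (pattern_sums ps cut_patterns))"
    using pattern_sums_count[rule_format, OF bad] 
    unfolding n_def ps_def pairs4_def Let_def list.map prod.case .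
  have n: "n \<in> {3, 4, 5, 6}"
    using bad unfolding bad_quotient_def Let_def n_def ps_def pairs4_def num_true_def
    by (simp split: if_splits)
  have cut: "cuts_edge (S t) {u, v} \<longleftrightarrow> selected t (\<phi> u) \<noteq> selected t (\<phi> v)"
    if "{u, v} \<in> edges G" for t u v
  proof -
    have "{u, v} \<subseteq> verts G" "card {u, v} = 2" using G(1) that by (auto simp: simple_graph_def)
    then have "u \<noteq> v" "u \<in> verts G" "v \<in> verts G" by auto
    then show ?thesis by (simp add: cuts_edge_pair S_def)
  qed
  define y where "y t = cut_exp G (S t)" for t
  define Y where "Y = range y"
  have "S t \<subseteq> verts G" for t by (auto simp: S_def)
  then have Y_sub: "Y \<subseteq> cut_exps G" by (auto simp: Y_def y_def cut_exps_def)
  then have finY: "finite Y" using finite_cut_exps[OF G(1)] by (rule finite_subset)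
  have cardY: "card Y \<le> 8"
  proof -
    have "card Y \<le> card (UNIV :: (bool \<times> bool \<times> bool) set)"
      unfolding Y_def by (rule card_image_le) simp
    then show ?thesis by (simp add: card_cartesian_product flip: UNIV_Times_UNIV)
  qed
  have sums: "length (remdups (pattern_sums ps cut_patterns)) \<le> card (sumset Y Y)"
  proof -
    have "\<exists>e. \<forall>q. case_prod (adj G \<phi>) q \<longrightarrow>
      (\<exists>u v. e q = {u, v} \<and> e q \<in> edges G \<and> \<phi> u = fst q \<and> \<phi> v = snd q)"
      by (rule choice) (auto simp: adj_def)
    then obtain e where e: "\<And>q. case_prod (adj G \<phi>) q \<Longrightarrow>
      (\<exists>u v. e q = {u, v} \<and> e q \<in> edges G \<and> \<phi> u = fst q \<and> \<phi> v = snd q)"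
      by blast
    define code where "code x = map (\<lambda>q. if case_prod (adj G \<phi>) q then lookup x (Var_s (e q)) else 0) pairs4"
      for x :: "'a set cut_var \<Rightarrow>\<^sub>0 nat"
    have lookup_y: "lookup (y t) (Var_s (e (i, j))) = of_bool (selected t i \<noteq> selected t j)"
      if "adj G \<phi> i j" for t i j
      using e[of "(i, j)"] that cut[of _ _ t] by (auto simp: y_def lookup_cut_exp[OF fin])
    have "pattern_sum ps (cut_pattern t) (cut_pattern t') = code (y t + y t')" for t t'
      unfolding pattern_sum_def ps_def cut_pattern_eq code_def
      by (simp add: pairs4_def lookup_add lookup_y)
    note pattern = this
    have "set (pattern_sums ps cut_patterns) \<subseteq> code ` sumset Y Y"
    proof
      fix z assume "z \<in> set (pattern_sums ps cut_patterns)"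
      then obtain c c' where c: "z = pattern_sum ps c c'" "c \<in> set cut_patterns" "c' \<in> set cut_patterns"
        using set_pattern_sums[of ps cut_patterns] by blast
      moreover have "set cut_patterns \<subseteq> range cut_pattern" by (auto simp: cut_patterns_def)
      ultimately obtain t t' where "c = cut_pattern t" "c' = cut_pattern t'" by blast
      then have "z = code (y t + y t')" using c(1) pattern by simp
      moreover have "y t + y t' \<in> sumset Y Y" unfolding sumset_def Y_def by blast
      ultimately show "z \<in> code ` sumset Y Y" by blast
    qed
    then have "card (set (pattern_sums ps cut_patterns)) \<le> card (code ` sumset Y Y)"
      by (intro card_mono finite_imageI finite_sumset finY)
    also have "\<dots> \<le> card (sumset Y Y)" by (intro card_image_le finite_sumset finY)
    finally show ?thesis by (simp add: length_remdups_card_conv)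
  qed
  have dim: "pm.dim (rat_vec ` Y) \<le> n + 1"
  proof -
    \<comment> \<open>The pair of classes of an edge, in increasing order; equal entries belong to edges that are never cut.\<close>
    define cls where "cls e = (Min (\<phi> ` e), Max (\<phi> ` e))" for e
    define P where "P = {q \<in> set pairs4. case_prod (adj G \<phi>) q}"
    define w where "w q = (\<Sum>e\<in>{e \<in> edges G. cls e = q}. edge_vec e)" for q
    let ?z = "rat_vec (cut_exp G {})"
    have finP: "finite P" by (simp add: P_def)
    have lookup_w: "lookup (w q) (Var_s f) = of_bool (f \<in> edges G \<and> cls f = q)"
      "lookup (w q) (Var_t f) = - of_bool (f \<in> edges G \<and> cls f = q)" for q f
      using fin by (auto simp: w_def lookup_sum sum_negf of_bool_def sum.delta' cong: if_cong)
    have cut_cls: "cuts_edge (S t) f \<longleftrightarrow> cls f \<in> P \<and> selected t (fst (cls f)) \<noteq> selected t (snd (cls f))"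
      if f: "f \<in> edges G" for t f
    proof -
      obtain u v where uv: "f = {u, v}" "\<phi> u \<le> \<phi> v" "v \<in> verts G"
        using edge_pair[OF G(1) f] by (metis insert_commute nle_le)
      have cls: "cls f = (\<phi> u, \<phi> v)" using uv(2) by (simp add: cls_def uv(1))
      have "adj G \<phi> (\<phi> u) (\<phi> v)" using f uv(1) by (auto simp: adj_def)
      then have "cls f \<in> P \<longleftrightarrow> \<phi> u < \<phi> v"
        using \<phi>[OF uv(3)] by (simp add: cls P_def pairs4_iff)
      moreover have "cuts_edge (S t) f \<longleftrightarrow> selected t (\<phi> u) \<noteq> selected t (\<phi> v)"
        using cut[of u v t] f uv(1) by simp
      moreover have "\<phi> u < \<phi> v \<or> \<phi> u = \<phi> v" using uv(2) by auto
      ultimately show ?thesis unfolding cls fst_conv snd_conv by metis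
    qed
    have y_eq: "rat_vec (y t) = ?z + (\<Sum>q\<in>P. pm_scale (of_bool (selected t (fst q) \<noteq> selected t (snd q))) (w q))"
      (is "_ = ?z + ?s") for t
    proof (rule poly_mapping_eqI)
      fix k
      have delta: "(\<Sum>q\<in>P. of_bool (selected t (fst q) \<noteq> selected t (snd q)) * of_bool (f \<in> edges G \<and> cls f = q)) =
        (of_bool (f \<in> edges G \<and> cuts_edge (S t) f) :: rat)" for f
      proof -
        have "(\<Sum>q\<in>P. of_bool (selected t (fst q) \<noteq> selected t (snd q)) * of_bool (f \<in> edges G \<and> cls f = q)) =
          (\<Sum>q\<in>P. if cls f = q then of_bool (f \<in> edges G \<and> selected t (fst (cls f)) \<noteq> selected t (snd (cls f))) else (0 :: rat))"
          by (intro sum.cong refl) auto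
        also have "\<dots> = of_bool (f \<in> edges G \<and> cuts_edge (S t) f)"
          using finP cut_cls[of f t] by (auto simp: sum.delta)
        finally show ?thesis .
      qed
      show "lookup (rat_vec (y t)) k = lookup (?z + ?s) k"
      proof (cases k)
        case (Var_s f)
        then show ?thesis
          using delta[of f] by (simp add: lookup_add lookup_sum lookup_w y_def lookup_cut_exp[OF fin])
      next
        case (Var_t f)
        have "lookup ?s k = - of_bool (f \<in> edges G \<and> cuts_edge (S t) f)"
          using delta[of f] by (simp add: Var_t lookup_sum lookup_w sum_negf)
        then show ?thesis
          by (auto simp: Var_t lookup_add y_def lookup_cut_exp[OF fin])
      qed
    qed
    have "rat_vec ` Y \<subseteq> pm.span (insert ?z (w ` P))"
    proof
      fix x assume "x \<in> rat_vec ` Y"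
      then obtain t where "x = rat_vec (y t)" by (auto simp: Y_def)
      then show "x \<in> pm.span (insert ?z (w ` P))"
        unfolding y_eq by (auto intro!: pm.span_add pm.span_sum pm.span_scale intro: pm.span_base)
    qed
    then have "pm.dim (rat_vec ` Y) \<le> card (insert ?z (w ` P))"
      by (rule pm.dim_le_card) (simp add: finP)
    also have "\<dots> \<le> Suc (card P)"
      using card_insert_le_m1[of "Suc (card (w ` P))" "w ` P" ?z] card_image_le[OF finP, of w]
      by (simp add: card_insert_if finP)
    also have "card P \<le> n"
    proof -
      have "P = set (filter (case_prod (adj G \<phi>)) pairs4)" by (auto simp: P_def)
      then have "card P \<le> length (filter (case_prod (adj G \<phi>)) pairs4)" using card_length by blast
      also have "\<dots> = n" by (simp add: n_def num_true_def ps_def pairs4_def)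
      finally show ?thesis .
    qed
    finally show ?thesis by simp
  qed
  have "0 < excess (rat_vec ` Y)"
  proof -
    let ?D = "pm.dim (rat_vec ` Y)"
    have "int ?D * int 8 - int (?D choose 2) \<le> int (n + 1) * int 8 - int ((n + 1) choose 2)"
      using n by (intro Freiman_bound_mono[OF dim]) auto
    also have "\<dots> < int (card (sumset Y Y))"
      using n bound sums by (auto simp: choose_two)
    finally have "int ?D * 8 - int (?D choose 2) < int (card (sumset Y Y))" by simp
    moreover have "int ?D * int (card Y) \<le> int ?D * 8"
      using cardY by (intro mult_left_mono) auto
    ultimately show ?thesis
      by (simp add: excess_def card_sumset_rat_vec card_image inj_on_subset[OF inj_rat_vec])
  qed
  then show ?thesis
    using Y_sub by (intro not_freiman_if_excess[OF G, of "rat_vec ` Y"]) auto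
qed

section \<open>Graphs with Freiman cut ideals have at most four edges\<close>

text \<open>The quotient graph on the values of \<open>\<psi>\<close> is connected, expressed through its cuts.\<close>

definition connects :: "'a ugraph \<Rightarrow> ('a \<Rightarrow> 'b) \<Rightarrow> bool" where
  "connects G \<psi> \<longleftrightarrow> (\<forall>T. (\<exists>v\<in>verts G. \<psi> v \<in> T) \<longrightarrow> (\<exists>v\<in>verts G. \<psi> v \<notin> T) \<longrightarrow>
     (\<exists>u v. {u, v} \<in> edges G \<and> \<psi> u \<in> T \<and> \<psi> v \<notin> T))"

text \<open>Every cut of the graph comes from a cut of the quotient on the values of \<open>\<psi>\<close>, so the identification loses no cut.\<close>

definition faithful :: "'a ugraph \<Rightarrow> ('a \<Rightarrow> 'b) \<Rightarrow> bool" where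
  "faithful G \<psi> \<longleftrightarrow> (\<forall>A. \<exists>T. \<forall>u v. {u, v} \<in> edges G \<longrightarrow>
     ((u \<in> A) \<noteq> (v \<in> A)) = ((\<psi> u \<in> T) \<noteq> (\<psi> v \<in> T)))"

lemma connects_comp:
  assumes "connects G \<psi>"
  shows "connects G (f \<circ> \<psi>)"
  unfolding connects_def
proof (intro allI impI)
  fix T assume "\<exists>v\<in>verts G. (f \<circ> \<psi>) v \<in> T" "\<exists>v\<in>verts G. (f \<circ> \<psi>) v \<notin> T"
  then have "\<exists>v\<in>verts G. \<psi> v \<in> f -` T" "\<exists>v\<in>verts G. \<psi> v \<notin> f -` T" by simp_all
  then have "\<exists>u v. {u, v} \<in> edges G \<and> \<psi> u \<in> f -` T \<and> \<psi> v \<notin> f -` T"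
    by (rule assms[unfolded connects_def, rule_format])
  then show "\<exists>u v. {u, v} \<in> edges G \<and> (f \<circ> \<psi>) u \<in> T \<and> (f \<circ> \<psi>) v \<notin> T" by simp
qed

lemma edge_verts: "simple_graph G \<Longrightarrow> {u, v} \<in> edges G \<Longrightarrow> u \<noteq> v \<and> u \<in> verts G \<and> v \<in> verts G"
  by (fastforce simp: simple_graph_def card_2_iff doubleton_eq_iff)

lemma faithful_comp:
  assumes "simple_graph G" "faithful G \<psi>" "inj_on f (\<psi> ` verts G)"
  shows "faithful G (f \<circ> \<psi>)"
  unfolding faithful_def
proof
  fix A
  obtain T where T: "\<forall>u v. {u, v} \<in> edges G \<longrightarrow> ((u \<in> A) \<noteq> (v \<in> A)) = ((\<psi> u \<in> T) \<noteq> (\<psi> v \<in> T))"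
    using assms(2)[unfolded faithful_def, rule_format, of A] by (rule exE)
  let ?T = "f ` (T \<inter> \<psi> ` verts G)"
  have "(f \<circ> \<psi>) v \<in> ?T \<longleftrightarrow> \<psi> v \<in> T" if "v \<in> verts G" for v
  proof -
    have "f (\<psi> v) \<in> ?T \<longleftrightarrow> \<psi> v \<in> T \<inter> \<psi> ` verts G"
      by (rule inj_on_image_mem_iff[OF assms(3)]) (use that in auto)
    then show ?thesis using that by simp
  qed
  then show "\<exists>T. \<forall>u v. {u, v} \<in> edges G \<longrightarrow>
     ((u \<in> A) \<noteq> (v \<in> A)) = (((f \<circ> \<psi>) u \<in> T) \<noteq> ((f \<circ> \<psi>) v \<in> T))"
    using T edge_verts[OF assms(1)] by (intro exI[of _ ?T]) (simp del: comp_apply)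
qed

text \<open>All components are glued together at one representative vertex each. The quotient is connected because every
  component contains the glued vertex. No cut is lost, because exchanging the two sides on a whole component does not
  change a cut, so every cut has the representatives on one side.\<close>

lemma glue_components:
  fixes G :: "'a ugraph"
  assumes "verts G \<noteq> {}"
  obtains \<psi> :: "'a \<Rightarrow> 'a" where "connects G \<psi>" "faithful G \<psi>"
proof -
  define r where "r = {(u, v). {u, v} \<in> edges G}"
  have "sym (r\<^sup>*)" by (intro sym_rtrancl) (auto simp: sym_def r_def insert_commute)
  define rep where "rep v = (SOME x. (v, x) \<in> r\<^sup>*)" for v
  have rep: "(v, rep v) \<in> r\<^sup>*" for v
    unfolding rep_def by (rule someI[of _ v]) simp
  have rep_eq: "rep u = rep v" if "(u, v) \<in> r\<^sup>*" for u v
  proof -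
    have "(u, x) \<in> r\<^sup>* \<longleftrightarrow> (v, x) \<in> r\<^sup>*" for x
      using that \<open>sym (r\<^sup>*)\<close> by (meson rtrancl_trans symD)
    then show ?thesis by (simp add: rep_def)
  qed
  have rep_rep: "rep (rep v) = rep v" for v
    using rep_eq[OF rep[of v]] by simp
  obtain v0 where "v0 \<in> verts G" using assms by blast
  define r0 where "r0 = rep v0"
  define \<psi> where "\<psi> v = (if rep v = v then r0 else v)" for v
  show ?thesis
  proof
    show "connects G \<psi>"
      unfolding connects_def
    proof (intro allI impI, rule ccontr)
      fix T assume ex: "\<exists>v\<in>verts G. \<psi> v \<in> T" "\<exists>v\<in>verts G. \<psi> v \<notin> T"
        and none: "\<not> (\<exists>u v. {u, v} \<in> edges G \<and> \<psi> u \<in> T \<and> \<psi> v \<notin> T)"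
      have step: "\<psi> u \<in> T \<longleftrightarrow> \<psi> v \<in> T" if "{u, v} \<in> edges G" for u v
        using none that by (metis insert_commute)
      have "\<psi> u \<in> T \<longleftrightarrow> \<psi> v \<in> T" if "(u, v) \<in> r\<^sup>*" for u v
        using that
      proof (induction rule: rtrancl_induct)
        case (step v w)
        then show ?case using \<open>\<And>u v. {u, v} \<in> edges G \<Longrightarrow> \<psi> u \<in> T \<longleftrightarrow> \<psi> v \<in> T\<close>[of v w] by (simp add: r_def)
      qed simp
      from this[OF rep] have "\<psi> v \<in> T \<longleftrightarrow> r0 \<in> T" for v
        by (simp add: \<psi>_def rep_rep)
      then show False using ex by blast
    qed
    show "faithful G \<psi>"
      unfolding faithful_def
    proof
      fix A
      \<comment> \<open>Sides are exchanged on the components whose representative is in \<open>A\<close>.\<close>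
      let ?T = "{v. (v \<in> A) \<noteq> (rep v \<in> A)}"
      have "\<psi> v \<in> ?T \<longleftrightarrow> v \<in> ?T" for v by (simp add: \<psi>_def r0_def rep_rep)
      moreover have "rep u = rep v" if "{u, v} \<in> edges G" for u v
        by (rule rep_eq) (use that in \<open>auto simp: r_def\<close>)
      ultimately show "\<exists>T. \<forall>u v. {u, v} \<in> edges G \<longrightarrow>
        ((u \<in> A) \<noteq> (v \<in> A)) = ((\<psi> u \<in> T) \<noteq> (\<psi> v \<in> T))"
        by (intro exI[of _ ?T]) auto
    qed
  qed
qed

lemma adj_commute: "adj G \<psi> i j \<longleftrightarrow> adj G \<psi> j i"
  unfolding adj_def by (metis insert_commute)

lemma adj_comp: "adj G (f \<circ> \<psi>) a b \<longleftrightarrow> (\<exists>i j. f i = a \<and> f j = b \<and> adj G \<psi> i j)"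
  unfolding adj_def by auto

text \<open>Two of the five vertices are identified and named 0, so that four classes with a bad quotient remain.\<close>

lemma not_freiman_if_connects_5:
  fixes \<psi> :: "'a \<Rightarrow> nat"
  assumes G: "simple_graph G" "edges G \<noteq> {}" and \<psi>: "connects G \<psi>" "\<psi> ` verts G = {..<5}"
  shows "\<not> freiman_ideal (cut_vars G) (cut_ideal G :: ('a set cut_var, 'k::field) mpoly set)"
proof -
  let ?p = "adj G \<psi>"
  have adj_less: "i < 5 \<and> j < 5" if "?p i j" for i j
    using that edge_verts[OF G(1)] \<psi>(2) unfolding adj_def by blast
  have lt5: "i < 5 \<longleftrightarrow> i = 0 \<or> i = 1 \<or> i = 2 \<or> i = 3 \<or> i = (4::nat)" for i by auto
  have "connected_on_5 (?p 0 1) (?p 0 2) (?p 0 3) (?p 0 4) (?p 1 2) (?p 1 3) (?p 1 4) (?p 2 3) (?p 2 4) (?p 3 4)"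
    unfolding connected_on_5_def
  proof (intro allI impI)
    fix a b c d assume not_all: "\<not> (a \<and> b \<and> c \<and> d)"
    define T where "T = {i. i = 0 \<or> i = 1 \<and> a \<or> i = 2 \<and> b \<or> i = 3 \<and> c \<or> i = (4::nat) \<and> d}"
    have "0 \<in> T" by (simp add: T_def)
    then have "\<exists>v\<in>verts G. \<psi> v \<in> T"
      using \<psi>(2) by (metis imageE lessThan_iff zero_less_numeral)
    moreover have "\<exists>v\<in>verts G. \<psi> v \<notin> T"
    proof -
      have "\<exists>i\<in>{1, 2, 3, 4}. i \<notin> T" using not_all by (simp add: T_def)
      then obtain i where "i \<in> {1, 2, 3, 4}" "i \<notin> T" by blast
      moreover have "i < 5" using calculation(1) by auto
      ultimately show ?thesis using \<psi>(2) by (metis imageE lessThan_iff)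
    qed
    ultimately obtain u v where uv: "{u, v} \<in> edges G" "\<psi> u \<in> T" "\<psi> v \<notin> T"
      using \<psi>(1)[unfolded connects_def, rule_format, of T] by blast
    then have "?p (\<psi> u) (\<psi> v)" by (auto simp: adj_def)
    moreover have "\<psi> u < 5" "\<psi> v < 5" using adj_less calculation by blast+
    ultimately show "?p 0 1 \<and> \<not> a \<or> ?p 0 2 \<and> \<not> b \<or> ?p 0 3 \<and> \<not> c \<or> ?p 0 4 \<and> \<not> d \<or> ?p 1 2 \<and> a \<noteq> b \<or>
      ?p 1 3 \<and> a \<noteq> c \<or> ?p 1 4 \<and> a \<noteq> d \<or> ?p 2 3 \<and> b \<noteq> c \<or> ?p 2 4 \<and> b \<noteq> d \<or> ?p 3 4 \<and> c \<noteq> d"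
      using uv(2,3) unfolding lt5
      by (elim disjE) (simp_all del: One_nat_def add: T_def
        adj_commute[of G \<psi> 1 0] adj_commute[of G \<psi> 2 0] adj_commute[of G \<psi> 2 1] 
        adj_commute[of G \<psi> 3 0] adj_commute[of G \<psi> 3 1] adj_commute[of G \<psi> 3 2] adj_commute[of G \<psi> 4 0] 
        adj_commute[of G \<psi> 4 1] adj_commute[of G \<psi> 4 2] adj_commute[of G \<psi> 4 3])
  qed
  note bad = bad_identification[rule_format, OF this]
  have merge: ?thesis
    if set: "{x, y, a, b, c} = {..<5}" "distinct [x, y, a, b, c]"
      and bad: "bad_quotient (?p x a \<or> ?p y a) (?p x b \<or> ?p y b) (?p x c \<or> ?p y c) (?p a b) (?p a c) (?p b c)"
    for x y a b c
  proof -
    define f where "f i = (if i = a then 1 else if i = b then 2 else if i = c then 3 else 0 :: nat)" for i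
    have f1: "f i = 1 \<longleftrightarrow> i = a" and f2: "f i = 2 \<longleftrightarrow> i = b" and f3: "f i = 3 \<longleftrightarrow> i = c" for i
      using set(2) by (auto simp: f_def)
    have f0: "f i = 0 \<longleftrightarrow> i = x \<or> i = y" if "i < 5" for i
    proof -
      have "i \<in> {x, y, a, b, c}" using that set(1) by simp
      then show ?thesis using set(2) by (auto simp: f_def)
    qed
    have q0: "adj G (f \<circ> \<psi>) 0 k \<longleftrightarrow> ?p x j \<or> ?p y j" if "\<And>i. f i = k \<longleftrightarrow> i = j" for k j
    proof -
      have "adj G (f \<circ> \<psi>) 0 k \<longleftrightarrow> (\<exists>i. f i = 0 \<and> ?p i j)"
        unfolding adj_comp that by blast
      also have "\<dots> \<longleftrightarrow> ?p x j \<or> ?p y j"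
        using f0 adj_less by (metis set(1) insertI1 insertI2 lessThan_iff)
      finally show ?thesis .
    qed
    have q1: "adj G (f \<circ> \<psi>) k l \<longleftrightarrow> ?p i j"
      if "\<And>n. f n = k \<longleftrightarrow> n = i" "\<And>n. f n = l \<longleftrightarrow> n = j" for k l i j
      unfolding adj_comp that by blast
    show ?thesis
    proof (rule not_freiman_if_bad_quotient[OF G, of "f \<circ> \<psi>"])
      show "(f \<circ> \<psi>) v < 4" for v by (simp add: f_def)
      show "bad_quotient (adj G (f \<circ> \<psi>) 0 1) (adj G (f \<circ> \<psi>) 0 2) (adj G (f \<circ> \<psi>) 0 3)
        (adj G (f \<circ> \<psi>) 1 2) (adj G (f \<circ> \<psi>) 1 3) (adj G (f \<circ> \<psi>) 2 3)"
        unfolding q0[OF f1] q0[OF f2] q0[OF f3] q1[OF f1 f2] q1[OF f1 f3] q1[OF f2 f3] by (rule bad)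
    qed
  qed
  note s = adj_commute[of G \<psi>]
  have five: "{..<5} = {0, 1, 2, 3, 4 :: nat}" by auto
  show ?thesis
    using bad
  proof (elim disjE, goal_cases)
    case 1 show ?case by (rule merge[of 0 1 2 3 4]) (use 1 five in auto)
  next
    case 2 show ?case by (rule merge[of 0 2 1 3 4]) (use 2 five s[of 2 1] in auto)
  next
    case 3 show ?case by (rule merge[of 0 3 1 2 4]) (use 3 five s[of 3 1] s[of 3 2] in auto)
  next
    case 4 show ?case by (rule merge[of 0 4 1 2 3]) (use 4 five s[of 4 1] s[of 4 2] s[of 4 3] in auto)
  next
    case 5 show ?case by (rule merge[of 1 2 0 3 4]) (use 5 five s[of 1 0] s[of 2 0] in auto)
  next
    case 6 show ?case by (rule merge[of 1 3 0 2 4]) (use 6 five s[of 1 0] s[of 3 0] s[of 3 2] in auto)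
  next
    case 7 show ?case by (rule merge[of 1 4 0 2 3]) (use 7 five s[of 1 0] s[of 4 0] s[of 4 2] s[of 4 3] in auto)
  next
    case 8 show ?case by (rule merge[of 2 3 0 1 4]) (use 8 five s[of 2 0] s[of 3 0] s[of 2 1] s[of 3 1] in auto)
  next
    case 9 show ?case by (rule merge[of 2 4 0 1 3]) (use 9 five s[of 2 0] s[of 4 0] s[of 2 1] s[of 4 1] s[of 4 3] in auto)
  next
    case 10 show ?case by (rule merge[of 3 4 0 1 2]) (use 10 five s[of 3 0] s[of 4 0] s[of 3 1] s[of 4 1] s[of 3 2] s[of 4 2] in auto)
  qed
qed

lemma connects_crossing:
  fixes \<psi> :: "'a \<Rightarrow> nat"
  assumes "connects G \<psi>" "\<psi> ` verts G = {..<q}" "i < q" "i \<in> T" "j < q" "j \<notin> T"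
    and G: "simple_graph G"
  shows "\<exists>i j. i < q \<and> j < q \<and> i \<in> T \<and> j \<notin> T \<and> adj G \<psi> i j"
proof -
  have "\<exists>v\<in>verts G. \<psi> v \<in> T" "\<exists>v\<in>verts G. \<psi> v \<notin> T"
    using assms(2-6) by (metis imageE lessThan_iff)+
  then obtain u v where uv: "{u, v} \<in> edges G" "\<psi> u \<in> T" "\<psi> v \<notin> T"
    using assms(1)[unfolded connects_def, rule_format, of T] by blast
  moreover have "\<psi> u < q" "\<psi> v < q"
    using edge_verts[OF G uv(1)] assms(2) by blast+
  ultimately show ?thesis unfolding adj_def by blast
qed

text \<open>As a symmetric difference, \<open>e3\<close> would have four elements if \<open>e1\<close> and \<open>e2\<close> were disjoint; so these share a vertex.\<close>

lemma parity_triangle: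
  assumes "card e1 = 2" "card e2 = 2" "card e3 = 2" "e1 \<noteq> e3"
    and parity: "\<And>x. x \<in> e3 \<longleftrightarrow> (x \<in> e1) \<noteq> (x \<in> e2)"
  obtains a b c where "distinct [a, b, c]" "{e1, e2, e3} = {{a, b}, {b, c}, {a, c}}"
proof -
  note triangleI = that
  obtain a b where ab: "e1 = {a, b}" "a \<noteq> b" using assms(1) by (auto simp: card_2_iff)
  obtain p q where pq: "e3 = {p, q}" "p \<noteq> q" using assms(3) by (auto simp: card_2_iff)
  have tri: thesis if ab: "e1 = {a, b}" "a \<noteq> b" and a: "a \<in> e2" for a b
  proof -
    obtain c where c: "e2 = {a, c}" "a \<noteq> c"
      using assms(2) a by (auto simp: card_2_iff)
    have "b \<noteq> c"
    proof
      assume "b = c"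
      then have "p \<notin> e3" using parity[of p] ab c by simp
      then show False using pq by simp
    qed
    then have "e3 = {b, c}" using parity ab c by auto
    then show thesis using triangleI[of b a c] ab c \<open>b \<noteq> c\<close> by (auto simp: insert_commute)
  qed
  consider "a \<in> e2" | "b \<in> e2" | "a \<notin> e2" "b \<notin> e2" by blast
  then show thesis
  proof cases
    case 1 then show ?thesis using tri[OF ab] by blast
  next
    case 2 then show ?thesis using tri[of b a] ab by (simp add: insert_commute)
  next
    case 3
    then have "{a, b} \<subseteq> e3" using parity ab by auto
    then have "e3 = {a, b}" using assms(3) card_subset_eq[of e3 "{a, b}"] ab pq by auto
    then show ?thesis using assms(4) ab by simp
  qed
qed

lemma faithfulD:
  assumes "faithful G \<psi>"
  shows "\<exists>T. \<forall>u v. {u, v} \<in> edges G \<longrightarrow> ((u \<in> A) \<noteq> (v \<in> A)) = ((\<psi> u \<in> T) \<noteq> (\<psi> v \<in> T))"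
  using assms[unfolded faithful_def, rule_format, of A] .

text \<open>Every cut meets a triangle of the quotient in an even number of edges. The cut of a single vertex \<open>x\<close> of the graph is
  one of them, so the three edges above the triangle contain \<open>x\<close> an even number of times.\<close>

lemma triangle_if_faithful:
  assumes G: "simple_graph G" and \<psi>: "faithful G \<psi>"
    and ijk: "i \<noteq> j" "j \<noteq> k" "i \<noteq> k" and adj: "adj G \<psi> i j" "adj G \<psi> j k" "adj G \<psi> i k"
  obtains a b c where "distinct [a, b, c]" "{{a, b}, {b, c}, {a, c}} \<subseteq> edges G"
proof -
  obtain u1 v1 where e1: "{u1, v1} \<in> edges G" "\<psi> u1 = i" "\<psi> v1 = j" using adj(1) unfolding adj_def by blast
  obtain u2 v2 where e2: "{u2, v2} \<in> edges G" "\<psi> u2 = j" "\<psi> v2 = k" using adj(2) unfolding adj_def by blast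
  obtain u3 v3 where e3: "{u3, v3} \<in> edges G" "\<psi> u3 = i" "\<psi> v3 = k" using adj(3) unfolding adj_def by blast
  have card: "card e = 2" if "e \<in> edges G" for e using G that by (simp add: simple_graph_def)
  have "x \<in> {u3, v3} \<longleftrightarrow> (x \<in> {u1, v1}) \<noteq> (x \<in> {u2, v2})" for x
  proof -
    obtain T where T: "\<forall>u v. {u, v} \<in> edges G \<longrightarrow> ((u \<in> {x}) \<noteq> (v \<in> {x})) = ((\<psi> u \<in> T) \<noteq> (\<psi> v \<in> T))"
      using faithfulD[OF \<psi>, of "{x}"] by (rule exE)
    have mem: "x \<in> {u, v} \<longleftrightarrow> (\<psi> u \<in> T) \<noteq> (\<psi> v \<in> T)" if "{u, v} \<in> edges G" for u v
      using T[rule_format, OF that] edge_verts[OF G that] by auto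
    show ?thesis
      unfolding mem[OF e1(1)] mem[OF e2(1)] mem[OF e3(1)] e1(2,3) e2(2,3) e3(2,3) by blast
  qed
  moreover have "{u1, v1} \<noteq> {u3, v3}"
    using e1 e3 ijk by (metis doubleton_eq_iff)
  ultimately obtain a b c where abc: "distinct [a, b, c]"
    "{{u1, v1}, {u2, v2}, {u3, v3}} = {{a, b}, {b, c}, {a, c}}"
    using parity_triangle[OF card[OF e1(1)] card[OF e2(1)] card[OF e3(1)]] by metis
  have "{{a, b}, {b, c}, {a, c}} \<subseteq> edges G" unfolding abc(2)[symmetric] using e1(1) e2(1) e3(1) by blast
  then show ?thesis using that abc(1) by blast
qed

text \<open>The cuts of single vertices tell edges apart, so a faithful quotient has neither loops nor multiple edges.\<close>

lemma card_edges_faithful: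
  fixes \<psi> :: "'a \<Rightarrow> nat"
  assumes G: "simple_graph G" and \<psi>: "faithful G \<psi>" "\<psi> ` verts G \<subseteq> {..<q}"
  shows "card (edges G) = card {(i, j). i < j \<and> j < q \<and> adj G \<psi> i j}"
proof -
  \<comment> \<open>The pair of classes of an edge, in increasing order.\<close>
  define cls where "cls e = (Min (\<psi> ` e), Max (\<psi> ` e))" for e
  have pair: "\<exists>u v. e = {u, v} \<and> \<psi> u < \<psi> v \<and> \<psi> v < q \<and> cls e = (\<psi> u, \<psi> v)" if e: "e \<in> edges G" for e
  proof -
    obtain u v where uv: "e = {u, v}" "u \<noteq> v" "v \<in> verts G" "\<psi> u \<le> \<psi> v"
      using edge_pair[OF G e] by (metis insert_commute nle_le)
    obtain T where "\<forall>x y. {x, y} \<in> edges G \<longrightarrow> ((x \<in> {u}) \<noteq> (y \<in> {u})) = ((\<psi> x \<in> T) \<noteq> (\<psi> y \<in> T))"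
      using faithfulD[OF \<psi>(1), of "{u}"] by (rule exE)
    then have "((u \<in> {u}) \<noteq> (v \<in> {u})) = ((\<psi> u \<in> T) \<noteq> (\<psi> v \<in> T))" using uv(1) e by blast
    then have "\<psi> u \<noteq> \<psi> v" using uv(2) by auto
    moreover have "\<psi> v < q" using \<psi>(2) uv(3) by auto
    moreover have "cls e = (\<psi> u, \<psi> v)" using uv(4) by (simp add: cls_def uv(1))
    ultimately show ?thesis using uv(1,4) by (intro exI[of _ u] exI[of _ v]) simp
  qed
  have "inj_on cls (edges G)"
  proof (rule inj_onI, rule ccontr)
    fix e f assume ef: "e \<in> edges G" "f \<in> edges G" "cls e = cls f" "e \<noteq> f"
    obtain u v where uv: "e = {u, v}" "\<psi> u < \<psi> v" "cls e = (\<psi> u, \<psi> v)" using pair[OF ef(1)] by blast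
    obtain u' v' where uv': "f = {u', v'}" "\<psi> u' < \<psi> v'" "cls f = (\<psi> u', \<psi> v')" using pair[OF ef(2)] by blast
    have eq: "\<psi> u = \<psi> u'" "\<psi> v = \<psi> v'" using ef(3) uv uv' by auto
    have same: "x \<in> e \<longleftrightarrow> x \<in> f" for x
    proof -
      obtain T where T: "\<forall>a b. {a, b} \<in> edges G \<longrightarrow> ((a \<in> {x}) \<noteq> (b \<in> {x})) = ((\<psi> a \<in> T) \<noteq> (\<psi> b \<in> T))"
        using faithfulD[OF \<psi>(1), of "{x}"] by (rule exE)
      have "((u \<in> {x}) \<noteq> (v \<in> {x})) = ((u' \<in> {x}) \<noteq> (v' \<in> {x}))"
        using T[rule_format, of u v] T[rule_format, of u' v'] ef(1,2) by (simp add: uv(1) uv'(1) eq)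
      then show ?thesis using uv uv' by auto
    qed
    show False using same ef(4) by blast
  qed
  then have "card (edges G) = card (cls ` edges G)" by (simp add: card_image)
  also have "cls ` edges G = {(i, j). i < j \<and> j < q \<and> adj G \<psi> i j}"
  proof
    show "cls ` edges G \<subseteq> {(i, j). i < j \<and> j < q \<and> adj G \<psi> i j}"
    proof
      fix x assume "x \<in> cls ` edges G"
      then obtain e where e: "e \<in> edges G" "x = cls e" by blast
      then obtain u v where "e = {u, v}" "\<psi> u < \<psi> v" "\<psi> v < q" "cls e = (\<psi> u, \<psi> v)"
        using pair by blast
      then show "x \<in> {(i, j). i < j \<and> j < q \<and> adj G \<psi> i j}" using e by (auto simp: adj_def)
    qed
    show "{(i, j). i < j \<and> j < q \<and> adj G \<psi> i j} \<subseteq> cls ` edges G"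
    proof clarify
      fix i j assume "i < j" "j < q" "adj G \<psi> i j"
      then obtain u v where uv: "{u, v} \<in> edges G" "\<psi> u = i" "\<psi> v = j" by (auto simp: adj_def)
      have "cls {u, v} = (i, j)" using uv \<open>i < j\<close> by (simp add: cls_def)
      then show "(i, j) \<in> cls ` edges G" using uv(1) by force
    qed
  qed
  finally show ?thesis .
qed

definition is_triangle :: "'a set set \<Rightarrow> bool" where
  "is_triangle E \<longleftrightarrow> (\<exists>a b c. distinct [a, b, c] \<and> E = {{a, b}, {b, c}, {a, c}})"

lemma card_triangle: "is_triangle E \<Longrightarrow> card E = 3"
  unfolding is_triangle_def by (auto simp: doubleton_eq_iff)

lemma edge_not_in_triangle:
  assumes "\<exists>x y. f = {x, y} \<and> x \<noteq> y" "f \<notin> {{a, b}, {b, c}, {a, c}}"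
  obtains p q where "f = {p, q}" "p \<noteq> q" "p \<notin> {a, b, c}"
proof -
  obtain x y where xy: "f = {x, y}" "x \<noteq> y" using assms(1) by blast
  have "\<not> f \<subseteq> {a, b, c}" using assms(2) xy by (auto simp: insert_commute)
  then show ?thesis using xy that[of x y] that[of y x] by (auto simp: insert_commute)
qed

text \<open>The edge sets of the six graphs; two edges may share a vertex or not, and so may a triangle and a further edge.\<close>

definition freiman_shape :: "'a set set \<Rightarrow> bool" where
  "freiman_shape E \<longleftrightarrow> (\<exists>e. E = {e}) \<or> (\<exists>e f. e \<noteq> f \<and> E = {e, f}) \<or> is_triangle E \<or>
     (\<exists>D f. is_triangle D \<and> f \<notin> D \<and> E = insert f D)"

lemma freiman_shapeI:
  "freiman_shape {e}" "e \<noteq> f \<Longrightarrow> freiman_shape {e, f}"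
  "is_triangle D \<Longrightarrow> freiman_shape D" "is_triangle D \<Longrightarrow> f \<notin> D \<Longrightarrow> freiman_shape (insert f D)"
  unfolding freiman_shape_def by metis+

text \<open>The premise is connectedness, with vertex 0 on one side of the cut. Among the graphs that are not bad only the
  triangle with a pendant edge is left.\<close>

lemma paw_pattern:
  "\<forall>p01 p02 p03 p12 p13 p23.
    (\<forall>a b c. \<not> (a \<and> b \<and> c) \<longrightarrow> p01 \<and> \<not> a \<or> p02 \<and> \<not> b \<or> p03 \<and> \<not> c \<or> p12 \<and> a \<noteq> b \<or> p13 \<and> a \<noteq> c \<or> p23 \<and> b \<noteq> c) \<longrightarrow>
    \<not> bad_quotient p01 p02 p03 p12 p13 p23 \<longrightarrow>
    num_true [p01, p02, p03, p12, p13, p23] = 4 \<and>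
    (p01 \<and> p12 \<and> p02 \<or> p01 \<and> p13 \<and> p03 \<or> p02 \<and> p23 \<and> p03 \<or> p12 \<and> p23 \<and> p13)"
  by code_simp

text \<open>After gluing the components, \<open>q\<close> vertices are left. More than four are impossible, and for at most four
  the number of edges, together with a triangle in the quotient, determines the edges of the graph.\<close>

theorem freiman_shape_if_freiman:
  fixes G :: "'a ugraph"
  assumes G: "simple_graph G" "edges G \<noteq> {}"
    and freiman: "freiman_ideal (cut_vars G) (cut_ideal G :: ('a set cut_var, 'k::field) mpoly set)"
  shows "freiman_shape (edges G)"
proof -
  have finV: "finite (verts G)" using G by (simp add: simple_graph_def)
  have finE: "finite (edges G)" by (rule finite_edges[OF G(1)])
  have "verts G \<noteq> {}" using G edge_pair[OF G(1)] by (metis empty_iff ex_in_conv)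
  then obtain \<psi>0 :: "'a \<Rightarrow> 'a" where \<psi>0: "connects G \<psi>0" "faithful G \<psi>0" by (rule glue_components)
  obtain h and q :: nat where h: "bij_betw h (\<psi>0 ` verts G) {..<q}"
    using ex_bij_betw_finite_nat[of "\<psi>0 ` verts G"] finV by (auto simp: atLeast0LessThan)
  define \<psi> where "\<psi> = h \<circ> \<psi>0"
  have conn: "connects G \<psi>" unfolding \<psi>_def by (rule connects_comp[OF \<psi>0(1)])
  have faith: "faithful G \<psi>" unfolding \<psi>_def
    using h by (intro faithful_comp[OF G(1) \<psi>0(2)]) (simp add: bij_betw_def)
  have img: "\<psi> ` verts G = {..<q}"
    unfolding \<psi>_def image_comp[symmetric] using h by (simp add: bij_betw_def)
  have crossing: "\<exists>i j. i < q \<and> j < q \<and> i \<in> T \<and> j \<notin> T \<and> adj G \<psi> i j"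
    if "0 \<in> T" "j < q" "j \<notin> T" for T j
    using connects_crossing[OF conn img, of 0 T j] that G(1) by auto
  have card: "card (edges G) = length (filter (case_prod (adj G \<psi>)) ps)"
    if "distinct ps" "set ps = {(i, j). i < j \<and> j < q}" for ps
  proof -
    have "{(i, j). i < j \<and> j < q \<and> adj G \<psi> i j} = set (filter (case_prod (adj G \<psi>)) ps)"
      using that(2) by auto
    moreover have "card (edges G) = card {(i, j). i < j \<and> j < q \<and> adj G \<psi> i j}"
      by (rule card_edges_faithful[OF G(1) faith]) (simp add: img)
    ultimately show ?thesis using distinct_card[OF distinct_filter[OF that(1)]] by metis
  qed
  have "0 < card (edges G)" using G finE by (simp add: card_gt_0_iff)
  note s = adj_commute[of G \<psi>]
  have tri: "\<exists>D. is_triangle D \<and> D \<subseteq> edges G"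
    if "adj G \<psi> i j" "adj G \<psi> j k" "adj G \<psi> i k" "i \<noteq> j" "j \<noteq> k" "i \<noteq> k" for i j k
  proof -
    note ijk = that
    obtain a b c where "distinct [a, b, c]" "{{a, b}, {b, c}, {a, c}} \<subseteq> edges G"
      by (rule triangle_if_faithful[OF G(1) faith ijk(4-6) ijk(1-3)])
    then show ?thesis unfolding is_triangle_def by blast
  qed
  consider "q \<le> 1" | "q = 2" | "q = 3" | "q = 4" | "5 \<le> q" by linarith
  then show ?thesis
  proof cases
    case 1
    then have "card (edges G) = 0" using card[of "[]"] by auto
    then show ?thesis using \<open>0 < card (edges G)\<close> by simp
  next
    case 2
    have "set [(0, 1)] = {(i, j). i < j \<and> j < q}" using 2 by auto
    then have "card (edges G) \<le> 1" using card[of "[(0, 1)]"] by simp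
    then have "card (edges G) = 1" using \<open>0 < card (edges G)\<close> by simp
    then obtain e where "edges G = {e}" by (auto simp: card_1_singleton_iff)
    then show ?thesis by (simp add: freiman_shapeI(1))
  next
    case 3
    have "set [(0, 1), (0, 2), (1, 2)] = {(i, j). i < j \<and> j < q}" using 3 by auto
    then have c: "card (edges G) = length (filter (case_prod (adj G \<psi>)) [(0, 1), (0, 2), (1, 2)])"
      by (intro card) simp_all
    have lt3: "i < 3 \<longleftrightarrow> i = 0 \<or> i = 1 \<or> i = (2::nat)" for i by auto
    have "adj G \<psi> 0 1 \<or> adj G \<psi> 0 2" using crossing[of "{0}" 1] 3 by (auto simp: lt3)
    moreover have "adj G \<psi> 0 2 \<or> adj G \<psi> 1 2" using crossing[of "{0, 1}" 2] 3 by (auto simp: lt3)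
    moreover have "adj G \<psi> 0 1 \<or> adj G \<psi> 1 2" using crossing[of "{0, 2}" 1] 3 s by (auto simp: lt3)
    ultimately consider "card (edges G) = 2" | "card (edges G) = 3" "adj G \<psi> 0 1" "adj G \<psi> 1 2" "adj G \<psi> 0 2"
      using c by (auto split: if_splits)
    then show ?thesis
    proof cases
      case 1
      then obtain e f where "edges G = {e, f}" "e \<noteq> f" by (auto simp: card_2_iff)
      then show ?thesis by (simp add: freiman_shapeI(2))
    next
      case 2
      then obtain D where "is_triangle D" "D \<subseteq> edges G" using tri[OF 2(2,3,4)] by auto
      then have "D = edges G" using 2(1) card_triangle finE by (intro card_subset_eq) auto
      then show ?thesis using \<open>is_triangle D\<close> by (simp add: freiman_shapeI(3))
    qed
  next
    case 4
    let ?p = "adj G \<psi>"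
    have "set pairs4 = {(i, j). i < j \<and> j < q}" using 4 by (auto simp: pairs4_iff)
    then have c: "card (edges G) = num_true [?p 0 1, ?p 0 2, ?p 0 3, ?p 1 2, ?p 1 3, ?p 2 3]"
      using card[of pairs4] by (simp add: pairs4_def num_true_def)
    have lt4: "i < 4 \<longleftrightarrow> i = 0 \<or> i = 1 \<or> i = 2 \<or> i = (3::nat)" for i by auto
    have "\<not> bad_quotient (?p 0 1) (?p 0 2) (?p 0 3) (?p 1 2) (?p 1 3) (?p 2 3)"
    proof
      assume bad: "bad_quotient (?p 0 1) (?p 0 2) (?p 0 3) (?p 1 2) (?p 1 3) (?p 2 3)"
      have "\<psi> v < 4" if "v \<in> verts G" for v using img 4 that by blast
      from not_freiman_if_bad_quotient[OF G this bad] show False using freiman by blast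
    qed
    moreover have "?p 0 1 \<and> \<not> a \<or> ?p 0 2 \<and> \<not> b \<or> ?p 0 3 \<and> \<not> c \<or> ?p 1 2 \<and> a \<noteq> b \<or> ?p 1 3 \<and> a \<noteq> c \<or> ?p 2 3 \<and> b \<noteq> c"
      if not_all: "\<not> (a \<and> b \<and> c)" for a b c
    proof -
      define T where "T = {i. i = 0 \<or> i = 1 \<and> a \<or> i = 2 \<and> b \<or> i = (3::nat) \<and> c}"
      have "\<exists>i\<in>{1, 2, 3}. i \<notin> T" using not_all by (simp add: T_def)
      then obtain i where "i \<in> {1, 2, 3}" "i \<notin> T" by blast
      moreover have "i < q" using calculation(1) 4 by auto
      ultimately obtain i j where "i < 4" "j < 4" "i \<in> T" "j \<notin> T" "?p i j"
        using crossing[of T i] 4 by (auto simp: T_def)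
      then show ?thesis
        unfolding lt4 by (elim disjE) (simp_all del: One_nat_def add: T_def s[of 1 0] s[of 2 0] s[of 2 1] s[of 3 0] s[of 3 1] s[of 3 2])
    qed
    ultimately have paw: "num_true [?p 0 1, ?p 0 2, ?p 0 3, ?p 1 2, ?p 1 3, ?p 2 3] = 4 \<and>
      (?p 0 1 \<and> ?p 1 2 \<and> ?p 0 2 \<or> ?p 0 1 \<and> ?p 1 3 \<and> ?p 0 3 \<or> ?p 0 2 \<and> ?p 2 3 \<and> ?p 0 3 \<or> ?p 1 2 \<and> ?p 2 3 \<and> ?p 1 3)"
      by (intro paw_pattern[rule_format]) simp_all
    then obtain D where D: "is_triangle D" "D \<subseteq> edges G"
      using tri[of 0 1 2] tri[of 0 1 3] tri[of 0 2 3] tri[of 1 2 3] by auto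
    have "card (edges G - D) = 1"
      using paw c card_triangle[OF D(1)] D(2) finite_subset[OF D(2) finE] by (simp add: card_Diff_subset)
    then obtain f where "edges G - D = {f}" by (auto simp: card_1_singleton_iff)
    then have "f \<notin> D" "edges G = insert f D" using D(2) by blast+
    then show ?thesis using D(1) by (simp add: freiman_shapeI(4))
  next
    case 5
    \<comment> \<open>All vertices from 4 onwards are merged.\<close>
    have "connects G (min 4 \<circ> \<psi>)" by (rule connects_comp[OF conn])
    moreover have "(min 4 \<circ> \<psi>) ` verts G = {..<5}"
    proof -
      have "min 4 ` {..<q} = {..<5::nat}"
      proof
        show "{..<5} \<subseteq> min 4 ` {..<q}"
        proof
          fix i :: nat assume "i \<in> {..<5}"
          then have "i = min 4 i" "i \<in> {..<q}" using 5 by auto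
          then show "i \<in> min 4 ` {..<q}" by blast
        qed
      qed auto
      then show ?thesis by (simp only: image_comp[symmetric] img)
    qed
    ultimately show ?thesis using not_freiman_if_connects_5[OF G] freiman by blast
  qed
qed

section \<open>The small graphs have Freiman cut ideals\<close>

text \<open>The exponents at the variables \<open>Var_s e\<close> determine the others, so a vector is recorded as a list over the edges.\<close>

definition edge_code :: "'a set list \<Rightarrow> ('a set cut_var \<Rightarrow>\<^sub>0 nat) \<Rightarrow> nat list" where
  "edge_code es x = map (\<lambda>e. lookup x (Var_s e)) es"

definition pairing :: "int list \<Rightarrow> nat list \<Rightarrow> int" where
  "pairing c p = sum_list (map2 (\<lambda>a b. a * int b) c p)"

lemma pairing_add:
  "pairing c (map (\<lambda>e. f e + g e) es) = pairing c (map f es) + pairing c (map g es)"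
proof (induction es arbitrary: c)
  case (Cons e es)
  then show ?case by (cases c) (simp_all add: pairing_def algebra_simps)
qed (simp add: pairing_def)

lemma pairing_zero: "pairing c (map (\<lambda>e. 0) es) = 0"
proof (induction es arbitrary: c)
  case (Cons e es)
  then show ?case by (cases c) (simp_all add: pairing_def)
qed (simp add: pairing_def)

lemma inj_on_edge_code:
  assumes G: "simple_graph G" and es: "set es = edges G"
  shows "inj_on (edge_code es) (nsums k (cut_exps G))"
proof (rule inj_onI)
  fix x y assume xy: "x \<in> nsums k (cut_exps G)" "y \<in> nsums k (cut_exps G)" "edge_code es x = edge_code es y"
  have s: "lookup x (Var_s e) = lookup y (Var_s e)" if "e \<in> edges G" for e
    using xy(3) that es by (simp add: edge_code_def)
  show "x = y"
    by (rule inj_onD[OF inj_on_restrict_nsums_cut_exps[OF G] _ xy(1,2)]) (use s in \<open>auto simp: restrict_def\<close>)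
qed

definition pattern_sumset :: "nat list list \<Rightarrow> nat list list" where
  "pattern_sumset pats = concat (map (\<lambda>p. map (map2 (+) p) pats) pats)"

text \<open>A list \<open>pats\<close> of all cut vectors, together with functionals \<open>cs\<close> and points \<open>ws\<close> that certify a flag of faces, reduces the
  Freiman property to finite counting. The last functional is the degree, whose point is the empty cut.\<close>

lemma freiman_if_patterns:
  fixes G :: "'a ugraph"
  assumes G: "simple_graph G" "edges G \<noteq> {}" and es: "distinct es" "set es = edges G"
    and pats: "edge_code es ` cut_exps G = set pats"
    and nonneg: "\<forall>c\<in>set cs. \<forall>p\<in>set pats. 0 \<le> pairing c p"
    and len: "length cs = length es"
    and ws: "\<forall>i<length es. ws ! i \<in> set pats \<and> 0 < pairing (cs ! i) (ws ! i) \<and>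
      (\<forall>j<i. pairing (cs ! j) (ws ! i) = 0)"
    and zero: "map (\<lambda>e. 0) es \<in> set pats"
    and count: "int (length (remdups (pattern_sumset pats))) =
      int (length es + 1) * int (length (remdups pats)) - int ((length es + 1) choose 2)"
  shows "freiman_ideal (cut_vars G) (cut_ideal G :: ('a set cut_var, 'k::field) mpoly set)"
proof -
  let ?T = "cut_exps G" and ?m = "length es"
  have fin: "finite (edges G)" by (rule finite_edges[OF G(1)])
  have m: "card (edges G) = ?m" using es distinct_card by metis
  have one: "nsums 1 ?T = ?T" by (auto simp: sumset_def)
  have two: "nsums 2 ?T = sumset ?T ?T" by (auto simp: numeral_2_eq_2 sumset_def)
  have cardT: "card ?T = length (remdups pats)"
    using card_image[OF inj_on_edge_code[OF G(1) es(2), of 1]]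
    by (simp add: one[simplified] pats length_remdups_card_conv)
  have code_add: "edge_code es (x + y) = map2 (+) (edge_code es x) (edge_code es y)" for x y
    by (simp add: edge_code_def lookup_add map2_map_map)
  have "edge_code es ` sumset ?T ?T = set (pattern_sumset pats)"
  proof -
    have "edge_code es ` sumset ?T ?T = {map2 (+) p q | p q. p \<in> edge_code es ` ?T \<and> q \<in> edge_code es ` ?T}"
      unfolding sumset_def by (force simp: code_add)
    also have "\<dots> = set (pattern_sumset pats)"
      unfolding pats pattern_sumset_def by auto
    finally show ?thesis .
  qed
  then have cardTT: "card (sumset ?T ?T) = length (remdups (pattern_sumset pats))"
    using card_image[OF inj_on_edge_code[OF G(1) es(2), of 2]]
    by (simp add: two length_remdups_card_conv)
  define ht where "ht i x = (if i < ?m then pairing (cs ! i) (edge_code es x) else int (mdeg x))"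
    for i :: nat and x :: "'a set cut_var \<Rightarrow>\<^sub>0 nat"
  have "\<forall>p\<in>set pats. \<exists>x. x \<in> ?T \<and> edge_code es x = p" using pats by force
  then obtain w where w: "\<And>p. p \<in> set pats \<Longrightarrow> w p \<in> ?T \<and> edge_code es (w p) = p" by metis
  define wt where "wt i = w (if i < ?m then ws ! i else map (\<lambda>e. 0) es)" for i
  have "enat (?m + 1) \<le> krull_dim (semigroup_ring ?T :: ('a set cut_var, 'k) mpoly ring)"
  proof (rule krull_dim_semigroup_ring_ge[of ht "?m + 1" ?T wt])
    show "ht i 0 = 0" for i by (simp add: ht_def edge_code_def pairing_zero)
    show "ht i (a + b) = ht i a + ht i b" for i a b
      by (simp add: ht_def edge_code_def lookup_add pairing_add mdeg_add)
    show "0 \<le> ht i a" if "i < ?m + 1" "a \<in> ?T" for i a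
    proof (cases "i < ?m")
      case True
      have "edge_code es a \<in> set pats" using that(2) pats by blast
      moreover have "cs ! i \<in> set cs" using True len by simp
      ultimately show ?thesis using nonneg True by (simp add: ht_def)
    qed (simp add: ht_def)
    fix i assume "i < ?m + 1"
    show "wt i \<in> ?T" using w ws zero by (simp add: wt_def)
    show "0 < ht i (wt i)"
    proof (cases "i < ?m")
      case True
      then show ?thesis using w ws by (simp add: ht_def wt_def)
    next
      case False
      have "mdeg (wt i) = ?m"
        using \<open>wt i \<in> ?T\<close> mdeg_cut_exp[OF fin] m by (auto simp: cut_exps_def)
      moreover have "0 < ?m" using G es by (metis length_greater_0_conv set_empty)
      ultimately show ?thesis using False by (simp add: ht_def)
    qed
    fix j assume "j < i"
    then have "j < ?m" using \<open>i < ?m + 1\<close> by simp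
    show "ht j (wt i) = 0"
    proof (cases "i < ?m")
      case True
      then have "edge_code es (wt i) = ws ! i" "pairing (cs ! j) (ws ! i) = 0"
        using w[of "ws ! i"] ws \<open>j < i\<close> by (simp_all add: wt_def)
      then show ?thesis using \<open>j < ?m\<close> by (simp add: ht_def)
    next
      case False
      then have "edge_code es (wt i) = map (\<lambda>e. 0) es" using w[OF zero] by (simp add: wt_def)
      then show ?thesis using \<open>j < ?m\<close> pairing_zero[of "cs ! j" es] by (simp add: ht_def)
    qed
  qed
  moreover have "krull_dim (semigroup_ring ?T :: ('a set cut_var, 'k) mpoly ring) \<le> enat (?m + 1)"
    unfolding m[symmetric] by (rule krull_dim_semigroup_ring_le) (rule card_nsums_cut_exps[OF G(1)])+
  ultimately have "krull_dim (semigroup_ring ?T :: ('a set cut_var, 'k) mpoly ring) = enat (?m + 1)"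
    by (rule antisym[rotated])
  then show ?thesis
    unfolding freiman_cut_ideal_iff[OF G] cardT cardTT using count by blast
qed

lemma edge_code_cut_exp:
  assumes "simple_graph G" "set es = edges G"
  shows "edge_code es (cut_exp G A) = map (\<lambda>e. of_bool (cuts_edge A e)) es"
  using assms by (simp add: edge_code_def lookup_cut_exp[OF finite_edges])

lemma edge_code_cut_exps:
  assumes G: "simple_graph G" and es: "set es = edges G"
    and sub: "\<And>A. A \<subseteq> verts G \<Longrightarrow> map (\<lambda>e. of_bool (cuts_edge A e)) es \<in> P"
    and sup: "\<And>p. p \<in> P \<Longrightarrow> \<exists>A\<subseteq>verts G. map (\<lambda>e. of_bool (cuts_edge A e)) es = p"
  shows "edge_code es ` cut_exps G = P"
proof
  show "edge_code es ` cut_exps G \<subseteq> P"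
    using sub by (auto simp: cut_exps_def edge_code_cut_exp[OF G es])
  show "P \<subseteq> edge_code es ` cut_exps G"
  proof
    fix p assume "p \<in> P"
    then obtain A where "A \<subseteq> verts G" "edge_code es (cut_exp G A) = p"
      using sup unfolding edge_code_cut_exp[OF G es] by blast
    then show "p \<in> edge_code es ` cut_exps G" unfolding cut_exps_def by blast
  qed
qed

lemma all_less_Suc_conv: "(\<forall>i<Suc n. P i) \<longleftrightarrow> P 0 \<and> (\<forall>i<n. P (Suc i))"
  by (metis less_Suc_eq_0_disj)

text \<open>One or two edges have all subsets as cuts; a triangle has the subsets of even size; a further edge doubles
  the cuts, because it has an end \<open>p\<close> outside the triangle, and moving \<open>p\<close> to the other side changes only that edge among the four.
  The functionals are the coordinates of edges outside the triangle and the three triangle inequalities.\<close>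

theorem freiman_if_shape:
  fixes G :: "'a ugraph"
  assumes G: "simple_graph G" and shape: "freiman_shape (edges G)"
  shows "freiman_ideal (cut_vars G) (cut_ideal G :: ('a set cut_var, 'k::field) mpoly set)"
proof -
  have edge: "\<exists>a b. e = {a, b} \<and> a \<noteq> b \<and> {a, b} \<subseteq> verts G" if e: "e \<in> edges G" for e
  proof -
    obtain a b where "e = {a, b}" "a \<noteq> b" "a \<in> verts G" "b \<in> verts G" by (rule edge_pair[OF G e])
    then show ?thesis by blast
  qed
  show ?thesis
    using shape unfolding freiman_shape_def
  proof (elim disjE exE conjE)
    fix e assume one: "edges G = {e}"
    obtain a b where e: "e = {a, b}" "a \<noteq> b" "{a, b} \<subseteq> verts G" using edge one by blast
    have "edge_code [e] ` cut_exps G = set [[0], [1]]"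
    proof (rule edge_code_cut_exps[OF G])
      fix p assume "p \<in> set [[0], [1 :: nat]]"
      then consider "p = [0]" | "p = [1]" by auto
      then show "\<exists>A\<subseteq>verts G. map (\<lambda>e. of_bool (cuts_edge A e)) [e] = p"
      proof cases
        case 1 then show ?thesis by (intro exI[of _ "{}"]) simp
      next
        case 2 then show ?thesis using e by (intro exI[of _ "{a}"]) (simp add: cuts_edge_pair)
      qed
    qed (use one in auto)
    then show ?thesis
      by (rule freiman_if_patterns[OF G, of "[e]", where cs = "[[1]]" and ws = "[[1]]", rotated 3])
         (use one in \<open>simp_all add: pairing_def pattern_sumset_def choose_two\<close>)
  next
    fix e f assume two: "e \<noteq> f" "edges G = {e, f}"
    have card2: "card e = 2" "card f = 2" using G two(2) by (auto simp: simple_graph_def)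
    then have fin2: "finite e" "finite f" by (auto intro: card_ge_0_finite)
    have "\<not> e \<subseteq> f" using card_subset_eq[OF fin2(2), of e] card2 two(1) by auto
    then obtain a where a: "a \<in> e" "a \<notin> f" by blast
    have "\<not> f \<subseteq> e" using card_subset_eq[OF fin2(1), of f] card2 two(1) by auto
    then obtain b where b: "b \<in> f" "b \<notin> e" by blast
    have verts: "a \<in> verts G" "b \<in> verts G" using a b two G by (auto simp: simple_graph_def)
    have ab: "a \<noteq> b" using a b by auto
    have ca: "cuts_edge {a} e" "\<not> cuts_edge {a} f" "cuts_edge {b} f" "\<not> cuts_edge {b} e"
      "cuts_edge {a, b} e" "cuts_edge {a, b} f"
      using a b by (auto simp: cuts_edge_def Int_insert_right)
    have "edge_code [e, f] ` cut_exps G = set [[0, 0], [1, 0], [0, 1], [1, 1]]"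
    proof (rule edge_code_cut_exps[OF G])
      fix p assume "p \<in> set [[0, 0], [1, 0], [0, 1], [1, 1 :: nat]]"
      then consider "p = [0, 0]" | "p = [1, 0]" | "p = [0, 1]" | "p = [1, 1]" by auto
      then show "\<exists>A\<subseteq>verts G. map (\<lambda>e. of_bool (cuts_edge A e)) [e, f] = p"
      proof cases
        case 1 then show ?thesis by (intro exI[of _ "{}"]) simp
      next
        case 2 then show ?thesis using ca verts by (intro exI[of _ "{a}"]) simp
      next
        case 3 then show ?thesis using ca verts by (intro exI[of _ "{b}"]) simp
      next
        case 4 then show ?thesis using ca verts by (intro exI[of _ "{a, b}"]) simp
      qed
    qed (use two in auto)
    then show ?thesis
      by (rule freiman_if_patterns[OF G, of "[e, f]", where cs = "[[1, 0], [0, 1]]" and ws = "[[1, 0], [0, 1]]", rotated 3])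
         (use two in \<open>simp_all add: pairing_def pattern_sumset_def choose_two all_less_Suc_conv\<close>)
  next
    assume "is_triangle (edges G)"
    then obtain a b c where abc: "distinct [a, b, c]" "edges G = {{a, b}, {b, c}, {a, c}}"
      unfolding is_triangle_def by blast
    have verts: "{a, b, c} \<subseteq> verts G" using G abc(2) by (auto simp: simple_graph_def)
    have ne: "b \<noteq> a" "c \<noteq> a" "c \<noteq> b" using abc(1) by auto
    let ?es = "[{a, b}, {b, c}, {a, c}]"
    have "edge_code ?es ` cut_exps G = set [[0, 0, 0], [1, 0, 1], [1, 1, 0], [0, 1, 1]]"
    proof (rule edge_code_cut_exps[OF G])
      show "map (\<lambda>e. of_bool (cuts_edge A e)) ?es \<in> set [[0, 0, 0], [1, 0, 1], [1, 1, 0], [0, 1, 1 :: nat]]" for A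
        using abc(1) by (cases "a \<in> A"; cases "b \<in> A"; cases "c \<in> A") (simp_all add: cuts_edge_pair)
      fix p assume "p \<in> set [[0, 0, 0], [1, 0, 1], [1, 1, 0], [0, 1, 1 :: nat]]"
      then consider "p = [0, 0, 0]" | "p = [1, 0, 1]" | "p = [1, 1, 0]" | "p = [0, 1, 1]" by auto
      then show "\<exists>A\<subseteq>verts G. map (\<lambda>e. of_bool (cuts_edge A e)) ?es = p"
      proof cases
        case 1 then show ?thesis by (intro exI[of _ "{}"]) simp
      next
        case 2 then show ?thesis using abc(1) verts by (intro exI[of _ "{a}"]) (auto simp: cuts_edge_pair)
      next
        case 3 then show ?thesis using abc(1) verts by (intro exI[of _ "{b}"]) (auto simp: cuts_edge_pair)
      next
        case 4 then show ?thesis using abc(1) verts by (intro exI[of _ "{c}"]) (auto simp: cuts_edge_pair)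
      qed
    qed (use abc in auto)
    then show ?thesis
      by (rule freiman_if_patterns[OF G, of ?es,
            where cs = "[[1, 1, -1], [1, -1, 1], [-1, 1, 1]]" and ws = "[[1, 1, 0], [1, 0, 1], [0, 1, 1]]", rotated 3])
         (use abc ne in \<open>simp_all add: pairing_def pattern_sumset_def choose_two all_less_Suc_conv doubleton_eq_iff\<close>)
  next
    fix D f assume four: "is_triangle D" "f \<notin> D" "edges G = insert f D"
    obtain a b c where abc: "distinct [a, b, c]" "D = {{a, b}, {b, c}, {a, c}}"
      using four(1) unfolding is_triangle_def by blast
    have f: "f \<in> edges G" using four by blast
    obtain p q where pq: "f = {p, q}" "p \<noteq> q" "p \<notin> {a, b, c}"
      by (rule edge_not_in_triangle[of f a b c]) (use edge[OF f] four(2) abc(2) in blast)+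
    have verts: "{a, b, c, p} \<subseteq> verts G" using G four(3) abc(2) pq(1) by (auto simp: simple_graph_def)
    have ne: "b \<noteq> a" "c \<noteq> a" "c \<noteq> b" "a \<noteq> p" "b \<noteq> p" "c \<noteq> p" using abc(1) pq(3) by auto
    let ?es = "[{a, b}, {b, c}, {a, c}, {p, q}]"
    let ?pats = "[[0, 0, 0, 0], [1, 0, 1, 0], [1, 1, 0, 0], [0, 1, 1, 0], [0, 0, 0, 1], [1, 0, 1, 1], [1, 1, 0, 1], [0, 1, 1, 1]] :: nat list list"
    have set_es: "set ?es = edges G" using four(3) abc(2) pq(1) by auto
    have "edge_code ?es ` cut_exps G = set ?pats"
    proof (rule edge_code_cut_exps[OF G])
      show "set ?es = edges G" by (rule set_es)
      show "map (\<lambda>e. of_bool (cuts_edge A e)) ?es \<in> set ?pats" for A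
        using abc(1) by (cases "a \<in> A"; cases "b \<in> A"; cases "c \<in> A") (simp_all add: cuts_edge_pair)
      fix v assume v: "v \<in> set ?pats"
      have tri: "\<exists>B\<subseteq>{a, b, c}. map (\<lambda>e. of_bool (cuts_edge B e)) [{a, b}, {b, c}, {a, c}] = take 3 v"
      proof -
        consider "take 3 v = [0, 0, 0]" | "take 3 v = [1, 0, 1]" | "take 3 v = [1, 1, 0]" | "take 3 v = [0, 1, 1]"
          using v by (auto simp: numeral_3_eq_3)
        then show ?thesis
        proof cases
          case 1 then show ?thesis by (intro exI[of _ "{}"]) simp
        next
          case 2 then show ?thesis using abc(1) by (intro exI[of _ "{a}"]) (auto simp: cuts_edge_pair)
        next
          case 3 then show ?thesis using abc(1) by (intro exI[of _ "{b}"]) (auto simp: cuts_edge_pair)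
        next
          case 4 then show ?thesis using abc(1) by (intro exI[of _ "{c}"]) (auto simp: cuts_edge_pair)
        qed
      qed
      then obtain B where B: "B \<subseteq> {a, b, c}"
        "map (\<lambda>e. of_bool (cuts_edge B e)) [{a, b}, {b, c}, {a, c}] = take 3 v" by blast
      have same: "cuts_edge (insert p B) {x, y} = cuts_edge B {x, y}" if "x \<noteq> y" "x \<in> {a, b, c}" "y \<in> {a, b, c}" for x y
        using that pq(3) by (auto simp: cuts_edge_pair)
      have flip: "cuts_edge (insert p B) {p, q} \<longleftrightarrow> \<not> cuts_edge B {p, q}"
        using pq B(1) by (auto simp: cuts_edge_pair)
      have v4: "v = take 3 v @ [v ! 3]" "v ! 3 = 0 \<or> v ! 3 = 1" using v by (auto simp: numeral_3_eq_3)
      \<comment> \<open>The side of \<open>p\<close> is chosen to adjust the last entry.\<close>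
      define A where "A = (if (v ! 3 = 1) = cuts_edge B {p, q} then B else insert p B)"
      have "map (\<lambda>e. of_bool (cuts_edge A e)) [{a, b}, {b, c}, {a, c}] = take 3 v"
        using B(2) same abc(1) by (auto simp: A_def)
      moreover have "of_bool (cuts_edge A {p, q}) = v ! 3"
        using flip v4(2) by (auto simp: A_def)
      ultimately have "map (\<lambda>e. of_bool (cuts_edge A e)) ?es = v" by (subst v4(1)) simp
      moreover have "A \<subseteq> verts G" using B(1) verts by (auto simp: A_def)
      ultimately show "\<exists>A\<subseteq>verts G. map (\<lambda>e. of_bool (cuts_edge A e)) ?es = v" by blast
    qed
    then show ?thesis
      by (rule freiman_if_patterns[OF G, of ?es,
            where cs = "[[1, 1, -1, 0], [1, -1, 1, 0], [-1, 1, 1, 0], [0, 0, 0, 1]]"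
              and ws = "[[1, 1, 0, 0], [1, 0, 1, 0], [0, 1, 1, 0], [0, 0, 0, 1]]", rotated 3])
         (use abc ne pq four set_es in \<open>simp_all add: pairing_def pattern_sumset_def choose_two all_less_Suc_conv doubleton_eq_iff\<close>)
  qed
qed

section \<open>Recognising the six graphs\<close>

text \<open>Reading an isomorphism backwards, as an embedding of the fixed graph, turns its existence into set equations
  that can be checked on explicit vertex lists.\<close>

lemma graph_iso_iff:
  assumes H: "simple_graph H" and T: "simple_graph T"
  shows "graph_iso H T \<longleftrightarrow>
    (\<exists>g. inj_on g (verts T) \<and> verts H = g ` verts T \<and> edges H = (`) g ` edges T)"
proof
  assume "graph_iso H T"
  then obtain f where f: "bij_betw f (verts H) (verts T)"
    "\<And>u v. u \<in> verts H \<Longrightarrow> v \<in> verts H \<Longrightarrow> {u, v} \<in> edges H \<longleftrightarrow> {f u, f v} \<in> edges T"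
    unfolding graph_iso_def by blast
  define g where "g = inv_into (verts H) f"
  have g: "bij_betw g (verts T) (verts H)" unfolding g_def by (rule bij_betw_inv_into[OF f(1)])
  have gf: "g (f u) = u" if "u \<in> verts H" for u
    unfolding g_def by (rule bij_betw_inv_into_left[OF f(1) that])
  have fg: "f (g x) = x" if "x \<in> verts T" for x
    unfolding g_def by (rule bij_betw_inv_into_right[OF f(1) that])
  have gV: "g x \<in> verts H" if "x \<in> verts T" for x using g that by (auto simp: bij_betw_def)
  have "edges H = (`) g ` edges T"
  proof (intro equalityI subsetI)
    fix e assume e: "e \<in> edges H"
    obtain u v where uv: "e = {u, v}" "u \<noteq> v" "u \<in> verts H" "v \<in> verts H" by (rule edge_pair[OF H e])
    then have "{f u, f v} \<in> edges T" using f(2) e by simp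
    moreover have "e = g ` {f u, f v}" using uv gf by simp
    ultimately show "e \<in> (`) g ` edges T" by blast
  next
    fix e assume "e \<in> (`) g ` edges T"
    then obtain e' where e': "e' \<in> edges T" "e = g ` e'" by blast
    obtain x y where xy: "e' = {x, y}" "x \<noteq> y" "x \<in> verts T" "y \<in> verts T" by (rule edge_pair[OF T e'(1)])
    have "{g x, g y} \<in> edges H"
      using f(2)[OF gV[OF xy(3)] gV[OF xy(4)]] e'(1) xy by (simp add: fg)
    then show "e \<in> edges H" using e'(2) xy(1) by simp
  qed
  then show "\<exists>g. inj_on g (verts T) \<and> verts H = g ` verts T \<and> edges H = (`) g ` edges T"
    using g by (intro exI[of _ g]) (auto simp: bij_betw_def)
next
  assume "\<exists>g. inj_on g (verts T) \<and> verts H = g ` verts T \<and> edges H = (`) g ` edges T"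
  then obtain g where g: "inj_on g (verts T)" "verts H = g ` verts T" "edges H = (`) g ` edges T" by blast
  define f where "f = inv_into (verts T) g"
  have fg: "f (g x) = x" if "x \<in> verts T" for x unfolding f_def by (rule inv_into_f_f[OF g(1) that])
  have "bij_betw f (verts H) (verts T)"
    unfolding f_def g(2) by (rule inj_on_imp_bij_betw[OF g(1), THEN bij_betw_inv_into])
  moreover have "{u, v} \<in> edges H \<longleftrightarrow> {f u, f v} \<in> edges T" if uv: "u \<in> verts H" "v \<in> verts H" for u v
  proof -
    obtain x y where xy: "x \<in> verts T" "u = g x" "y \<in> verts T" "v = g y" using uv g(2) by blast
    have sub: "e \<subseteq> verts T" if "e \<in> edges T" for e using T that by (simp add: simple_graph_def)
    have "g ` {x, y} \<in> (`) g ` edges T \<longleftrightarrow> {x, y} \<in> edges T"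
    proof
      assume "g ` {x, y} \<in> (`) g ` edges T"
      then obtain e where e: "e \<in> edges T" "g ` {x, y} = g ` e" by blast
      then have "{x, y} = e" using inj_on_image_eq_iff[OF g(1), of "{x, y}" e] sub xy by simp
      then show "{x, y} \<in> edges T" using e by simp
    qed blast
    then show ?thesis using xy by (simp add: g(3) fg)
  qed
  ultimately show "graph_iso H T" unfolding graph_iso_def by blast
qed

lemma triangle_image:
  assumes "is_triangle D" "inj_on g (\<Union>D)"
  shows "is_triangle ((`) g ` D)"
proof -
  obtain a b c where abc: "distinct [a, b, c]" "D = {{a, b}, {b, c}, {a, c}}"
    using assms(1) unfolding is_triangle_def by blast
  have "g a \<noteq> g b" "g b \<noteq> g c" "g a \<noteq> g c"
    using abc assms(2) by (auto simp: inj_on_def)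
  then show ?thesis unfolding is_triangle_def abc(2)
    by (intro exI[of _ "g a"] exI[of _ "g b"] exI[of _ "g c"]) simp
qed

lemma freiman_shape_image:
  assumes "freiman_shape E" "inj_on g (\<Union>E)"
  shows "freiman_shape ((`) g ` E)"
  using assms(1) unfolding freiman_shape_def[of E]
proof (elim disjE exE conjE)
  fix e assume "E = {e}"
  then show ?thesis by (simp add: freiman_shapeI(1))
next
  fix e f assume ef: "e \<noteq> f" "E = {e, f}"
  then have "g ` e \<noteq> g ` f" using inj_on_image_eq_iff[OF assms(2), of e f] by auto
  then show ?thesis using ef(2) by (simp add: freiman_shapeI(2))
next
  assume "is_triangle E"
  then show ?thesis by (intro freiman_shapeI(3) triangle_image assms(2))
next
  fix D f assume D: "is_triangle D" "f \<notin> D" "E = insert f D"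
  have "inj_on g (\<Union>D)" by (rule inj_on_subset[OF assms(2)]) (use D in auto)
  then have "is_triangle ((`) g ` D)" by (rule triangle_image[OF D(1)])
  moreover have "g ` f \<notin> (`) g ` D"
  proof
    assume "g ` f \<in> (`) g ` D"
    then obtain e where "e \<in> D" "g ` f = g ` e" by blast
    moreover have "f \<subseteq> \<Union>E" "e \<subseteq> \<Union>E" using D calculation(1) by auto
    ultimately have "f = e" using inj_on_image_eq_iff[OF assms(2), of f e] by simp
    then show False using D(2) \<open>e \<in> D\<close> by simp
  qed
  ultimately show ?thesis using D(3) by (simp add: freiman_shapeI(4))
qed

lemma two_subsets:
  "{e. e \<subseteq> {a, b} \<and> card e = 2} = (if a = b then {} else {{a, b}})"
  "distinct [a, b, c] \<Longrightarrow> {e. e \<subseteq> {a, b, c} \<and> card e = 2} = {{a, b}, {b, c}, {a, c}}"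
proof -
  show "{e. e \<subseteq> {a, b} \<and> card e = 2} = (if a = b then {} else {{a, b}})"
    by (auto simp: card_2_iff doubleton_eq_iff)
  assume "distinct [a, b, c]"
  then show "{e. e \<subseteq> {a, b, c} \<and> card e = 2} = {{a, b}, {b, c}, {a, c}}"
    by (auto simp: card_2_iff doubleton_eq_iff)
qed

lemma lessThan_small: "{..<2} = {0, 1 :: nat}" "{..<3} = {0, 1, 2 :: nat}"
  by auto

lemma K2_eq: "K_graph 2 = ({0, 1}, {{0, 1}})"
  unfolding complete_graph_def lessThan_small two_subsets by simp

lemma K3_eq: "K_graph 3 = ({0, 1, 2}, {{0, 1}, {1, 2}, {0, 2}})"
  unfolding complete_graph_def lessThan_small by (simp add: two_subsets(2))

lemma P3_eq: "path_graph 3 = ({0, 1, 2}, {{0, 1}, {1, 2}})"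
proof -
  have "{{i, Suc i} | i. Suc i < 3} = (\<lambda>i. {i, Suc i}) ` {i. Suc i < 3}" by blast
  also have "{i. Suc i < 3} = {0, 1}" by auto
  finally have "{{i, Suc i} | i. Suc i < 3} = {{0, 1}, {1, 2}}" by (simp add: numeral_2_eq_2)
  then show ?thesis unfolding path_graph_def lessThan_small by simp
qed

lemma K2_K2_eq: "graph_disjoint_union (K_graph 2) (K_graph 2) =
  ({Inl 0, Inl 1, Inr 0, Inr 1}, {{Inl 0, Inl 1}, {Inr 0, Inr 1}})"
  unfolding graph_disjoint_union_def K2_eq by auto

lemma K2_K3_eq: "graph_disjoint_union (K_graph 2) (K_graph 3) =
  ({Inl 0, Inl 1, Inr 0, Inr 1, Inr 2},
   {{Inl 0, Inl 1}, {Inr 0, Inr 1}, {Inr 1, Inr 2}, {Inr 0, Inr 2}})"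
  unfolding graph_disjoint_union_def K2_eq K3_eq by auto

lemma K2_glue_K3_eq: "K2_glue_K3 = ({0, 1, 2, 3}, {{0, 1}, {1, 2}, {2, 3}, {1, 3}})"
  unfolding K2_glue_K3_def complete_graph_def by (auto simp: two_subsets)

lemma simple_small_graphs:
  "simple_graph (K_graph 2)" "simple_graph (K_graph 3)" "simple_graph (path_graph 3)"
  "simple_graph (graph_disjoint_union (K_graph 2) (K_graph 2))"
  "simple_graph (graph_disjoint_union (K_graph 2) (K_graph 3))" "simple_graph K2_glue_K3"
proof -
  show "simple_graph (K_graph 2)" unfolding K2_eq by (simp add: simple_graph_def)
  show "simple_graph (K_graph 3)" unfolding K3_eq by (simp add: simple_graph_def)
  show "simple_graph (path_graph 3)" unfolding P3_eq by (simp add: simple_graph_def)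
  show "simple_graph (graph_disjoint_union (K_graph 2) (K_graph 2))"
    unfolding K2_K2_eq by (simp add: simple_graph_def)
  show "simple_graph (graph_disjoint_union (K_graph 2) (K_graph 3))"
    unfolding K2_K3_eq by (simp add: simple_graph_def)
  show "simple_graph K2_glue_K3" unfolding K2_glue_K3_eq by (simp add: simple_graph_def)
qed

lemma triangleI: "distinct [a, b, c] \<Longrightarrow> is_triangle {{a, b}, {b, c}, {a, c}}"
  unfolding is_triangle_def by blast

lemma shape_small_graphs:
  "freiman_shape (edges (K_graph 2))" "freiman_shape (edges (K_graph 3))"
  "freiman_shape (edges (path_graph 3))"
  "freiman_shape (edges (graph_disjoint_union (K_graph 2) (K_graph 2)))"
  "freiman_shape (edges (graph_disjoint_union (K_graph 2) (K_graph 3)))"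
  "freiman_shape (edges K2_glue_K3)"
proof -
  show "freiman_shape (edges (K_graph 2))" unfolding K2_eq by (simp add: freiman_shapeI(1))
  show "freiman_shape (edges (K_graph 3))" unfolding K3_eq snd_conv
    by (intro freiman_shapeI(3) triangleI) simp
  show "freiman_shape (edges (path_graph 3))" unfolding P3_eq snd_conv
    by (intro freiman_shapeI(2)) (simp add: doubleton_eq_iff)
  show "freiman_shape (edges (graph_disjoint_union (K_graph 2) (K_graph 2)))" unfolding K2_K2_eq snd_conv
    by (intro freiman_shapeI(2)) (simp add: doubleton_eq_iff)
  show "freiman_shape (edges (graph_disjoint_union (K_graph 2) (K_graph 3)))" unfolding K2_K3_eq snd_conv
    by (intro freiman_shapeI(4) triangleI) (simp_all add: doubleton_eq_iff)
  show "freiman_shape (edges K2_glue_K3)" unfolding K2_glue_K3_eq snd_conv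
    by (intro freiman_shapeI(4) triangleI) (simp_all add: doubleton_eq_iff)
qed

lemma graph_isoI:
  assumes "simple_graph H" "verts H = \<Union>(edges H)" "T = (W, F)" "simple_graph T"
    and "inj_on g W" "\<Union>(edges H) = g ` W" "edges H = (`) g ` F"
  shows "graph_iso H T"
  using assms(2,3,5-7) by (intro graph_iso_iff[OF assms(1,4), THEN iffD2] exI[of _ g]) simp

lemma freiman_shape_graph_iso:
  assumes "graph_iso H T" "simple_graph H" "simple_graph T" "freiman_shape (edges T)"
  shows "freiman_shape (edges H)"
proof -
  obtain g where g: "inj_on g (verts T)" "edges H = (`) g ` edges T"
    using graph_iso_iff[OF assms(2,3)] assms(1) by blast
  have "\<Union>(edges T) \<subseteq> verts T" using assms(3) by (auto simp: simple_graph_def)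
  then show ?thesis
    unfolding g(2) by (intro freiman_shape_image[OF assms(4)] inj_on_subset[OF g(1)])
qed

text \<open>Two edges are disjoint or form a path, and the end \<open>q\<close> of the edge added to a triangle lies on the triangle or not.\<close>

theorem small_graph_iso_iff:
  fixes H :: "'a ugraph"
  assumes H: "simple_graph H" and no_isolated: "verts H = \<Union>(edges H)"
  shows "freiman_shape (edges H) \<longleftrightarrow>
    graph_iso H (K_graph 2) \<or> graph_iso H (K_graph 3) \<or> graph_iso H (path_graph 3) \<or>
    graph_iso H (graph_disjoint_union (K_graph 2) (K_graph 2)) \<or>
    graph_iso H (graph_disjoint_union (K_graph 2) (K_graph 3)) \<or>
    graph_iso H K2_glue_K3" (is "_ \<longleftrightarrow> ?iso")
proof
  show "freiman_shape (edges H)" if ?iso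
    using that
    by (elim disjE) (erule freiman_shape_graph_iso, rule H, rule simple_small_graphs, rule shape_small_graphs)+
next
  note iso = graph_isoI[OF H no_isolated]
  have edge: "\<exists>a b. e = {a, b} \<and> a \<noteq> b" if e: "e \<in> edges H" for e
  proof -
    obtain a b where "e = {a, b}" "a \<noteq> b" by (rule edge_pair[OF H e])
    then show ?thesis by blast
  qed
  assume "freiman_shape (edges H)"
  then show ?iso
    unfolding freiman_shape_def
  proof (elim disjE exE conjE)
    fix e assume e: "edges H = {e}"
    then obtain a b where ab: "e = {a, b}" "a \<noteq> b" using edge by blast
    have "graph_iso H (K_graph 2)"
    proof (rule iso[OF K2_eq simple_small_graphs(1)])
      let ?g = "\<lambda>i. if i = (0 :: nat) then a else b"
      show "inj_on ?g {0, 1}" using ab by (auto simp: inj_on_def)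
      show "\<Union>(edges H) = ?g ` {0, 1}" unfolding e ab(1) by auto
      show "edges H = (`) ?g ` {{0, 1}}" unfolding e ab(1) by (simp add: insert_commute)
    qed
    then show ?iso by blast
  next
    fix e f assume ef: "e \<noteq> f" "edges H = {e, f}"
    then have "e \<in> edges H" "f \<in> edges H" by simp_all
    then obtain a b c d where ab: "e = {a, b}" "a \<noteq> b" and cd: "f = {c, d}" "c \<noteq> d"
      using edge by metis
    have path: "graph_iso H (path_graph 3)"
      if xyz: "edges H = {{x, y}, {y, z}}" "distinct [x, y, z]" for x y z
    proof (rule iso[OF P3_eq simple_small_graphs(3)])
      let ?g = "\<lambda>i. if i = (0 :: nat) then x else if i = 1 then y else z"
      show "inj_on ?g {0, 1, 2}" using xyz(2) by (auto simp: inj_on_def)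
      show "\<Union>(edges H) = ?g ` {0, 1, 2}" unfolding xyz(1) by auto
      show "edges H = (`) ?g ` {{0, 1}, {1, 2}}" unfolding xyz(1) by (simp add: insert_commute)
    qed
    consider "a = c" | "a = d" | "b = c" | "b = d" | "distinct [a, b, c, d]" using ab cd by auto
    then show ?iso
    proof cases
      case 1
      have "graph_iso H (path_graph 3)"
        by (rule path[of b a d]) (use ef ab cd 1 in \<open>auto simp: insert_commute\<close>)
      then show ?thesis by blast
    next
      case 2
      have "graph_iso H (path_graph 3)"
        by (rule path[of b a c]) (use ef ab cd 2 in \<open>auto simp: insert_commute\<close>)
      then show ?thesis by blast
    next
      case 3
      have "graph_iso H (path_graph 3)"
        by (rule path[of a b d]) (use ef ab cd 3 in \<open>auto simp: insert_commute\<close>)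
      then show ?thesis by blast
    next
      case 4
      have "graph_iso H (path_graph 3)"
        by (rule path[of a b c]) (use ef ab cd 4 in \<open>auto simp: insert_commute\<close>)
      then show ?thesis by blast
    next
      case 5
      have "graph_iso H (graph_disjoint_union (K_graph 2) (K_graph 2))"
    proof (rule iso[OF K2_K2_eq simple_small_graphs(4)])
      let ?g = "case_sum (\<lambda>i. if i = (0 :: nat) then a else b) (\<lambda>i. if i = (0 :: nat) then c else d)"
      show "inj_on ?g {Inl 0, Inl 1, Inr 0, Inr 1}" using 5 by (auto simp: inj_on_def)
      show "\<Union>(edges H) = ?g ` {Inl 0, Inl 1, Inr 0, Inr 1}" unfolding ef(2) ab(1) cd(1) by auto
      show "edges H = (`) ?g ` {{Inl 0, Inl 1}, {Inr 0, Inr 1}}" unfolding ef(2) ab(1) cd(1) by (simp add: insert_commute)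
    qed
      then show ?thesis by blast
    qed
  next
    assume "is_triangle (edges H)"
    then obtain a b c where abc: "distinct [a, b, c]" "edges H = {{a, b}, {b, c}, {a, c}}"
      unfolding is_triangle_def by blast
    have "graph_iso H (K_graph 3)"
    proof (rule iso[OF K3_eq simple_small_graphs(2)])
      let ?g = "\<lambda>i. if i = (0 :: nat) then a else if i = 1 then b else c"
      show "inj_on ?g {0, 1, 2}" using abc(1) by (auto simp: inj_on_def)
      show "\<Union>(edges H) = ?g ` {0, 1, 2}" unfolding abc(2) by auto
      show "edges H = (`) ?g ` {{0, 1}, {1, 2}, {0, 2}}" unfolding abc(2) by (simp add: insert_commute)
    qed
    then show ?iso by blast
  next
    fix D f assume D: "is_triangle D" "f \<notin> D" "edges H = insert f D"
    obtain a b c where abc: "distinct [a, b, c]" "D = {{a, b}, {b, c}, {a, c}}"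
      using D(1) unfolding is_triangle_def by blast
    have f: "f \<in> edges H" using D(3) by simp
    obtain p q where pq: "f = {p, q}" "p \<noteq> q" "p \<notin> {a, b, c}"
      by (rule edge_not_in_triangle[of f a b c]) (use edge[OF f] D(2) abc(2) in blast)+
    have glue: "graph_iso H K2_glue_K3"
      if xyz: "edges H = {{p, x}, {x, y}, {y, z}, {x, z}}" "distinct [p, x, y, z]" for x y z
    proof (rule iso[OF K2_glue_K3_eq simple_small_graphs(6)])
      let ?g = "\<lambda>i. if i = (0 :: nat) then p else if i = 1 then x else if i = 2 then y else z"
      show "inj_on ?g {0, 1, 2, 3}" using xyz(2) by (auto simp: inj_on_def)
      show "\<Union>(edges H) = ?g ` {0, 1, 2, 3}" unfolding xyz(1) by auto
      show "edges H = (`) ?g ` {{0, 1}, {1, 2}, {2, 3}, {1, 3}}" unfolding xyz(1) by (simp add: insert_commute)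
    qed
    consider "q = a" | "q = b" | "q = c" | "q \<notin> {a, b, c}" by blast
    then show ?iso
    proof cases
      case 1
      have "graph_iso H K2_glue_K3"
        by (rule glue[of a b c]) (use D abc pq 1 in \<open>auto simp: insert_commute\<close>)
      then show ?thesis by blast
    next
      case 2
      have "graph_iso H K2_glue_K3"
        by (rule glue[of b a c]) (use D abc pq 2 in \<open>auto simp: insert_commute\<close>)
      then show ?thesis by blast
    next
      case 3
      have "graph_iso H K2_glue_K3"
        by (rule glue[of c a b]) (use D abc pq 3 in \<open>auto simp: insert_commute\<close>)
      then show ?thesis by blast
    next
      case 4
      have "graph_iso H (graph_disjoint_union (K_graph 2) (K_graph 3))"
    proof (rule iso[OF K2_K3_eq simple_small_graphs(5)])
      let ?g = "case_sum (\<lambda>i. if i = (0 :: nat) then p else q) (\<lambda>i. if i = (0 :: nat) then a else if i = 1 then b else c)"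
      show "inj_on ?g {Inl 0, Inl 1, Inr 0, Inr 1, Inr 2}" using 4 abc(1) pq(2,3) by (auto simp: inj_on_def)
      show "\<Union>(edges H) = ?g ` {Inl 0, Inl 1, Inr 0, Inr 1, Inr 2}" unfolding D(3) abc(2) pq(1) by auto
      show "edges H = (`) ?g ` {{Inl 0, Inl 1}, {Inr 0, Inr 1}, {Inr 1, Inr 2}, {Inr 0, Inr 2}}" unfolding D(3) abc(2) pq(1) by (simp add: insert_commute)
    qed
      then show ?thesis by blast
    qed
  qed
qed

theorem theorem6p2:
  fixes G :: "'a ugraph"
  assumes "simple_graph G" and "edges G \<noteq> {}"
  shows "freiman_ideal (cut_vars G) (cut_ideal G :: ('a set cut_var, 'k::field) mpoly set) \<longleftrightarrow>
    (let H = delete_isolated G in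
       graph_iso H (K_graph 2) \<or>
       graph_iso H (K_graph 3) \<or>
       graph_iso H (path_graph 3) \<or>
       graph_iso H (graph_disjoint_union (K_graph 2) (K_graph 2)) \<or>
       graph_iso H (graph_disjoint_union (K_graph 2) (K_graph 3)) \<or>
       graph_iso H K2_glue_K3)"
proof -
  let ?H = "delete_isolated G"
  have edges: "edges ?H = edges G" by (simp add: delete_isolated_def)
  have "simple_graph ?H" "verts ?H = \<Union>(edges ?H)"
    using assms(1) by (auto simp: simple_graph_def delete_isolated_def)
  note iso = small_graph_iso_iff[OF this]
  have "freiman_ideal (cut_vars G) (cut_ideal G :: ('a set cut_var, 'k) mpoly set) \<longleftrightarrow> freiman_shape (edges G)"
    using freiman_shape_if_freiman[OF assms] freiman_if_shape[OF assms(1)] by blast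
  then show ?thesis unfolding Let_def using iso unfolding edges by blast
qed

end
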